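(* Let $A$, $P$, $L$ be as in the context. Define, with infima/suprema taken over all sequences $\{x_n\}\subset D(L)\setminus\{0\}$ such that $x_n/\|x_n\|\rightharpoonup0$ and $Lx_n/\|Lx_n\|\rightharpoonup0$ weakly, $$m_i:=\inf\liminf_{n\to\infty}\mu_i(x_n),\qquad M_i:=\sup\limsup_{n\to\infty}\mu_i(x_n),\qquad i=1,2,$$ (values in $\mathbb R\cup\{\pm\infty\}$). Then $[m_1,M_1]\cup[m_2,M_2]\subseteq\overline{\mathrm{Spu}(A,P,L)}\cup\hat\sigma_{\rm ess}(A)$.
   Context: $A$ is a self-adjoint operator on a separable Hilbert space $\mathfrak H$ with dense domain $D(A)$ (graph norm $\|x\|^2+\|Ax\|^2$), $P$ an orthogonal projector on $\mathfrak H$, and $L:D(L)\subset P\mathfrak H\to(1-P)\mathfrak H$ an injective linear operator such that $D(L)\oplus LD(L)\subset D(A)$ is a core for $A$. It is assumed that $PAP$ is essentially self-adjoint on $D(L)$ and $(1-P)A(1-P)$ is essentially self-adjoint on $LD(L)$. For a finite-dimensional $V\subset D(A)$, $A_{|V}$ is the restriction of $P_VAP_V$ to $V$. For $0\ne x\in D(L)$, $\mu_1(x)\le\mu_2(x)$ are the two eigenvalues of $A_{|\mathrm{span}\{x,Lx\}}$ (the $2\times2$ matrix of $A$ on $x\mathbb C\oplus Lx\,\mathbb C$). $\lambda\in\mathbb R$ is a $(P,L)$-spurious eigenvalue, $\lambda\in\mathrm{Spu}(A,P,L)$, if there exist finite-dimensional subspaces $V_n^+\subset D(L)$, $V_n^+\subset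 V_{n+1}^+$, such that $\bigcup_n(V_n^+\oplus LV_n^+)$ is dense in $D(A)$ for the graph norm, $\lim_n\mathrm{dist}(\lambda,\sigma(A_{|V_n^+\oplus LV_n^+}))=0$, and $\lambda\notin\sigma(A)$. $\hat\sigma_{\rm ess}(A)$ is $\sigma_{\rm ess}(A)$ together with $-\infty$ (resp. $+\infty$) if $\sigma(A)$ is unbounded below (resp. above). Intervals are in the extended real line, $[c,d]=\emptyset$ if $d<c$. *)

theory Defs
  imports "HOL-Analysis.Analysis"
begin

text \<open>
  Encoding of a complex Hilbert space: a real Hilbert space (type class
  real_inner + complete_space) together with an orthogonal complex structure J
  (multiplication by the imaginary unit). The real inner product is the real
  part of the complex one; for J-invariant subspaces and J-commuting operators
  all orthogonality / adjointness conditions below are equivalent to their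
  complex counterparts.
\<close>

definition complex_structure :: "('a::real_inner \<Rightarrow> 'a) \<Rightarrow> bool" where
  "complex_structure J \<longleftrightarrow> linear J \<and> (\<forall>x. J (J x) = - x) \<and>
     (\<forall>x y. inner (J x) (J y) = inner x y)"

definition hilbert_separable :: "'a::real_normed_vector itself \<Rightarrow> bool" where
  "hilbert_separable _ \<longleftrightarrow> (\<exists>D::'a set. countable D \<and> closure D = UNIV)"

definition csubspace :: "('a::real_vector \<Rightarrow> 'a) \<Rightarrow> 'a set \<Rightarrow> bool" where
  "csubspace J V \<longleftrightarrow> subspace V \<and> (\<forall>v\<in>V. J v \<in> V)"

definition fin_csubspace :: "('a::real_vector \<Rightarrow> 'a) \<Rightarrow> 'a set \<Rightarrow> bool" where
  "fin_csubspace J V \<longleftrightarrow> csubspace J V \<and> (\<exists>B. finite B \<and> V = span B)"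

definition clinear_on :: "('a::real_vector \<Rightarrow> 'a) \<Rightarrow> 'a set \<Rightarrow> ('a \<Rightarrow> 'b::real_vector) \<Rightarrow> ('b \<Rightarrow> 'b) \<Rightarrow> bool" where
  "clinear_on J D T J' \<longleftrightarrow> csubspace J D \<and>
     (\<forall>x\<in>D. \<forall>y\<in>D. T (x + y) = T x + T y) \<and>
     (\<forall>c. \<forall>x\<in>D. T (c *\<^sub>R x) = c *\<^sub>R T x) \<and>
     (\<forall>x\<in>D. T (J x) = J' (T x))"

definition orth_projector :: "('a::real_inner \<Rightarrow> 'a) \<Rightarrow> ('a \<Rightarrow> 'a) \<Rightarrow> bool" where
  "orth_projector J P \<longleftrightarrow> bounded_linear P \<and> (\<forall>x. P (P x) = P x) \<and>
     (\<forall>x y. inner (P x) y = inner x (P y)) \<and> (\<forall>x. P (J x) = J (P x))"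

definition selfadjoint_in :: "('a::real_inner \<Rightarrow> 'a) \<Rightarrow> 'a set \<Rightarrow> ('a \<Rightarrow> 'a) \<Rightarrow> 'a set \<Rightarrow> bool" where
  "selfadjoint_in J K T D \<longleftrightarrow>
     clinear_on J D T J \<and> D \<subseteq> K \<and> K \<subseteq> closure D \<and> (\<forall>x\<in>D. T x \<in> K) \<and>
     (\<forall>x\<in>D. \<forall>y\<in>D. inner (T x) y = inner x (T y)) \<and>
     (\<forall>y\<in>K. \<forall>z\<in>K. (\<forall>x\<in>D. inner (T x) y = inner x z) \<longrightarrow> y \<in> D \<and> T y = z)"

definition graph_of :: "('a \<Rightarrow> 'b) \<Rightarrow> 'a set \<Rightarrow> ('a \<times> 'b) set" where
  "graph_of T D = {(x, T x) | x. x \<in> D}"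

definition ess_selfadjoint_in :: "('a::{real_inner} \<Rightarrow> 'a) \<Rightarrow> 'a set \<Rightarrow> ('a \<Rightarrow> 'a) \<Rightarrow> 'a set \<Rightarrow> bool" where
  "ess_selfadjoint_in J K T D \<longleftrightarrow>
     (let G = closure (graph_of T D) in
       (\<forall>x y z. (x, y) \<in> G \<and> (x, z) \<in> G \<longrightarrow> y = z) \<and>
       selfadjoint_in J K (\<lambda>x. THE y. (x, y) \<in> G) (fst ` G))"

definition is_core :: "('a::real_normed_vector \<Rightarrow> 'a) \<Rightarrow> 'a set \<Rightarrow> 'a set \<Rightarrow> bool" where
  "is_core T D W \<longleftrightarrow> W \<subseteq> D \<and> closure (graph_of T W) = graph_of T D"

text \<open>(real part of the) spectrum; for self-adjoint T the spectrum is real\<close>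
definition spec :: "('a::real_normed_vector \<Rightarrow> 'a) \<Rightarrow> 'a set \<Rightarrow> real set" where
  "spec T D = {l. \<not> (bij_betw (\<lambda>x. T x - l *\<^sub>R x) D UNIV \<and>
        (\<exists>C. \<forall>x\<in>D. norm x \<le> C * norm (T x - l *\<^sub>R x)))}"

definition disc_spec :: "('a::real_normed_vector \<Rightarrow> 'a) \<Rightarrow> 'a set \<Rightarrow> real set" where
  "disc_spec T D = {l\<in>spec T D. (\<exists>e>0. spec T D \<inter> ball l e = {l}) \<and>
        (\<exists>B. finite B \<and> {x\<in>D. T x = l *\<^sub>R x} = span B)}"

definition ess_spec :: "('a::real_normed_vector \<Rightarrow> 'a) \<Rightarrow> 'a set \<Rightarrow> real set" where
  "ess_spec T D = spec T D - disc_spec T D"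

definition hat_ess_spec :: "('a::real_normed_vector \<Rightarrow> 'a) \<Rightarrow> 'a set \<Rightarrow> ereal set" where
  "hat_ess_spec T D = ereal ` ess_spec T D
     \<union> (if bdd_below (spec T D) then {} else {-\<infinity>})
     \<union> (if bdd_above (spec T D) then {} else {\<infinity>})"

text \<open>spectrum of the compression A_{|W} = P_W A P_W restricted to the
  finite-dimensional (complex) subspace W, i.e. its eigenvalues\<close>
definition comp_spec :: "('a::real_inner \<Rightarrow> 'a) \<Rightarrow> 'a set \<Rightarrow> real set" where
  "comp_spec T W = {l. \<exists>v\<in>W. v \<noteq> 0 \<and> (\<forall>w\<in>W. inner w (T v) = l * inner w v)}"

definition dir_sum :: "('a \<Rightarrow> 'a) \<Rightarrow> 'a set \<Rightarrow> 'a::real_vector set" where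
  "dir_sum L V = {v + L w | v w. v \<in> V \<and> w \<in> V}"

definition pair_span :: "('a::real_vector \<Rightarrow> 'a) \<Rightarrow> ('a \<Rightarrow> 'a) \<Rightarrow> 'a \<Rightarrow> 'a set" where
  "pair_span J L x = span {x, J x, L x, J (L x)}"

definition mu1 :: "('a::real_inner \<Rightarrow> 'a) \<Rightarrow> ('a \<Rightarrow> 'a) \<Rightarrow> ('a \<Rightarrow> 'a) \<Rightarrow> 'a \<Rightarrow> real" where
  "mu1 J A L x = Min (comp_spec A (pair_span J L x))"

definition mu2 :: "('a::real_inner \<Rightarrow> 'a) \<Rightarrow> ('a \<Rightarrow> 'a) \<Rightarrow> ('a \<Rightarrow> 'a) \<Rightarrow> 'a \<Rightarrow> real" where
  "mu2 J A L x = Max (comp_spec A (pair_span J L x))"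

text \<open>weak convergence to 0 (real parts suffice, as Im<y,u> = Re<Jy,u>)\<close>
definition weak_to_zero :: "(nat \<Rightarrow> 'a::real_inner) \<Rightarrow> bool" where
  "weak_to_zero u \<longleftrightarrow> (\<forall>y. ((\<lambda>n. inner y (u n)) \<longlongrightarrow> 0) sequentially)"

definition adm_seq :: "('a::real_inner \<Rightarrow> 'a) \<Rightarrow> 'a set \<Rightarrow> (nat \<Rightarrow> 'a) \<Rightarrow> bool" where
  "adm_seq L DL xs \<longleftrightarrow> (\<forall>n. xs n \<in> DL \<and> xs n \<noteq> 0) \<and>
     weak_to_zero (\<lambda>n. xs n /\<^sub>R norm (xs n)) \<and>
     weak_to_zero (\<lambda>n. L (xs n) /\<^sub>R norm (L (xs n)))"

definition inf_liminf :: "('a::real_inner \<Rightarrow> 'a) \<Rightarrow> 'a set \<Rightarrow> ('a \<Rightarrow> real) \<Rightarrow> ereal" where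
  "inf_liminf L DL f = Inf {liminf (\<lambda>n. ereal (f (xs n))) | xs. adm_seq L DL xs}"

definition sup_limsup :: "('a::real_inner \<Rightarrow> 'a) \<Rightarrow> 'a set \<Rightarrow> ('a \<Rightarrow> real) \<Rightarrow> ereal" where
  "sup_limsup L DL f = Sup {limsup (\<lambda>n. ereal (f (xs n))) | xs. adm_seq L DL xs}"

definition spu :: "('a::real_inner \<Rightarrow> 'a) \<Rightarrow> ('a \<Rightarrow> 'a) \<Rightarrow> 'a set \<Rightarrow> ('a \<Rightarrow> 'a) \<Rightarrow> 'a set \<Rightarrow> real set" where
  "spu J A DA L DL = {l. l \<notin> spec A DA \<and>
     (\<exists>V::nat \<Rightarrow> 'a set.
        (\<forall>n. fin_csubspace J (V n) \<and> V n \<subseteq> DL \<and> V n \<subseteq> V (Suc n)) \<and>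
        graph_of A DA \<subseteq> closure (graph_of A (\<Union>n. dir_sum L (V n))) \<and>
        (\<forall>e>0. eventually (\<lambda>n. \<exists>m\<in>comp_spec A (dir_sum L (V n)). \<bar>l - m\<bar> < e) sequentially))}"

end

theory Submission
  imports Defs
begin

text \<open>Write \<open>Q\<^sub>s(u) = \<langle>u, A u\<rangle> - s \<parallel>u\<parallel>\<^sup>2\<close> and call \<open>V \<oplus> L V\<close> a block. A block that is
  almost orthogonal to a finite set of vectors containing a basis of an earlier block \<open>U\<close> and its
  image \<open>A U\<close> decouples from \<open>U\<close>, so eigenvalues of such blocks can be appended one after the
  other and become spurious. Replacing \<open>A\<close> by \<open>- A\<close>, only \<open>\<mu>\<^sub>1\<close> has to be treated. A point strictly
  between \<open>m\<^sub>1\<close> and \<open>M\<^sub>1\<close> is the lowest eigenvalue of some block on the segment joining a block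
  with a negative direction for \<open>Q\<close> to a remote block on which \<open>Q\<close> is positive.

  The delicate case is \<open>m\<^sub>1 = M\<^sub>1 = \<lambda>\<close> with \<open>\<lambda>\<close> in the discrete spectrum. Then every \<open>s < \<lambda>\<close> near
  \<open>\<lambda>\<close> is spurious. Either \<open>Q\<^sub>s\<close> has negative subspaces of every finite dimension; these may be
  moved into the core and cut with finitely many linear conditions, which gives negative blocks
  exactly orthogonal to any prescribed finite set, and the segment argument applies at \<open>s\<close>. Or
  \<open>Q\<^sub>s \<ge> 0\<close> up to finitely many dimensions; applying Cauchy--Schwarz for \<open>Q\<^sub>s\<close> to the weakly null
  eigenvectors \<open>v\<close> of \<open>\<mu>\<^sub>1\<close> and to \<open>(A - s)\<^sup>-\<^sup>1 v\<close> yields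
  \<open>(\<lambda> - s) \<langle>(A - s)\<^sup>-\<^sup>1 v, v\<rangle> \<rightarrow> 1\<close>, so that \<open>v\<close> approaches the finite-dimensional eigenspace of
  \<open>\<lambda>\<close>, which is impossible for a weakly null sequence of unit vectors.\<close>

section \<open>Bounded self-adjoint operators\<close>

text \<open>Points of the spectrum are never in \<open>spu\<close>, so a discrete eigenvalue can
  only be reached as a limit of spurious points. Inside a nondegenerate interval such limits are at
  hand. If the interval is the single point \<open>l\<close>, the points must be found outside it,
  from negative directions of the form that \<open>mu1\<close> along admissible sequences does not
  reveal. A negative vector in the core has the form \<open>Z + L Z'\<close> with unrelated
  \<open>Z\<close> and \<open>Z'\<close>; this is why the blocks on the segment have two generators.
  Both ends are then images of the same real space of dimension eight, and since \<open>L\<close> is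
  linear, a segment of generators gives a segment of parametrising maps. Spectral information enters
  only through the bijectivity and the lower bounds in \<open>spec\<close>. The resolvent carries
  the bounds over to bounded operators, where lower bounds for all negative shifts are converted
  into the sign of a quadratic form.\<close>

lemma form_Cauchy_Schwarz:
  fixes b :: "'a::real_vector \<Rightarrow> 'a \<Rightarrow> real"
  assumes S: "subspace S"
    and add: "\<And>x y z. \<lbrakk>x \<in> S; y \<in> S; z \<in> S\<rbrakk> \<Longrightarrow> b (x + y) z = b x z + b y z"
    and scale: "\<And>c x y. \<lbrakk>x \<in> S; y \<in> S\<rbrakk> \<Longrightarrow> b (c *\<^sub>R x) y = c * b x y"
    and sym: "\<And>x y. \<lbrakk>x \<in> S; y \<in> S\<rbrakk> \<Longrightarrow> b x y = b y x"
    and nonneg: "\<And>x. x \<in> S \<Longrightarrow> b x x \<ge> 0"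
    and x: "x \<in> S" and y: "y \<in> S"
  shows "(b x y)\<^sup>2 \<le> b x x * b y y"
proof -
  have expand: "b x x + 2 * t * b x y + t\<^sup>2 * b y y \<ge> 0" for t
  proof -
    have ty: "t *\<^sub>R y \<in> S" and sum: "x + t *\<^sub>R y \<in> S"
      using S x y by (auto intro: subspace_add subspace_scale)
    have "b (x + t *\<^sub>R y) (x + t *\<^sub>R y) = b x (x + t *\<^sub>R y) + b (t *\<^sub>R y) (x + t *\<^sub>R y)"
      using add[OF x ty sum] .
    also have "\<dots> = b (x + t *\<^sub>R y) x + t * b (x + t *\<^sub>R y) y"
      using scale[OF y sum] sym[OF x sum] sym[OF y sum] by simp
    also have "\<dots> = b x x + 2 * t * b x y + t\<^sup>2 * b y y"
      using add[OF x ty x] add[OF x ty y] scale[OF y x] scale[OF y y] sym[OF y x]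
      by (simp add: algebra_simps power2_eq_square)
    finally show ?thesis using nonneg[OF sum] by simp
  qed
  show ?thesis
  proof (cases "b y y = 0")
    case True
    have "b x y = 0"
    proof (rule ccontr)
      assume "b x y \<noteq> 0"
      \<comment> \<open>With \<open>b y y = 0\<close> the expansion is affine in \<open>t\<close>;
        this \<open>t\<close> makes it equal to -1.\<close>
      then have "b x x + 2 * (- (b x x + 1) / (2 * b x y)) * b x y = -1"
        by (simp add: field_simps)
      with expand[of "- (b x x + 1) / (2 * b x y)"] True show False by simp
    qed
    then show ?thesis using True by simp
  next
    case False
    then have pos: "b y y > 0" using nonneg[OF y] by simp
    have "b x x + 2 * (- b x y / b y y) * b x y + (- b x y / b y y)\<^sup>2 * b y y
        = b x x - (b x y)\<^sup>2 / b y y"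
      using pos by (simp add: field_simps power2_eq_square)
    then have "(b x y)\<^sup>2 / b y y \<le> b x x"
      using expand[of "- b x y / b y y"] by simp
    then show ?thesis using pos by (simp add: field_simps)
  qed
qed

text \<open>Cauchy--Schwarz for the semidefinite form \<open>inner (T x) y\<close>, applied to
  \<open>x\<close> and \<open>T x\<close>, gives norm(T x)^4 on the left; the second factor on the
  right is at most \<open>c\<close> times norm(T x)^2, which cancels.\<close>

lemma nonneg_operator_norm_le:
  fixes T :: "'a::real_inner \<Rightarrow> 'a"
  assumes "linear T" and sym: "\<And>x y. inner (T x) y = inner x (T y)"
    and nonneg: "\<And>x. inner (T x) x \<ge> 0"
    and bound: "\<And>x. norm (T x) \<le> c * norm x"
  shows "(norm (T x))\<^sup>2 \<le> c * inner (T x) x"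
proof (cases "T x = 0")
  case False
  interpret linear T by fact
  have "(inner (T x) (T x))\<^sup>2 \<le> inner (T x) x * inner (T (T x)) (T x)"
    by (rule form_Cauchy_Schwarz[OF subspace_UNIV, where b = "\<lambda>x y. inner (T x) y"])
      (simp_all add: add scale inner_add_left nonneg, metis inner_commute sym)
  also have "\<dots> \<le> inner (T x) x * (c * (norm (T x))\<^sup>2)"
  proof (rule mult_left_mono[OF _ nonneg])
    have "inner (T (T x)) (T x) \<le> norm (T (T x)) * norm (T x)" by (rule norm_cauchy_schwarz)
    also have "\<dots> \<le> c * norm (T x) * norm (T x)"
      by (intro mult_right_mono bound) auto
    finally show "inner (T (T x)) (T x) \<le> c * (norm (T x))\<^sup>2" by (simp add: power2_eq_square)
  qed
  finally have "(norm (T x))\<^sup>2 * (norm (T x))\<^sup>2 \<le> (c * inner (T x) x) * (norm (T x))\<^sup>2"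
    unfolding dot_square_norm by (simp add: power2_eq_square algebra_simps)
  then show ?thesis using False by (meson mult_le_cancel_right zero_less_power2 norm_eq_zero linorder_not_le)
qed (use nonneg[of x] in simp)

text \<open>The infimum \<open>t\<close> of the numerical range is an approximate eigenvalue:
  \<open>G - t\<close> is nonnegative, so norm(G y - t y)^2 is at most a constant times
  \<open>inner (G y) y - t\<close> on unit vectors. If \<open>t\<close> were negative, the lower
  bound \<open>k\<close> for \<open>G - t\<close> would contradict this near the infimum.\<close>

lemma nonneg_if_bounded_below_shifts:
  fixes G :: "'a::real_inner \<Rightarrow> 'a"
  assumes "bounded_linear G" and sym: "\<And>x y. inner (G x) y = inner x (G y)"
    and below: "\<And>t. t < 0 \<Longrightarrow> \<exists>k>0. \<forall>x. k * norm x \<le> norm (G x - t *\<^sub>R x)"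
  shows "inner (G x) x \<ge> 0"
proof (rule ccontr)
  interpret bounded_linear G by fact
  assume neg: "\<not> inner (G x) x \<ge> 0"
  then have "x \<noteq> 0" by auto
  obtain K where K: "\<And>x. norm (G x) \<le> norm x * K" using bounded by blast
  define X where "X = {inner (G y) y | y. norm y = 1}"
  define t where "t = Inf X"
  have bdd: "bdd_below X"
  proof (rule bdd_belowI)
    fix r assume "r \<in> X"
    then obtain y where y: "norm y = 1" "r = inner (G y) y" by (auto simp: X_def)
    have "\<bar>inner (G y) y\<bar> \<le> norm (G y) * norm y" by (rule Cauchy_Schwarz_ineq2)
    also have "\<dots> \<le> K" using K[of y] y by simp
    finally show "- K \<le> r" using y by simp
  qed
  have unit: "inner (G y) y = (norm y)\<^sup>2 * inner (G (y /\<^sub>R norm y)) (y /\<^sub>R norm y)" if "y \<noteq> 0" for y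
    using that by (simp add: scale field_simps power2_eq_square)
  have mem: "inner (G (y /\<^sub>R norm y)) (y /\<^sub>R norm y) \<in> X" if "y \<noteq> 0" for y
    using that unfolding X_def by (intro CollectI exI[of _ "y /\<^sub>R norm y"]) auto
  have le: "t * (norm y)\<^sup>2 \<le> inner (G y) y" for y
  proof (cases "y = 0")
    case False
    have "t \<le> inner (G (y /\<^sub>R norm y)) (y /\<^sub>R norm y)"
      unfolding t_def by (rule cInf_lower[OF mem[OF False] bdd])
    from mult_left_mono[OF this zero_le_power2[of "norm y"]]
    show ?thesis unfolding unit[OF False] by (metis mult.commute)
  qed (simp add: zero)
  have "t < 0"
  proof -
    have "t * (norm x)\<^sup>2 < 0" using le[of x] neg by simp
    then show ?thesis by (simp add: mult_less_0_iff)
  qed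
  then obtain k where k: "k > 0" "\<And>x. k * norm x \<le> norm (G x - t *\<^sub>R x)" using below by blast
  have lin: "linear (\<lambda>x. G x - t *\<^sub>R x)"
    by (intro linear_compose_sub linear_axioms linear_scale_self)
  have upper: "(norm (G y - t *\<^sub>R y))\<^sup>2 \<le> (\<bar>K\<bar> + \<bar>t\<bar>) * inner (G y - t *\<^sub>R y) y" for y
  proof (rule nonneg_operator_norm_le[OF lin])
    show "inner (G x - t *\<^sub>R x) y = inner x (G y - t *\<^sub>R y)" for x y
      by (simp add: inner_diff_left inner_diff_right sym)
    show "0 \<le> inner (G x - t *\<^sub>R x) x" for x
      using le[of x] by (simp add: inner_diff_left power2_norm_eq_inner)
    show "norm (G x - t *\<^sub>R x) \<le> (\<bar>K\<bar> + \<bar>t\<bar>) * norm x" for x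
    proof -
      have "norm (G x - t *\<^sub>R x) \<le> norm x * K + \<bar>t\<bar> * norm x"
        using norm_triangle_ineq4[of "G x" "t *\<^sub>R x"] K[of x] by simp
      also have "\<dots> \<le> norm x * \<bar>K\<bar> + \<bar>t\<bar> * norm x" by (intro add_mono mult_left_mono) auto
      finally show ?thesis by (simp add: algebra_simps)
    qed
  qed
  define C where "C = \<bar>K\<bar> + \<bar>t\<bar>"
  have "C > 0" using \<open>t < 0\<close> by (simp add: C_def)
  \<comment> \<open>The lower bound \<open>k\<close> raises the infimum by k^2 / C, which is
    absurd.\<close>
  have "t + k\<^sup>2 / C \<le> Inf X"
  proof (rule cInf_greatest)
    show "X \<noteq> {}" using mem[OF \<open>x \<noteq> 0\<close>] by blast
    fix r assume "r \<in> X"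
    then obtain y where y: "norm y = 1" "r = inner (G y) y" by (auto simp: X_def)
    have "k\<^sup>2 \<le> (norm (G y - t *\<^sub>R y))\<^sup>2" using k(1) k(2)[of y] y by (intro power_mono) auto
    also have "\<dots> \<le> C * (r - t)"
    proof -
      have "inner (G y - t *\<^sub>R y) y = r - t"
        using y by (simp add: inner_diff_left power2_norm_eq_inner[symmetric])
      then show ?thesis using upper[of y] by (simp add: C_def)
    qed
    finally show "t + k\<^sup>2 / C \<le> r" using \<open>C > 0\<close> by (simp add: field_simps)
  qed
  moreover have "k\<^sup>2 / C > 0" using k \<open>C > 0\<close> by simp
  ultimately show False by (simp add: t_def)
qed

text \<open>The iteration \<open>u \<mapsto> u - T u / c\<close> contracts the form of \<open>T\<close> and hence converges
  geometrically to a kernel vector; this replaces the spectral theorem.\<close>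
lemma kernel_approximation:
  fixes T :: "'a::{real_inner, complete_space} \<Rightarrow> 'a"
  assumes "bounded_linear T" and sym: "\<And>x y. inner (T x) y = inner x (T y)"
    and nonneg: "\<And>x. inner (T x) x \<ge> 0"
    and e: "e > 0" and gap: "\<And>x. e * inner (T x) x \<le> (norm (T x))\<^sup>2"
  shows "\<exists>C. \<forall>v. \<exists>k. T k = 0 \<and> (norm (v - k))\<^sup>2 \<le> C * inner (T v) v"
proof -
  interpret bounded_linear T by fact
  obtain K where K: "\<And>x. norm (T x) \<le> norm x * K" using bounded by blast
  \<comment> \<open>\<open>c\<close> must bound the norm of \<open>T\<close>; adding
    \<open>e\<close> also ensures \<open>e <= c\<close>, so that the contraction factor
    \<open>q = 1 - e / c\<close> is not negative.\<close>
  define c where "c = \<bar>K\<bar> + e"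
  have c: "c > 0" "e \<le> c" using e by (auto simp: c_def)
  have bound: "norm (T x) \<le> c * norm x" for x
  proof -
    have "norm (T x) \<le> norm x * K" by (rule K)
    also have "\<dots> \<le> norm x * c" using e by (intro mult_left_mono) (auto simp: c_def)
    finally show ?thesis by (simp add: mult.commute)
  qed
  have Tc: "(norm (T x))\<^sup>2 \<le> c * inner (T x) x" for x
    by (rule nonneg_operator_norm_le[OF linear_axioms sym nonneg bound])
  define q where "q = 1 - e / c"
  have q: "0 \<le> q" "q < 1" using c e by (auto simp: q_def field_simps)
  define r where "r = sqrt q"
  have r: "0 \<le> r" "r < 1" using q by (auto simp: r_def)
  \<comment> \<open>The quadratic term of the expansion costs at most norm(T y)^2 / c, half of what
    the linear term gains; \<open>gap\<close> turns the remaining gain into a fixed fraction of the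
    form.\<close>
  have step: "inner (T (y - (1/c) *\<^sub>R T y)) (y - (1/c) *\<^sub>R T y) \<le> q * inner (T y) y" for y
  proof -
    have "inner (T (T y)) (T y) \<le> c * (norm (T y))\<^sup>2"
    proof -
      have "inner (T (T y)) (T y) \<le> norm (T (T y)) * norm (T y)" by (rule norm_cauchy_schwarz)
      also have "\<dots> \<le> c * norm (T y) * norm (T y)" by (intro mult_right_mono bound) auto
      finally show ?thesis by (simp add: power2_eq_square)
    qed
    moreover have "inner (T (y - (1/c) *\<^sub>R T y)) (y - (1/c) *\<^sub>R T y)
        = inner (T y) y - 2 / c * (norm (T y))\<^sup>2 + inner (T (T y)) (T y) / c\<^sup>2"
      using sym[of "T y" y]
      by (simp add: diff scale inner_diff_left inner_diff_right dot_square_norm power2_eq_square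
          diff_divide_distrib)
    ultimately have "inner (T (y - (1/c) *\<^sub>R T y)) (y - (1/c) *\<^sub>R T y)
        \<le> inner (T y) y - 2 / c * (norm (T y))\<^sup>2 + c * (norm (T y))\<^sup>2 / c\<^sup>2"
      by (simp add: divide_right_mono)
    also have "\<dots> = inner (T y) y - (norm (T y))\<^sup>2 / c"
      using c by (simp add: field_simps power2_eq_square)
    also have "\<dots> \<le> inner (T y) y - e * inner (T y) y / c"
      using gap[of y] c by (simp add: divide_right_mono)
    finally show ?thesis by (simp add: q_def algebra_simps)
  qed
  have "\<exists>k. T k = 0 \<and> (norm (v - k))\<^sup>2 \<le> 1 / (c * (1 - r)\<^sup>2) * inner (T v) v" for v
  proof -
    define u where "u k = ((\<lambda>y. y - (1/c) *\<^sub>R T y) ^^ k) v" for k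
    define d where "d k = (1/c) *\<^sub>R T (u k)" for k
    define M where "M = sqrt (inner (T v) v / c)"
    have u_Suc: "u (Suc k) = u k - d k" for k by (simp add: u_def d_def)
    have form: "inner (T (u k)) (u k) \<le> q ^ k * inner (T v) v" for k
    proof (induction k)
      case (Suc k)
      have "inner (T (u (Suc k))) (u (Suc k)) \<le> q * inner (T (u k)) (u k)"
        using step[of "u k"] by (simp add: u_Suc d_def)
      also have "\<dots> \<le> q * (q ^ k * inner (T v) v)" by (intro mult_left_mono Suc q)
      finally show ?case by (simp add: mult.assoc)
    qed (simp add: u_def)
    \<comment> \<open>The increment is controlled by the square root of the form, hence decays with
      ratio \<open>r = sqrt q\<close>. Summing the geometric series produces the constant in the
      claim.\<close>
    have nd: "norm (d k) \<le> M * r ^ k" for k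
    proof (rule power2_le_imp_le)
      have "(norm (d k))\<^sup>2 = (norm (T (u k)))\<^sup>2 / c\<^sup>2" by (simp add: d_def power_divide)
      also have "\<dots> \<le> c * inner (T (u k)) (u k) / c\<^sup>2" by (intro divide_right_mono Tc) auto
      also have "\<dots> \<le> c * (q ^ k * inner (T v) v) / c\<^sup>2"
        using c by (intro divide_right_mono mult_left_mono form) auto
      also have "\<dots> = (M * r ^ k)\<^sup>2"
      proof -
        have "(r ^ k)\<^sup>2 = q ^ k" using q by (simp add: r_def real_sqrt_power[symmetric])
        moreover have "M\<^sup>2 = inner (T v) v / c" using c nonneg[of v] by (simp add: M_def)
        ultimately show ?thesis using c by (simp add: power_mult_distrib) (simp add: power2_eq_square)
      qed
      finally show "(norm (d k))\<^sup>2 \<le> (M * r ^ k)\<^sup>2" .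
      show "0 \<le> M * r ^ k" using r nonneg[of v] c by (simp add: M_def)
    qed
    have geo: "summable (\<lambda>k. M * r ^ k)" using r by (intro summable_mult summable_geometric) auto
    have nsum: "summable (\<lambda>k. norm (d k))"
      by (rule summable_comparison_test'[OF geo, of 0]) (use nd in auto)
    have u_diff: "norm (u m - u n) \<le> (\<Sum>i\<in>{m..<n}. norm (d i))" if "m \<le> n" for m n
      using that
    proof (induction rule: dec_induct)
      case (step n)
      have "norm (u m - u (Suc n)) \<le> norm (u m - u n) + norm (d n)"
        using norm_triangle_ineq[of "u m - u n" "d n"] by (simp add: u_Suc algebra_simps)
      then show ?case using step by simp
    qed simp
    have "Cauchy u"
    proof (rule CauchyI')
      fix e :: real assume "e > 0"
      then obtain N where N: "\<And>m n. m \<ge> N \<Longrightarrow> norm (\<Sum>i\<in>{m..<n}. norm (d i)) < e"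
        using nsum unfolding summable_Cauchy by blast
      have "dist (u m) (u n) < e" if "m \<ge> N" "m < n" for m n
        using u_diff[of m n] N[of m n] that by (simp add: dist_norm)
      then show "\<exists>N. \<forall>m\<ge>N. \<forall>n>m. dist (u m) (u n) < e" by blast
    qed
    then obtain k where k: "u \<longlonglongrightarrow> k" using Cauchy_convergent convergent_def by blast
    then have "(\<lambda>n. T (u n)) \<longlonglongrightarrow> T k" by (rule tendsto)
    moreover have "(\<lambda>n. T (u n)) \<longlonglongrightarrow> c *\<^sub>R 0"
    proof -
      have "T (u n) = c *\<^sub>R d n" for n using c by (simp add: d_def)
      moreover have "d \<longlonglongrightarrow> 0" using summable_LIMSEQ_zero[OF nsum] tendsto_norm_zero_iff by blast
      ultimately show ?thesis by (simp only:) (intro tendsto_intros)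
    qed
    ultimately have "T k = 0" using LIMSEQ_unique by fastforce
    moreover have "norm (v - k) \<le> M / (1 - r)"
    proof (rule tendsto_upperbound)
      show "(\<lambda>n. norm (v - u n)) \<longlonglongrightarrow> norm (v - k)" by (intro tendsto_intros k)
      have "norm (v - u n) \<le> M / (1 - r)" for n
      proof -
        have "norm (v - u n) \<le> (\<Sum>i\<in>{0..<n}. norm (d i))" using u_diff[of 0 n] by (simp add: u_def)
        also have "\<dots> \<le> (\<Sum>n. norm (d n))" by (rule sum_le_suminf[OF nsum]) auto
        also have "\<dots> \<le> (\<Sum>n. M * r ^ n)" by (rule suminf_le[OF nd nsum geo])
        also have "\<dots> = M / (1 - r)" using r by (simp add: suminf_mult suminf_geometric)
        finally show ?thesis .
      qed
      then show "\<forall>\<^sub>F n in sequentially. norm (v - u n) \<le> M / (1 - r)" by simp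
    qed simp
    then have "(norm (v - k))\<^sup>2 \<le> (M / (1 - r))\<^sup>2" by (intro power_mono) auto
    moreover have "(M / (1 - r))\<^sup>2 = 1 / (c * (1 - r)\<^sup>2) * inner (T v) v"
      using nonneg[of v] c by (simp add: M_def power_divide)
    ultimately show ?thesis by auto
  qed
  then show ?thesis by blast
qed

section \<open>Finite-dimensional subspaces\<close>

text \<open>A quantitative form of weak smallness, uniform over a whole subspace \<open>W\<close>
  and tested against finitely many vectors. The value \<open>e = 0\<close> means exact
  orthogonality.\<close>

definition almost_orth :: "'a::real_inner set \<Rightarrow> real \<Rightarrow> 'a set \<Rightarrow> bool" where
  "almost_orth F e W \<longleftrightarrow> (\<forall>f\<in>F. \<forall>w\<in>W. \<bar>inner f w\<bar> \<le> e * norm w)"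

lemma almost_orthD: "almost_orth F e W \<Longrightarrow> f \<in> F \<Longrightarrow> w \<in> W \<Longrightarrow> \<bar>inner f w\<bar> \<le> e * norm w"
  by (auto simp: almost_orth_def)

lemma almost_orth_mono:
  assumes "almost_orth F e W" "F' \<subseteq> F" "e \<le> e'" "W' \<subseteq> W"
  shows "almost_orth F' e' W'"
  unfolding almost_orth_def
proof (intro ballI)
  fix f w assume "f \<in> F'" "w \<in> W'"
  then have "\<bar>inner f w\<bar> \<le> e * norm w" using assms almost_orthD[of F e W f w] by blast
  also have "\<dots> \<le> e' * norm w" using assms by (intro mult_right_mono) auto
  finally show "\<bar>inner f w\<bar> \<le> e' * norm w" .
qed

text \<open>Four times the lower bound for norm(u + v)^2 exceeds the square of the left side by at
  least 3 (norm u - norm v)^2. Thus the factor 1/2 in the angle condition costs exactly a factor 2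
  in the norms.\<close>

lemma norm_add_ge_half:
  fixes u v :: "'a::real_inner"
  assumes "\<bar>inner u v\<bar> \<le> 1/2 * norm u * norm v"
  shows "norm u + norm v \<le> 2 * norm (u + v)"
proof (rule power2_le_imp_le)
  have "(norm (u + v))\<^sup>2 = (norm u)\<^sup>2 + 2 * inner u v + (norm v)\<^sup>2"
    by (simp add: power2_norm_eq_inner inner_add_left inner_add_right inner_commute)
  moreover have "0 \<le> 3 * (norm u - norm v)\<^sup>2" by simp
  ultimately show "(norm u + norm v)\<^sup>2 \<le> (2 * norm (u + v))\<^sup>2"
    using assms by (simp add: power2_eq_square algebra_simps)
qed simp

lemma almost_orth_sum:
  assumes "almost_orth F e U" "almost_orth F e V"
    and "\<And>u v. u \<in> U \<Longrightarrow> v \<in> V \<Longrightarrow> \<bar>inner u v\<bar> \<le> 1/2 * norm u * norm v"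
    and e: "e \<ge> 0" and W: "W \<subseteq> {u + v | u v. u \<in> U \<and> v \<in> V}"
  shows "almost_orth F (2 * e) W"
  unfolding almost_orth_def
proof (intro ballI)
  fix f w assume f: "f \<in> F" and "w \<in> W"
  then obtain u v where uv: "u \<in> U" "v \<in> V" "w = u + v" using W by blast
  have "\<bar>inner f w\<bar> \<le> \<bar>inner f u\<bar> + \<bar>inner f v\<bar>" by (simp add: uv inner_add_right)
  also have "\<dots> \<le> e * (norm u + norm v)"
    using almost_orthD[OF assms(1) f uv(1)] almost_orthD[OF assms(2) f uv(2)] by (simp add: algebra_simps)
  also have "\<dots> \<le> e * (2 * norm w)"
    unfolding uv(3) using assms(3) uv e by (intro mult_left_mono norm_add_ge_half) auto
  finally show "\<bar>inner f w\<bar> \<le> 2 * e * norm w" by simp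
qed

lemma orthonormal_basis_span:
  fixes B :: "'a::real_inner set"
  assumes "finite B"
  obtains E where "finite E" "span E = span B"
    "\<And>v. v \<in> span B \<Longrightarrow> (\<Sum>e\<in>E. inner e v *\<^sub>R e) = v" "\<And>e. e \<in> E \<Longrightarrow> norm e = 1"
proof -
  obtain C where C: "finite C" "span C = span B" "pairwise orthogonal C"
    using basis_orthogonal[OF assms] by blast
  define E where "E = (\<lambda>c. c /\<^sub>R norm c) ` (C - {0})"
  have fin: "finite E" using C by (simp add: E_def)
  have orth: "inner e e' = 0" if "e \<in> E" "e' \<in> E" "e \<noteq> e'" for e e'
  proof -
    obtain c c' where c: "c \<in> C" "c' \<in> C" "e = c /\<^sub>R norm c" "e' = c' /\<^sub>R norm c'"
      using \<open>e \<in> E\<close> \<open>e' \<in> E\<close> by (auto simp: E_def)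
    then have "c \<noteq> c'" using \<open>e \<noteq> e'\<close> by auto
    then have "inner c c' = 0" using C(3) c by (auto simp: pairwise_def orthogonal_def)
    then show ?thesis by (simp add: c)
  qed
  have unit: "norm e = 1" if e: "e \<in> E" for e
  proof -
    obtain c where "c \<noteq> 0" "e = c /\<^sub>R norm c" using e by (auto simp: E_def)
    then show ?thesis by simp
  qed
  have span: "span E = span B"
  proof -
    have "E \<subseteq> span C" by (auto simp: E_def intro: span_scale span_base)
    moreover have "C \<subseteq> span E"
    proof
      fix c assume "c \<in> C"
      show "c \<in> span E"
      proof (cases "c = 0")
        case False
        then have "c /\<^sub>R norm c \<in> E" using \<open>c \<in> C\<close> by (auto simp: E_def)
        then have "norm c *\<^sub>R (c /\<^sub>R norm c) \<in> span E" by (intro span_scale span_base)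
        then show ?thesis using False by simp
      qed (simp add: span_zero)
    qed
    ultimately show ?thesis unfolding C(2)[symmetric] by (simp add: span_eq)
  qed
  have expand: "(\<Sum>e\<in>E. inner e v *\<^sub>R e) = v" if "v \<in> span B" for v
  proof -
    have "v \<in> span E" using that span by simp
    then obtain a where a: "v = (\<Sum>e\<in>E. a e *\<^sub>R e)" using span_finite[OF fin] by auto
    have "inner e v = a e" if "e \<in> E" for e
    proof -
      have "inner e v = (\<Sum>e'\<in>E. a e' * inner e e')" by (simp add: a inner_sum_right)
      also have "\<dots> = (\<Sum>e'\<in>E. if e' = e then a e else 0)"
        using orth unit that by (intro sum.cong) (auto simp: dot_square_norm)
      finally show ?thesis using that fin by simp
    qed
    then show ?thesis unfolding a by (intro sum.cong) (simp_all add: a)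
  qed
  show ?thesis using that[OF fin span expand unit] by blast
qed

text \<open>The test set is the image under \<open>M\<close> of an orthonormal basis of the span. It
  depends only on the block already chosen, so it can be imposed on every later one. Taking
  \<open>M\<close> to be the identity controls angles, taking \<open>M = A - l\<close> controls the
  off-diagonal part of the operator. Linearity is asked on the span only, because \<open>A\<close>
  is linear only on its domain.\<close>

lemma almost_orth_imp_small_pairing:
  fixes M :: "'a::real_inner \<Rightarrow> 'a"
  assumes "finite B"
    and add: "\<And>x y. x \<in> span B \<Longrightarrow> y \<in> span B \<Longrightarrow> M (x + y) = M x + M y"
    and scale: "\<And>c x. x \<in> span B \<Longrightarrow> M (c *\<^sub>R x) = c *\<^sub>R M x"
    and eta: "eta > 0"
  shows "\<exists>F e. finite F \<and> e > 0 \<and>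
    (\<forall>W. almost_orth F e W \<longrightarrow> (\<forall>u\<in>span B. \<forall>w\<in>W. \<bar>inner (M u) w\<bar> \<le> eta * norm u * norm w))"
proof -
  obtain E where E: "finite E" "span E = span B"
    "\<And>v. v \<in> span B \<Longrightarrow> (\<Sum>e\<in>E. inner e v *\<^sub>R e) = v" "\<And>e. e \<in> E \<Longrightarrow> norm e = 1"
    using orthonormal_basis_span[OF assms(1)] by metis
  \<comment> \<open>The bound is lost once per basis vector; the added 1 covers an empty
    basis.\<close>
  define d where "d = eta / (real (card E) + 1)"
  have "d > 0" using eta by (simp add: d_def)
  have zero: "M 0 = 0" using scale[of 0 0] by (simp add: span_zero)
  have Msum: "M (\<Sum>e\<in>E'. a e *\<^sub>R e) = (\<Sum>e\<in>E'. a e *\<^sub>R M e)" if "E' \<subseteq> E" for E' a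
  proof -
    have "finite E'" using that E(1) finite_subset by blast
    then show ?thesis using that
    proof (induction E')
      case (insert x X)
      have x: "x \<in> span B" and X: "(\<Sum>e\<in>X. a e *\<^sub>R e) \<in> span B"
        using insert E(2) by (auto intro!: span_sum span_scale simp flip: E(2) intro: span_base)
      then show ?case using insert by (simp add: add scale span_scale)
    qed (simp add: zero)
  qed
  have "\<bar>inner (M u) w\<bar> \<le> eta * norm u * norm w"
    if W: "almost_orth (M ` E) d W" and u: "u \<in> span B" and w: "w \<in> W" for W u w
  proof -
    have "inner (M u) w = (\<Sum>e\<in>E. inner e u * inner (M e) w)"
      using Msum[of E "\<lambda>e. inner e u"] E(3)[OF u] by (simp add: inner_sum_left)
    also have "\<bar>\<dots>\<bar> \<le> (\<Sum>e\<in>E. norm u * (d * norm w))"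
    proof (rule order_trans[OF sum_abs], rule sum_mono)
      fix e assume e: "e \<in> E"
      have "\<bar>inner e u\<bar> \<le> norm u" using Cauchy_Schwarz_ineq2[of e u] E(4)[OF e] by simp
      moreover have "\<bar>inner (M e) w\<bar> \<le> d * norm w" using almost_orthD[OF W _ w] e by simp
      ultimately show "\<bar>inner e u * inner (M e) w\<bar> \<le> norm u * (d * norm w)"
        by (simp add: abs_mult mult_mono)
    qed
    also have "\<dots> = real (card E) * d * norm u * norm w" by simp
    also have "\<dots> \<le> eta * norm u * norm w"
      using eta by (intro mult_right_mono) (auto simp: d_def field_simps)
    finally show ?thesis .
  qed
  moreover have "finite (M ` E)" using E(1) by simp
  ultimately show ?thesis using \<open>d > 0\<close> by blast
qed

text \<open>The ambient space may be infinite-dimensional. The coordinates of a unit vector in an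
  orthonormal basis lie in [-1, 1], and the corresponding cube is an iterated sum of compact
  segments.\<close>

lemma compact_unit_sphere_span:
  fixes B :: "'a::real_inner set"
  assumes "finite B"
  shows "compact {v \<in> span B. norm v = 1}"
proof -
  obtain E where E: "finite E" "span E = span B"
    "\<And>v. v \<in> span B \<Longrightarrow> (\<Sum>e\<in>E. inner e v *\<^sub>R e) = v" "\<And>e. e \<in> E \<Longrightarrow> norm e = 1"
    using orthonormal_basis_span[OF assms] by metis
  define K where "K X = {\<Sum>e\<in>X. a e *\<^sub>R e | a. \<forall>e\<in>X. a e \<in> {-1..1::real}}" for X :: "'a set"
  have "compact (K X)" if "finite X" for X
    using that
  proof (induction X)
    case empty
    have "K {} = {0}" by (auto simp: K_def)
    then show ?case by simp
  next
    case (insert x X)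
    have "K (insert x X) = {u + v | u v. u \<in> (\<lambda>t. t *\<^sub>R x) ` {-1..1} \<and> v \<in> K X}"
    proof (intro equalityI subsetI)
      fix y assume "y \<in> K (insert x X)"
      then obtain a where "y = (\<Sum>e\<in>insert x X. a e *\<^sub>R e)" "\<forall>e\<in>insert x X. a e \<in> {-1..1}"
        by (auto simp: K_def)
      then have "y = a x *\<^sub>R x + (\<Sum>e\<in>X. a e *\<^sub>R e)" "a x \<in> {-1..1}" "(\<Sum>e\<in>X. a e *\<^sub>R e) \<in> K X"
        using insert by (auto simp: K_def)
      then show "y \<in> {u + v | u v. u \<in> (\<lambda>t. t *\<^sub>R x) ` {-1..1} \<and> v \<in> K X}" by blast
    next
      fix y assume "y \<in> {u + v | u v. u \<in> (\<lambda>t. t *\<^sub>R x) ` {-1..1} \<and> v \<in> K X}"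
      then obtain t a where ta: "t \<in> {-1..1}" "\<forall>e\<in>X. a e \<in> {-1..1}"
          "y = t *\<^sub>R x + (\<Sum>e\<in>X. a e *\<^sub>R e)"
        by (auto simp: K_def)
      have "(\<Sum>e\<in>X. (a(x := t)) e *\<^sub>R e) = (\<Sum>e\<in>X. a e *\<^sub>R e)"
        using insert by (intro sum.cong) auto
      then have "y = (\<Sum>e\<in>insert x X. (a(x := t)) e *\<^sub>R e)" using ta insert by simp
      then show "y \<in> K (insert x X)" using ta unfolding K_def
        by (intro CollectI exI[of _ "a(x := t)"]) auto
    qed
    moreover have "compact ((\<lambda>t. t *\<^sub>R x) ` {-1..1::real})"
      by (intro compact_continuous_image continuous_intros) auto
    ultimately show ?case using insert compact_sums by simp
  qed
  then have "compact (K E)" using E(1) .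
  moreover have "{v \<in> span B. norm v = 1} = K E \<inter> sphere 0 1"
  proof (intro equalityI subsetI)
    fix v assume v: "v \<in> {v \<in> span B. norm v = 1}"
    have "\<bar>inner e v\<bar> \<le> 1" if "e \<in> E" for e
      using Cauchy_Schwarz_ineq2[of e v] E(4)[OF that] v by simp
    then have "\<forall>e\<in>E. inner e v \<in> {-1..1}" by (auto simp: abs_le_iff)
    then show "v \<in> K E \<inter> sphere 0 1" using v E(3)[of v] unfolding K_def
      by (auto intro!: exI[of _ "\<lambda>e. inner e v"])
  next
    fix v assume v: "v \<in> K E \<inter> sphere 0 1"
    then obtain a where "v = (\<Sum>e\<in>E. a e *\<^sub>R e)" by (auto simp: K_def)
    then have "v \<in> span E" by (auto intro!: span_sum span_scale intro: span_base)
    then show "v \<in> {v \<in> span B. norm v = 1}" using v E(2) by simp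
  qed
  moreover have "closed (sphere (0::'a) 1)"
    unfolding sphere_def by (intro closed_Collect_eq continuous_intros)
  ultimately show ?thesis by (simp add: compact_Int_closed)
qed

text \<open>\<open>M\<close> need not be continuous on the whole space; on the span it agrees with a
  finite sum of inner products times fixed vectors, which is. The general \<open>g\<close> serves
  two minimisations: of the Rayleigh quotient and of the norm of a residual.\<close>

lemma quadratic_min_unit_sphere:
  fixes B :: "'a::real_inner set" and M :: "'a \<Rightarrow> 'b::real_normed_vector"
  assumes "finite B" "w0 \<in> span B" "w0 \<noteq> 0"
    and add: "\<And>x y. x \<in> span B \<Longrightarrow> y \<in> span B \<Longrightarrow> M (x + y) = M x + M y"
    and scale: "\<And>c x. x \<in> span B \<Longrightarrow> M (c *\<^sub>R x) = c *\<^sub>R M x"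
    and g: "\<And>x. x \<in> span B \<Longrightarrow> h x = g x (M x)"
    and cont: "continuous_on UNIV (\<lambda>(x, y). g x y)"
  shows "\<exists>v\<in>span B. norm v = 1 \<and> (\<forall>w\<in>span B. norm w = 1 \<longrightarrow> (h v :: real) \<le> h w)"
proof -
  obtain E where E: "finite E" "span E = span B"
    "\<And>v. v \<in> span B \<Longrightarrow> (\<Sum>e\<in>E. inner e v *\<^sub>R e) = v" "\<And>e. e \<in> E \<Longrightarrow> norm e = 1"
    using orthonormal_basis_span[OF assms(1)] by metis
  have zero: "M 0 = 0" using scale[of 0 0] by (simp add: span_zero)
  have Msum: "M (\<Sum>e\<in>E'. a e *\<^sub>R e) = (\<Sum>e\<in>E'. a e *\<^sub>R M e)" if "E' \<subseteq> E" for E' a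
  proof -
    have "finite E'" using that E(1) finite_subset by blast
    then show ?thesis using that
    proof (induction E')
      case (insert x X)
      have x: "x \<in> span B" and X: "(\<Sum>e\<in>X. a e *\<^sub>R e) \<in> span B"
        using insert E(2) by (auto intro!: span_sum span_scale simp flip: E(2) intro: span_base)
      then show ?case using insert by (simp add: add scale span_scale)
    qed (simp add: zero)
  qed
  let ?S = "{v \<in> span B. norm v = 1}"
  let ?h = "\<lambda>x. case (x, \<Sum>e\<in>E. inner e x *\<^sub>R M e) of (x, y) \<Rightarrow> g x y"
  have h: "h x = ?h x" if "x \<in> span B" for x
    using Msum[of E "\<lambda>e. inner e x"] E(3)[OF that] g[OF that] by simp
  have "continuous_on ?S ?h"
    by (rule continuous_on_compose2[OF cont]) (auto intro!: continuous_intros)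
  moreover have "?S \<noteq> {}"
    using assms(2,3) by (auto intro!: exI[of _ "w0 /\<^sub>R norm w0"] span_scale)
  ultimately have "\<exists>v\<in>?S. \<forall>w\<in>?S. ?h v \<le> ?h w"
    by (intro continuous_attains_inf compact_unit_sphere_span assms(1))
  then show ?thesis using h by force
qed

text \<open>Elimination by induction on the equations: an equation with a nonzero coefficient
  removes one unknown.\<close>

lemma homogeneous_system_nontrivial:
  fixes f :: "'k \<Rightarrow> 'i \<Rightarrow> real"
  assumes "finite K" "finite I" "card K < card I"
  shows "\<exists>c. (\<exists>i\<in>I. c i \<noteq> 0) \<and> (\<forall>k\<in>K. (\<Sum>i\<in>I. f k i * c i) = 0)"
  using assms
proof (induction K arbitrary: I f)
  case empty
  then obtain i where "i \<in> I" by fastforce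
  then show ?case by (intro exI[of _ "\<lambda>_. 1"]) auto
next
  case (insert k K)
  show ?case
  proof (cases "\<forall>i\<in>I. f k i = 0")
    case True
    moreover obtain c where "(\<exists>i\<in>I. c i \<noteq> 0) \<and> (\<forall>k\<in>K. (\<Sum>i\<in>I. f k i * c i) = 0)"
      using insert.IH[of I f] insert by fastforce
    ultimately show ?thesis by (intro exI[of _ c]) auto
  next
    case False
    then obtain j where j: "j \<in> I" "f k j \<noteq> 0" by blast
    define f' where "f' l i = f l i - f l j * f k i / f k j" for l i
    have "card K < card (I - {j})" using insert j by (simp add: card_Diff_singleton)
    then obtain c where c: "\<exists>i\<in>I - {j}. c i \<noteq> 0"
        "\<And>l. l \<in> K \<Longrightarrow> (\<Sum>i\<in>I - {j}. f' l i * c i) = 0"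
      using insert.IH[of "I - {j}" f'] insert by blast
    \<comment> \<open>Back substitution: the pivot unknown is set so that equation \<open>k\<close>
      holds.\<close>
    define c' where "c' = c(j := - (\<Sum>i\<in>I - {j}. f k i * c i) / f k j)"
    have sum: "(\<Sum>i\<in>I. f l i * c' i)
        = (\<Sum>i\<in>I - {j}. f l i * c i) - f l j * (\<Sum>i\<in>I - {j}. f k i * c i) / f k j" for l
    proof -
      have "(\<Sum>i\<in>I. f l i * c' i) = f l j * c' j + (\<Sum>i\<in>I - {j}. f l i * c' i)"
        using insert j by (simp add: sum.remove)
      also have "(\<Sum>i\<in>I - {j}. f l i * c' i) = (\<Sum>i\<in>I - {j}. f l i * c i)"
        by (intro sum.cong) (auto simp: c'_def)
      finally show ?thesis by (simp add: c'_def)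
    qed
    have "(\<Sum>i\<in>I. f l i * c' i) = 0" if "l \<in> insert k K" for l
    proof (cases "l = k")
      case True
      then show ?thesis using sum[of k] j by simp
    next
      case False
      then have "0 = (\<Sum>i\<in>I - {j}. f' l i * c i)" using c that by simp
      also have "\<dots> = (\<Sum>i\<in>I - {j}. f l i * c i - f l j / f k j * (f k i * c i))"
        by (intro sum.cong) (auto simp: f'_def algebra_simps)
      also have "\<dots> = (\<Sum>i\<in>I. f l i * c' i)"
        by (simp add: sum sum_subtractf sum_distrib_left sum_divide_distrib)
      finally show ?thesis by simp
    qed
    moreover have "\<exists>i\<in>I. c' i \<noteq> 0" using c(1) by (auto simp: c'_def)
    ultimately show ?thesis by blast
  qed
qed

text \<open>At the supremum of the parameters where the form takes a nonpositive value it is still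
  nonnegative.\<close>
lemma form_path_crossing:
  fixes q :: "real \<Rightarrow> 'e::euclidean_space \<Rightarrow> real"
  assumes cont: "continuous_on ({0..1} \<times> sphere 0 1) (\<lambda>(t, c). q t c)"
    and pos: "\<And>c. norm c = 1 \<Longrightarrow> q 1 c > 0"
    and neg: "norm c0 = 1" "q 0 c0 < 0"
  shows "\<exists>t\<in>{0<..<1}. (\<forall>c. norm c = 1 \<longrightarrow> q t c \<ge> 0) \<and> (\<exists>c. norm c = 1 \<and> q t c = 0)"
proof -
  let ?D = "{0..1::real} \<times> sphere (0::'e) 1"
  define Z where "Z = {p \<in> ?D. (case p of (t, c) \<Rightarrow> q t c) \<le> 0}"
  have "compact ?D" by (intro compact_Times) auto
  then have "closed ?D" by (rule compact_imp_closed)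
  have Z: "Z = ?D \<inter> (\<lambda>(t, c). q t c) -` {..0}" by (auto simp: Z_def)
  have "closed Z" unfolding Z
    by (rule continuous_closed_preimage[OF cont \<open>closed ?D\<close> closed_atMost])
  then have "compact (?D \<inter> Z)" using \<open>compact ?D\<close> by (rule compact_Int_closed[rotated])
  moreover have "?D \<inter> Z = Z" unfolding Z by blast
  ultimately have "compact Z" by simp
  then have cT: "compact (fst ` Z)" by (intro compact_continuous_image continuous_intros)
  have "0 \<in> fst ` Z" using neg by (force simp: Z_def)
  then obtain t where t: "t \<in> fst ` Z" "\<And>s. s \<in> fst ` Z \<Longrightarrow> s \<le> t"
    using compact_attains_sup[OF cT] by blast
  then obtain c where c: "norm c = 1" "q t c \<le> 0" and t01: "t \<in> {0..1}" by (auto simp: Z_def)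
  have "t \<noteq> 1" using pos c by force
  then have t1: "t < 1" using t01 by simp
  \<comment> \<open>Parameters above \<open>t\<close> lie outside the closed set of nonpositive
    values, so the form is positive there; continuity from the right passes this to
    \<open>t\<close>.\<close>
  have nn: "q t d \<ge> 0" if d: "norm d = 1" for d
  proof (rule tendsto_lowerbound)
    have "continuous_on {t..1} (\<lambda>s. case (s, d) of (t, c) \<Rightarrow> q t c)"
      using t01 d by (intro continuous_on_compose2[OF cont]) (auto intro!: continuous_intros)
    then have "((\<lambda>s. q s d) \<longlongrightarrow> q t d) (at t within {t..1})"
      using t1 by (auto simp: continuous_on_def)
    then show "((\<lambda>s. q s d) \<longlongrightarrow> q t d) (at t within {t<..<1})"
      by (rule tendsto_within_subset) auto
    show "\<forall>\<^sub>F s in at t within {t<..<1}. 0 \<le> q s d"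
      unfolding eventually_at_filter
    proof (intro always_eventually allI impI)
      fix s assume s: "s \<noteq> t" "s \<in> {t<..<1}"
      show "0 \<le> q s d"
      proof (rule ccontr)
        assume "\<not> 0 \<le> q s d"
        then have "(s, d) \<in> Z" using s d t01 by (auto simp: Z_def)
        then show False using t(2)[of s] s by force
      qed
    qed
    show "at t within {t<..<1} \<noteq> bot" using t1 by (simp add: at_within_eq_bot_iff)
  qed
  have "t \<noteq> 0" using nn neg by force
  then show ?thesis using nn c t01 t1 by (intro bexI[of _ t]) (auto intro!: exI[of _ c] antisym)
qed

text \<open>Separability passes to subsets: for every centre in a countable dense set and every
  radius 1/(n+1), one point of \<open>S\<close> in that ball is selected if there is one. It will be
  applied to the graph of \<open>A\<close> over the core, where density means density in graph
  norm.\<close>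

lemma dense_sequence_in_product_subset:
  fixes S :: "('a::real_normed_vector \<times> 'a) set"
  assumes "hilbert_separable TYPE('a)" "S \<noteq> {}"
  shows "\<exists>g::nat \<Rightarrow> _. range g \<subseteq> S \<and> S \<subseteq> closure (range g)"
proof -
  obtain D :: "'a set" where D: "countable D" "closure D = UNIV"
    using assms(1) by (auto simp: hilbert_separable_def)
  obtain s0 where s0: "s0 \<in> S" using assms(2) by blast
  \<comment> \<open>\<open>s0\<close> is only the default for balls that miss \<open>S\<close>; it
    keeps all selected points in \<open>S\<close>.\<close>
  define pick where "pick p = (if \<exists>s\<in>S. dist s (fst p) < 1 / real (Suc (snd p))
      then SOME s. s \<in> S \<and> dist s (fst p) < 1 / real (Suc (snd p)) else s0)"
    for p :: "('a \<times> 'a) \<times> nat"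
  have pick: "pick p \<in> S" "(\<exists>s\<in>S. dist s (fst p) < 1 / real (Suc (snd p))) \<Longrightarrow>
      dist (pick p) (fst p) < 1 / real (Suc (snd p))" for p
    using s0 someI_ex[of "\<lambda>s. s \<in> S \<and> dist s (fst p) < 1 / real (Suc (snd p))"]
    by (auto simp: pick_def)
  define C where "C = pick ` ((D \<times> D) \<times> UNIV)"
  have "D \<noteq> {}" using D(2) by auto
  then have "C \<noteq> {}" by (auto simp: C_def)
  moreover have "countable C" unfolding C_def using D(1) by (intro countable_image countable_SIGMA) auto
  ultimately obtain g :: "nat \<Rightarrow> _" where g: "range g = C" using uncountable_def by metis
  have "s \<in> closure C" if s: "s \<in> S" for s
    unfolding closure_approachable
  proof (intro allI impI)
    fix e :: real assume "e > 0"
    then obtain n where n: "1 / real (Suc n) < e / 2"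
      using reals_Archimedean[of "e/2"] by (auto simp: inverse_eq_divide)
    have "s \<in> closure (D \<times> D)" by (simp add: closure_Times D)
    then obtain d where d: "d \<in> D \<times> D" "dist d s < 1 / real (Suc n)"
      unfolding closure_approachable by (meson of_nat_0_less_iff zero_less_Suc zero_less_divide_1_iff)
    then have "dist (pick (d, n)) d < 1 / real (Suc n)"
      using pick(2)[of "(d, n)"] s by (metis dist_commute fst_conv snd_conv)
    then have "dist (pick (d, n)) s < e"
      using dist_triangle[of "pick (d, n)" s d] d n by linarith
    moreover have "pick (d, n) \<in> C" using d by (auto simp: C_def)
    ultimately show "\<exists>y\<in>C. dist y s < e" by blast
  qed
  then show ?thesis using g pick by (intro exI[of _ g]) (auto simp: C_def)
qed

section \<open>Unbounded symmetric operators\<close>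

locale symmetric_operator =
  fixes A :: "'a::{real_inner, complete_space} \<Rightarrow> 'a" and DA :: "'a set"
  assumes dom: "subspace DA"
    and A_add: "x \<in> DA \<Longrightarrow> y \<in> DA \<Longrightarrow> A (x + y) = A x + A y"
    and A_scale: "x \<in> DA \<Longrightarrow> A (c *\<^sub>R x) = c *\<^sub>R A x"
    and A_sym: "x \<in> DA \<Longrightarrow> y \<in> DA \<Longrightarrow> inner (A x) y = inner x (A y)"
begin

text \<open>\<open>A\<close> acts on the second argument only, so linearity in the first one holds
  without domain conditions.\<close>

definition Q :: "real \<Rightarrow> 'a \<Rightarrow> 'a \<Rightarrow> real" where
  "Q s u v = inner u (A v) - s * inner u v"

lemma Q_sym: "u \<in> DA \<Longrightarrow> v \<in> DA \<Longrightarrow> Q s u v = Q s v u"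
  by (metis A_sym Q_def inner_commute)

lemma Q_add_left: "Q s (x + y) z = Q s x z + Q s y z"
  by (simp add: Q_def inner_add_left algebra_simps)

lemma Q_scale_left: "Q s (c *\<^sub>R x) y = c * Q s x y"
  by (simp add: Q_def algebra_simps)

lemma Q_add_right: "x \<in> DA \<Longrightarrow> y \<in> DA \<Longrightarrow> Q s z (x + y) = Q s z x + Q s z y"
  by (simp add: Q_def A_add inner_add_right algebra_simps)

lemma Q_scale_right: "y \<in> DA \<Longrightarrow> Q s x (c *\<^sub>R y) = c * Q s x y"
  by (simp add: Q_def A_scale algebra_simps)

lemma Q_self: "Q s u u = inner u (A u) - s * (norm u)\<^sup>2"
  by (simp add: Q_def power2_norm_eq_inner)

lemma Q_Cauchy_Schwarz:
  assumes "subspace S" "S \<subseteq> DA" "\<And>x. x \<in> S \<Longrightarrow> Q s x x \<ge> 0" "x \<in> S" "y \<in> S"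
  shows "(Q s x y)\<^sup>2 \<le> Q s x x * Q s y y"
  using assms by (intro form_Cauchy_Schwarz[of S]) (auto simp: Q_add_left Q_scale_left intro: Q_sym)

text \<open>For a nonnegative form a null vector lies in the radical, by Cauchy--Schwarz. This is
  the mechanism that produces every eigenvector of a compression: make the form nonnegative on the
  block, with a null vector.\<close>

lemma Q_null_vector:
  assumes "subspace S" "S \<subseteq> DA" "\<And>x. x \<in> S \<Longrightarrow> Q s x x \<ge> 0" "v \<in> S" "Q s v v = 0" "w \<in> S"
  shows "inner w (A v) = s * inner w v"
  using Q_Cauchy_Schwarz[OF assms(1-3) assms(6,4)] assms(5) by (simp add: Q_def)

text \<open>\<open>r\<close> is the minimum of the Rayleigh quotient; at level \<open>r\<close> the
  form is nonnegative on the block and vanishes at the minimiser.\<close>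

lemma comp_spec_bottom:
  assumes "finite B" "span B \<subseteq> DA" "w0 \<in> span B" "w0 \<noteq> 0"
  shows "\<exists>v r. v \<in> span B \<and> norm v = 1 \<and> (\<forall>w\<in>span B. inner w (A v) = r * inner w v) \<and>
    (\<forall>w\<in>span B. r * (norm w)\<^sup>2 \<le> inner w (A w))"
proof -
  have "\<exists>v\<in>span B. norm v = 1 \<and> (\<forall>w\<in>span B. norm w = 1 \<longrightarrow> inner v (A v) \<le> inner w (A w))"
    using assms(2)
    by (intro quadratic_min_unit_sphere[OF assms(1,3,4), where M = A and g = inner])
      (auto intro: A_add A_scale simp: case_prod_unfold intro!: continuous_intros)
  then obtain v where v: "v \<in> span B" "norm v = 1"
    "\<And>w. w \<in> span B \<Longrightarrow> norm w = 1 \<Longrightarrow> inner v (A v) \<le> inner w (A w)" by blast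
  define r where "r = inner v (A v)"
  have low: "r * (norm w)\<^sup>2 \<le> inner w (A w)" if w: "w \<in> span B" for w
  proof (cases "w = 0")
    case False
    have "r \<le> inner (w /\<^sub>R norm w) (A (w /\<^sub>R norm w))"
      unfolding r_def using False w by (intro v(3) span_scale) auto
    also have "\<dots> = inner w (A w) / (norm w)\<^sup>2"
      using w assms(2) by (subst A_scale) (auto simp: field_simps power2_eq_square)
    finally show ?thesis using False by (simp add: field_simps)
  qed simp
  have "Q r v v = 0" by (simp add: Q_self r_def v(2))
  then have "inner w (A v) = r * inner w v" if "w \<in> span B" for w
    using Q_null_vector[OF subspace_span assms(2) _ v(1) _ that] low by (simp add: Q_self)
  then show ?thesis using v low by blast
qed

text \<open>Eigenvectors of distinct eigenvalues are orthogonal, hence independent in a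
  finite-dimensional span. Finiteness gives the \<open>Min\<close> and \<open>Max\<close> in
  \<open>mu1\<close> and \<open>mu2\<close> their meaning.\<close>

lemma comp_spec_finite:
  assumes "finite B" "span B \<subseteq> DA"
  shows "finite (comp_spec A (span B))"
proof -
  define f where "f l = (SOME v. v \<in> span B \<and> v \<noteq> 0 \<and> (\<forall>w\<in>span B. inner w (A v) = l * inner w v))" for l
  have f: "f l \<in> span B" "f l \<noteq> 0" "\<And>w. w \<in> span B \<Longrightarrow> inner w (A (f l)) = l * inner w (f l)"
    if "l \<in> comp_spec A (span B)" for l
    using someI_ex[of "\<lambda>v. v \<in> span B \<and> v \<noteq> 0 \<and> (\<forall>w\<in>span B. inner w (A v) = l * inner w v)"] that
    unfolding f_def comp_spec_def by blast+
  have orth: "inner (f l) (f m) = 0"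
    if l: "l \<in> comp_spec A (span B)" and m: "m \<in> comp_spec A (span B)" and "l \<noteq> m" for l m
  proof -
    have "m * inner (f l) (f m) = inner (f l) (A (f m))" using f l m by simp
    also have "\<dots> = inner (f m) (A (f l))"
      using A_sym[of "f l" "f m"] f l m assms(2) by (metis inner_commute subset_iff)
    also have "\<dots> = l * inner (f l) (f m)" using f l m by (simp add: inner_commute)
    finally show ?thesis using \<open>l \<noteq> m\<close> by simp
  qed
  have inj: "inj_on f (comp_spec A (span B))"
  proof (rule inj_onI, rule ccontr)
    fix l m assume lm: "l \<in> comp_spec A (span B)" "m \<in> comp_spec A (span B)" "f l = f m" "l \<noteq> m"
    then show False using orth[of l m] f(2)[of m] by simp
  qed
  have "independent (f ` comp_spec A (span B))"
    by (rule pairwise_orthogonal_independent)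
      (auto simp: pairwise_def orthogonal_def orth f(2) dest: f(2)[THEN not_sym], metis orth)
  then have "finite (f ` comp_spec A (span B))"
    using independent_span_bound[OF assms(1)] f(1) by (simp add: image_subset_iff)
  then show ?thesis using inj by (rule finite_imageD)
qed

lemma Min_comp_spec:
  assumes "finite B" "span B \<subseteq> DA" "w0 \<in> span B" "w0 \<noteq> 0"
  defines "r \<equiv> Min (comp_spec A (span B))"
  shows "\<exists>v\<in>span B. norm v = 1 \<and> (\<forall>w\<in>span B. inner w (A v) = r * inner w v)"
    and "w \<in> span B \<Longrightarrow> r * (norm w)\<^sup>2 \<le> inner w (A w)"
    and "r \<in> comp_spec A (span B)"
proof -
  obtain v s where v: "v \<in> span B" "norm v = 1" "\<And>w. w \<in> span B \<Longrightarrow> inner w (A v) = s * inner w v"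
    and low: "\<And>w. w \<in> span B \<Longrightarrow> s * (norm w)\<^sup>2 \<le> inner w (A w)"
    using comp_spec_bottom[OF assms(1-4)] by blast
  have mem: "s \<in> comp_spec A (span B)"
    using v unfolding comp_spec_def by (intro CollectI bexI[of _ v]) auto
  have "s \<le> t" if t: "t \<in> comp_spec A (span B)" for t
  proof -
    obtain u where u: "u \<in> span B" "u \<noteq> 0" "inner u (A u) = t * inner u u"
      using t unfolding comp_spec_def by blast
    then have "s * (norm u)\<^sup>2 \<le> t * (norm u)\<^sup>2" using low[OF u(1)] by (simp add: power2_norm_eq_inner)
    then show ?thesis using u by simp
  qed
  then have s: "r = s" unfolding r_def
    using mem comp_spec_finite[OF assms(1,2)] by (intro Min_eqI) auto
  show "\<exists>v\<in>span B. norm v = 1 \<and> (\<forall>w\<in>span B. inner w (A v) = r * inner w v)"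
    using v s by blast
  show "w \<in> span B \<Longrightarrow> r * (norm w)\<^sup>2 \<le> inner w (A w)" using low s by blast
  show "r \<in> comp_spec A (span B)" using mem s by simp
qed

text \<open>\<open>N\<close> is the compression of \<open>A - l\<close> to the block. Let
  \<open>t\<close> be the minimum of \<open>norm (N x)\<close> on the unit sphere, attained at
  \<open>u\<close>. Then \<open>u\<close> is a null vector of the nonnegative form \<open>b\<close>,
  so N (N u) = t^2 u. Factoring this as (N - t)(N + t) u = 0 yields an eigenvalue -t or t of
  \<open>N\<close>, and \<open>t <= e\<close> because \<open>v\<close> competes in the
  minimum.\<close>

lemma comp_spec_near:
  assumes B: "finite B" "span B \<subseteq> DA" and v: "v \<in> span B" "norm v = 1"
    and small: "\<And>w. w \<in> span B \<Longrightarrow> \<bar>Q l w v\<bar> \<le> e * norm w"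
  shows "\<exists>m\<in>comp_spec A (span B). \<bar>l - m\<bar> \<le> e"
proof -
  obtain E where E: "finite E" "span E = span B"
    "\<And>v. v \<in> span B \<Longrightarrow> (\<Sum>e\<in>E. inner e v *\<^sub>R e) = v" "\<And>e. e \<in> E \<Longrightarrow> norm e = 1"
    using orthonormal_basis_span[OF B(1)] by metis
  define N where "N x = (\<Sum>e\<in>E. Q l e x *\<^sub>R e)" for x
  have mem: "N x \<in> span B" for x
    unfolding N_def E(2)[symmetric] by (auto intro!: span_sum span_scale intro: span_base)
  have in_N: "inner w (N x) = Q l w x" if "w \<in> span B" for w x
  proof -
    have "Q l (\<Sum>e\<in>X. a e *\<^sub>R e) x = (\<Sum>e\<in>X. a e * Q l e x)" for X a
      by (induction X rule: infinite_finite_induct)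
        (simp_all add: Q_add_left Q_scale_left, simp_all add: Q_def)
    then have "Q l w x = (\<Sum>e\<in>E. inner e w * Q l e x)" using E(3)[OF that] by metis
    also have "\<dots> = inner w (N x)" by (simp add: N_def inner_sum_right inner_commute mult.commute)
    finally show ?thesis by simp
  qed
  have N_add: "N (x + y) = N x + N y" if "x \<in> span B" "y \<in> span B" for x y
    unfolding N_def using that B(2) by (subst Q_add_right) (auto simp: scaleR_left_distrib sum.distrib)
  have N_scale: "N (c *\<^sub>R x) = c *\<^sub>R N x" if "x \<in> span B" for c x
    unfolding N_def using that B(2) by (subst Q_scale_right) (auto simp: scaleR_sum_right)
  have N_sym: "inner (N x) y = inner x (N y)" if "x \<in> span B" "y \<in> span B" for x y
    using in_N[OF that(1)] in_N[OF that(2)] that B(2) Q_sym by (metis inner_commute subset_iff)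
  have "v \<noteq> 0" using v by auto
  have "\<exists>u\<in>span B. norm u = 1 \<and> (\<forall>w\<in>span B. norm w = 1 \<longrightarrow> norm (N u) \<le> norm (N w))"
    by (intro quadratic_min_unit_sphere[OF B(1) v(1) \<open>v \<noteq> 0\<close>, where M = N and g = "\<lambda>x y. norm y"])
      (auto simp: N_add N_scale case_prod_unfold intro!: continuous_intros)
  then obtain u where u: "u \<in> span B" "norm u = 1"
    and min: "\<And>w. w \<in> span B \<Longrightarrow> norm w = 1 \<Longrightarrow> norm (N u) \<le> norm (N w)" by blast
  define t where "t = norm (N u)"
  have "t \<le> e"
  proof -
    have "(norm (N v))\<^sup>2 \<le> e * norm (N v)"
      using in_N[OF mem[of v], of v] small[OF mem[of v]] by (simp add: power2_norm_eq_inner)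
    then have "norm (N v) * norm (N v) \<le> e * norm (N v)" by (simp add: power2_eq_square)
    moreover have "0 \<le> e" using small[OF v(1)] v(2) by simp
    ultimately have "norm (N v) \<le> e"
      by (metis mult_le_cancel_right norm_ge_zero order_antisym_conv linorder_not_le)
    then show ?thesis using min[OF v] by (simp add: t_def)
  qed
  define b where "b x y = inner (N x) (N y) - t\<^sup>2 * inner x y" for x y
  have b_nonneg: "b x x \<ge> 0" if x: "x \<in> span B" for x
  proof (cases "x = 0")
    case False
    have "t \<le> norm (N (x /\<^sub>R norm x))"
      unfolding t_def using False x by (intro min span_scale) auto
    then have "t * norm x \<le> norm (N x)" using False x by (simp add: N_scale field_simps)
    then have "(t * norm x)\<^sup>2 \<le> (norm (N x))\<^sup>2" by (intro power_mono) (auto simp: t_def)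
    then show ?thesis by (simp add: b_def power2_norm_eq_inner power_mult_distrib)
  qed (use N_scale[of 0 0] in \<open>simp add: b_def span_zero\<close>)
  have "b w u = 0" if w: "w \<in> span B" for w
  proof -
    have "(b w u)\<^sup>2 \<le> b w w * b u u"
      by (rule form_Cauchy_Schwarz[OF subspace_span[of B] _ _ _ b_nonneg w u(1)])
        (auto simp: b_def N_add N_scale inner_add_left algebra_simps inner_commute)
    moreover have "b u u = 0" using u by (simp add: b_def t_def dot_square_norm)
    ultimately show ?thesis by simp
  qed
  then have NN: "inner w (N (N u)) = t\<^sup>2 * inner w u" if "w \<in> span B" for w
    using that N_sym[OF that mem[of u]] by (simp add: b_def)
  \<comment> \<open>If \<open>y\<close> vanishes, \<open>u\<close> is an eigenvector for -t;
    otherwise \<open>y\<close> is one for t.\<close>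
  define y where "y = N u + t *\<^sub>R u"
  have y: "y \<in> span B" using u mem by (auto simp: y_def intro: span_add span_scale)
  have eig: "inner w (A x) = (l + r) * inner w x" if "inner w (N x) = r * inner w x" "w \<in> span B" for w x r
    using in_N[of w x] that by (simp add: Q_def algebra_simps)
  show ?thesis
  proof (cases "y = 0")
    case True
    then have "N u = (- t) *\<^sub>R u" unfolding y_def by (metis add_eq_0_iff2 scaleR_minus_left)
    then have "inner w (A u) = (l + - t) * inner w u" if "w \<in> span B" for w
      using that by (intro eig) simp_all
    then have "l + - t \<in> comp_spec A (span B)"
      using u unfolding comp_spec_def by (intro CollectI bexI[of _ u]) auto
    then show ?thesis using \<open>t \<le> e\<close> by (intro bexI) (auto simp: t_def)
  next
    case False
    have "inner w (N y) = t * inner w y" if w: "w \<in> span B" for w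
      using NN[OF w] u mem by (simp add: y_def N_add N_scale span_scale inner_add_right
          power2_eq_square algebra_simps)
    then have "inner w (A y) = (l + t) * inner w y" if "w \<in> span B" for w
      using that by (intro eig)
    then have "l + t \<in> comp_spec A (span B)"
      using y False unfolding comp_spec_def by (intro CollectI bexI[of _ y]) auto
    then show ?thesis using \<open>t \<le> e\<close> by (intro bexI) (auto simp: t_def)
  qed
qed

section \<open>Resolvents, form bounds and isolated spectral points\<close>

lemma resolvent_exists:
  assumes "l \<notin> spec A DA"
  obtains R where "bounded_linear R" "\<And>y. R y \<in> DA" "\<And>y. A (R y) = y + l *\<^sub>R R y"
    "\<And>x y. inner (R x) y = inner x (R y)"
proof -
  define R where "R = inv_into DA (\<lambda>x. A x - l *\<^sub>R x)"
  obtain C where bij: "bij_betw (\<lambda>x. A x - l *\<^sub>R x) DA UNIV"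
    and C: "\<And>x. x \<in> DA \<Longrightarrow> norm x \<le> C * norm (A x - l *\<^sub>R x)"
    using assms by (auto simp: spec_def)
  have R: "R y \<in> DA" "A (R y) - l *\<^sub>R R y = y" for y
    using bij unfolding bij_betw_def R_def
    by (metis UNIV_I inv_into_into, metis (no_types, lifting) UNIV_I f_inv_into_f)
  have uniq: "R y = x" if "x \<in> DA" "A x - l *\<^sub>R x = y" for x y
    using bij that R[of y] unfolding bij_betw_def by (metis (no_types, lifting) inj_onD)
  have lin: "linear R"
  proof (rule linearI)
    show "R (x + y) = R x + R y" for x y
    proof (rule uniq)
      show "R x + R y \<in> DA" using dom R by (simp add: subspace_add)
      show "A (R x + R y) - l *\<^sub>R (R x + R y) = x + y"
        using R(2)[of x] R(2)[of y] by (simp add: A_add R(1) algebra_simps)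
    qed
    show "R (c *\<^sub>R x) = c *\<^sub>R R x" for c x
    proof (rule uniq)
      show "c *\<^sub>R R x \<in> DA" using dom R by (simp add: subspace_scale)
      have "A (c *\<^sub>R R x) - l *\<^sub>R (c *\<^sub>R R x) = c *\<^sub>R (A (R x) - l *\<^sub>R R x)"
        by (simp add: A_scale R(1) algebra_simps)
      then show "A (c *\<^sub>R R x) - l *\<^sub>R (c *\<^sub>R R x) = c *\<^sub>R x" by (simp add: R)
    qed
  qed
  have "norm (R x) \<le> norm x * C" for x
    using C[OF R(1)[of x]] R(2)[of x] by (simp add: mult.commute)
  then have "bounded_linear R"
    using lin by (simp add: bounded_linear_def bounded_linear_axioms_def) blast
  moreover have "inner (R x) y = inner x (R y)" for x y
  proof -
    have "inner (R x) y = inner (R x) (A (R y) - l *\<^sub>R R y)" by (simp add: R)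
    also have "\<dots> = inner (A (R x) - l *\<^sub>R R x) (R y)"
      using A_sym[OF R(1)[of x] R(1)[of y]] by (simp add: inner_diff_left inner_diff_right)
    finally show ?thesis by (simp add: R)
  qed
  moreover have "A (R y) = y + l *\<^sub>R R y" for y using R(2)[of y] by (simp add: algebra_simps)
  ultimately show ?thesis using that R(1) by blast
qed

text \<open>A quantitative half of the spectral mapping for the resolvent: (A - (l + 1/rho)) R x is
  -1/rho times (R x - rho x), so the bound for \<open>A\<close> at l + 1/rho controls
  \<open>R x\<close>, and then \<open>x\<close> by the triangle inequality.\<close>

lemma resolvent_shift_bounded_below:
  assumes R: "\<And>y. R y \<in> DA" "\<And>y. A (R y) = y + l *\<^sub>R R y"
    and "\<rho> > 0" "l + 1 / \<rho> \<notin> spec A DA"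
  shows "\<exists>k>0. \<forall>x. k * norm x \<le> norm (R x - \<rho> *\<^sub>R x)"
proof -
  obtain C where C: "\<And>x. x \<in> DA \<Longrightarrow> norm x \<le> C * norm (A x - (l + 1 / \<rho>) *\<^sub>R x)"
    using assms(4) by (auto simp: spec_def)
  define D where "D = (\<bar>C\<bar> / \<rho> + 1) / \<rho>"
  have D: "D > 0" using assms(3) by (simp add: D_def add_nonneg_pos)
  have "norm x \<le> D * norm (R x - \<rho> *\<^sub>R x)" for x
  proof -
    have "A (R x) - (l + 1 / \<rho>) *\<^sub>R R x = (- 1 / \<rho>) *\<^sub>R (R x - \<rho> *\<^sub>R x)"
      using assms(3) by (simp add: R algebra_simps)
    then have eq: "norm (A (R x) - (l + 1 / \<rho>) *\<^sub>R R x) = norm (R x - \<rho> *\<^sub>R x) / \<rho>"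
      using assms(3) by simp
    have "norm (R x) \<le> C * (norm (R x - \<rho> *\<^sub>R x) / \<rho>)" using C[OF R(1)[of x]] eq by simp
    also have "\<dots> \<le> \<bar>C\<bar> * (norm (R x - \<rho> *\<^sub>R x) / \<rho>)"
      using assms(3) by (intro mult_right_mono) auto
    finally have 1: "norm (R x) \<le> \<bar>C\<bar> / \<rho> * norm (R x - \<rho> *\<^sub>R x)" by simp
    have "\<rho> * norm x = norm (R x - (R x - \<rho> *\<^sub>R x))" using assms(3) by simp
    also have "\<dots> \<le> norm (R x) + norm (R x - \<rho> *\<^sub>R x)" by (rule norm_triangle_ineq4)
    also have "\<dots> \<le> (\<bar>C\<bar> / \<rho> + 1) * norm (R x - \<rho> *\<^sub>R x)" using 1 by (simp add: algebra_simps)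
    finally show ?thesis using assms(3) by (simp add: D_def field_simps)
  qed
  then have "1 / D * norm x \<le> norm (R x - \<rho> *\<^sub>R x)" for x
    using D by (simp add: field_simps)
  then show ?thesis using D by (intro exI[of _ "1 / D"]) simp
qed

text \<open>For \<open>l\<close> above the spectrum, a shift of \<open>-R\<close> by a negative
  \<open>t\<close> corresponds to the point l - 1/t, still above the spectrum. Hence
  \<open>-R\<close> is nonnegative, and inserting \<open>A u - l u\<close>, whose image under
  \<open>R\<close> is \<open>u\<close>, gives the bound with constant \<open>l\<close>.\<close>

lemma form_le_if_spec_bdd_above:
  assumes "bdd_above (spec A DA)"
  shows "\<exists>C. \<forall>u\<in>DA. inner u (A u) \<le> C * (norm u)\<^sup>2"
proof -
  obtain b where b: "\<And>s. s \<in> spec A DA \<Longrightarrow> s \<le> b" using assms by (auto simp: bdd_above_def)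
  define l where "l = b + 1"
  have out: "s \<notin> spec A DA" if "s \<ge> l" for s using b[of s] that by (auto simp: l_def)
  obtain C where bij: "bij_betw (\<lambda>x. A x - l *\<^sub>R x) DA UNIV"
    using out[of l] by (auto simp: spec_def)
  obtain R where R: "bounded_linear R" "\<And>y. R y \<in> DA" "\<And>y. A (R y) = y + l *\<^sub>R R y"
    "\<And>x y. inner (R x) y = inner x (R y)" using resolvent_exists out[of l] by blast
  have neg: "inner (- R x) x \<ge> 0" for x
  proof (rule nonneg_if_bounded_below_shifts)
    show "bounded_linear (\<lambda>x. - R x)" using R(1) by (rule bounded_linear_minus)
    show "inner (- R x) y = inner x (- R y)" for x y by (simp add: R(4))
    fix t :: real assume t: "t < 0"
    then have "l + 1 / (- t) \<notin> spec A DA" by (intro out) (simp add: field_simps)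
    then obtain k where "k > 0" "\<And>x. k * norm x \<le> norm (R x - (- t) *\<^sub>R x)"
      using resolvent_shift_bounded_below[OF R(2,3), of "- t"] t by auto
    moreover have "norm (- R x - t *\<^sub>R x) = norm (R x - (- t) *\<^sub>R x)" for x
      using norm_minus_cancel[of "R x + t *\<^sub>R x"] by (simp add: algebra_simps)
    ultimately show "\<exists>k>0. \<forall>x. k * norm x \<le> norm (- R x - t *\<^sub>R x)" by auto
  qed
  have "inner u (A u) \<le> l * (norm u)\<^sup>2" if u: "u \<in> DA" for u
  proof -
    have "A (R (A u - l *\<^sub>R u)) - l *\<^sub>R R (A u - l *\<^sub>R u) = A u - l *\<^sub>R u"
      by (simp add: R(3))
    then have "R (A u - l *\<^sub>R u) = u"
      using bij R(2) u unfolding bij_betw_def by (metis (no_types, lifting) inj_onD)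
    then show ?thesis using neg[of "A u - l *\<^sub>R u"]
      by (simp add: inner_diff_right power2_norm_eq_inner)
  qed
  then show ?thesis by blast
qed

text \<open>\<open>T = 1 - h R\<close>, with \<open>R\<close> the resolvent at \<open>l - h\<close>,
  sends the eigenvalue \<open>l\<close> to 0; a spectral value r of \<open>T\<close> comes from the
  point l + h r/(1 - r). The hole of radius \<open>h\<close> around \<open>l\<close> therefore
  leaves no spectrum of \<open>T\<close> below 1/2 except 0. So \<open>T\<close> is nonnegative with
  a gap, and the kernel iteration applies.\<close>

lemma isolated_point_kernel_approximation:
  assumes h: "0 < h" and gap: "\<And>m. 0 < \<bar>m - l\<bar> \<Longrightarrow> \<bar>m - l\<bar> \<le> h \<Longrightarrow> m \<notin> spec A DA"
    and R: "bounded_linear R" "\<And>y. R y \<in> DA" "\<And>y. A (R y) = y + (l - h) *\<^sub>R R y"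
    "\<And>x y. inner (R x) y = inner x (R y)"
  shows "h * inner (R v) v \<le> (norm v)\<^sup>2"
    and "\<exists>C. \<forall>v. \<exists>k\<in>DA. A k = l *\<^sub>R k \<and> (norm (v - k))\<^sup>2 \<le> C * ((norm v)\<^sup>2 - h * inner (R v) v)"
proof -
  define T where "T y = y - h *\<^sub>R R y" for y
  interpret R: bounded_linear R by (rule R)
  have T: "bounded_linear T" unfolding T_def
    by (intro bounded_linear_sub bounded_linear_ident bounded_linear_const_scaleR R(1))
  interpret T: bounded_linear T by (rule T)
  have T_sym: "inner (T x) y = inner x (T y)" for x y
    by (simp add: T_def inner_diff_left inner_diff_right R(4))
  \<comment> \<open>For r < 1/2 one has |r| <= 1 - r, which is what keeps h r/(1 - r) within the
    hole; r = 0 is the point \<open>l\<close> itself.\<close>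
  have below: "\<exists>k>0. \<forall>x. k * norm x \<le> norm (T x - r *\<^sub>R x)" if r: "r < 1/2" "r \<noteq> 0" for r
  proof -
    define \<rho> where "\<rho> = (1 - r) / h"
    have "\<rho> > 0" using r h by (simp add: \<rho>_def)
    have "l - h + 1 / \<rho> - l = h * r / (1 - r)" using r by (simp add: \<rho>_def field_simps)
    moreover have "\<bar>r\<bar> \<le> 1 - r" using r by linarith
    then have "0 < \<bar>h * r / (1 - r)\<bar>" "\<bar>h * r / (1 - r)\<bar> \<le> h"
      using r h mult_left_mono[of "\<bar>r\<bar>" "1 - r" h] by (simp_all add: abs_mult divide_le_eq)
    ultimately have "l - h + 1 / \<rho> \<notin> spec A DA" by (intro gap) simp_all
    then obtain k where k: "k > 0" "\<And>x. k * norm x \<le> norm (R x - \<rho> *\<^sub>R x)"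
      using resolvent_shift_bounded_below[OF R(2,3) \<open>\<rho> > 0\<close>] by blast
    have "norm (T x - r *\<^sub>R x) = h * norm (R x - \<rho> *\<^sub>R x)" for x
    proof -
      have "(h * \<rho>) *\<^sub>R x = x - r *\<^sub>R x" using h by (simp add: \<rho>_def scaleR_diff_left)
      then have "T x - r *\<^sub>R x = (- h) *\<^sub>R (R x - \<rho> *\<^sub>R x)"
        by (simp add: T_def scaleR_diff_right)
      then show ?thesis using h by simp
    qed
    then have "h * k * norm x \<le> norm (T x - r *\<^sub>R x)" for x
      using k(2)[of x] h by (simp add: mult.assoc)
    then show ?thesis using h k(1) by (intro exI[of _ "h * k"]) simp
  qed
  have T_nonneg: "inner (T x) x \<ge> 0" for x
    by (rule nonneg_if_bounded_below_shifts[OF T T_sym]) (auto intro: below)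
  have T_gap: "1/2 * inner (T x) x \<le> (norm (T x))\<^sup>2" for x
  proof -
    \<comment> \<open>The gap inequality says that T^2 - T/2 is nonnegative, so again lower bounds
      for its negative shifts are needed.\<close>
    define G where "G x = T (T x) - (1/2) *\<^sub>R T x" for x
    have "bounded_linear G" unfolding G_def
      by (intro bounded_linear_sub bounded_linear_const_scaleR T bounded_linear_compose[OF T T, unfolded comp_def])
    moreover have "inner (G x) y = inner x (G y)" for x y
      by (simp add: G_def inner_diff_left inner_diff_right T_sym)
    moreover have "\<exists>k>0. \<forall>x. k * norm x \<le> norm (G x - t *\<^sub>R x)" if t: "t < 0" for t
    \<comment> \<open>-1/16 is the minimum of x^2 - x/2. Below it, completing the square at 1/4
      suffices. Otherwise the polynomial x^2 - x/2 - t has the roots 1/4 - D and 1/4 + D, both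
      strictly between 0 and 1/2, and \<open>below\<close> applies to each factor.\<close>
    proof (cases "t < - 1/16")
      case True
      have "(- t - 1/16) * norm x \<le> norm (G x - t *\<^sub>R x)" for x
      proof (cases "x = 0")
        case False
        have "(- t - 1/16) * (norm x)\<^sup>2 + (norm (T x - (1/4) *\<^sub>R x))\<^sup>2 = inner (G x - t *\<^sub>R x) x"
          by (simp add: G_def power2_norm_eq_inner inner_diff_left inner_diff_right T_sym[of "T x" x]
              inner_commute[of x "T x"] algebra_simps)
        moreover have "\<dots> \<le> norm (G x - t *\<^sub>R x) * norm x" by (rule norm_cauchy_schwarz)
        ultimately have "(- t - 1/16) * (norm x)\<^sup>2 \<le> norm (G x - t *\<^sub>R x) * norm x"
          using zero_le_power2[of "norm (T x - (1/4) *\<^sub>R x)"] by linarith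
        then have "(- t - 1/16) * norm x * norm x \<le> norm (G x - t *\<^sub>R x) * norm x"
          by (simp add: power2_eq_square mult.assoc)
        then show ?thesis using False by (meson mult_le_cancel_right zero_less_norm_iff linorder_not_le)
      qed simp
      then show ?thesis using True by (intro exI[of _ "- t - 1/16"]) auto
    next
      case False
      define D where "D = sqrt (1/16 + t)"
      have D: "0 \<le> D" "D * D = 1/16 + t" using False by (auto simp: D_def)
      have "D < 1/4"
      proof (rule power2_less_imp_less)
        show "D\<^sup>2 < (1/4)\<^sup>2" using D t by (simp add: power2_eq_square)
      qed simp
      note D = D this
      obtain k1 where k1: "k1 > 0" "\<And>x. k1 * norm x \<le> norm (T x - (1/4 - D) *\<^sub>R x)"
        using below[of "1/4 - D"] D by auto
      obtain k2 where k2: "k2 > 0" "\<And>x. k2 * norm x \<le> norm (T x - (1/4 + D) *\<^sub>R x)"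
        using below[of "1/4 + D"] D by auto
      have "k1 * k2 * norm x \<le> norm (G x - t *\<^sub>R x)" for x
      proof -
        define y where "y = T x - (1/4 + D) *\<^sub>R x"
        have t_eq: "t = - ((1/4 - D) * (1/4 + D))" using D(2) by (simp add: algebra_simps)
        have "G x - t *\<^sub>R x = T y - (1/4 - D) *\<^sub>R y"
        proof -
          have "T y = T (T x) - (1/4 + D) *\<^sub>R T x" by (simp add: y_def T.diff T.scale)
          moreover have "(1/2) *\<^sub>R T x = (1/4 + D) *\<^sub>R T x + (1/4 - D) *\<^sub>R T x"
            by (simp flip: scaleR_left_distrib)
          ultimately show ?thesis unfolding G_def t_eq y_def scaleR_diff_right scaleR_scaleR
            by simp
        qed
        then have "k1 * norm y \<le> norm (G x - t *\<^sub>R x)" using k1(2)[of y] by simp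
        moreover have "k1 * (k2 * norm x) \<le> k1 * norm y"
          using k1(1) k2(2)[of x] by (simp add: y_def)
        ultimately show ?thesis by (simp add: mult.assoc)
      qed
      then show ?thesis using k1 k2 by (intro exI[of _ "k1 * k2"]) auto
    qed
    ultimately have "0 \<le> inner (G x) x" by (rule nonneg_if_bounded_below_shifts)
    then show ?thesis by (simp add: G_def inner_diff_left T_sym[of "T x" x] power2_norm_eq_inner)
  qed
  have form: "inner (T v) v = (norm v)\<^sup>2 - h * inner (R v) v" for v
    by (simp add: T_def inner_diff_left power2_norm_eq_inner)
  show "h * inner (R v) v \<le> (norm v)\<^sup>2" using T_nonneg[of v] form[of v] by simp
  obtain C where C: "\<And>v. \<exists>k. T k = 0 \<and> (norm (v - k))\<^sup>2 \<le> C * inner (T v) v"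
    using kernel_approximation[OF T T_sym T_nonneg _ T_gap] by auto
  have "k \<in> DA \<and> A k = l *\<^sub>R k" if "T k = 0" for k
  proof -
    have k: "k = h *\<^sub>R R k" using that by (simp add: T_def)
    then have mem: "k \<in> DA" using R(2) dom by (metis subspace_scale)
    have "A k = h *\<^sub>R A (R k)" using k A_scale[OF R(2)] by metis
    also have "\<dots> = h *\<^sub>R k + (l - h) *\<^sub>R (h *\<^sub>R R k)" by (simp add: R(3) algebra_simps)
    also have "\<dots> = l *\<^sub>R k" using k by (simp flip: k add: algebra_simps)
    finally show ?thesis using mem by simp
  qed
  then show "\<exists>C. \<forall>v. \<exists>k\<in>DA. A k = l *\<^sub>R k \<and> (norm (v - k))\<^sup>2 \<le> C * ((norm v)\<^sup>2 - h * inner (R v) v)"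
    using C form by metis
qed

end

section \<open>Negative systems of the form\<close>

context symmetric_operator
begin

definition neg_system :: "real \<Rightarrow> nat \<Rightarrow> (nat \<Rightarrow> 'a) \<Rightarrow> bool" where
  "neg_system s m n \<longleftrightarrow> (\<forall>i<m. n i \<in> DA) \<and>
    (\<forall>i<m. \<forall>j<m. Q s (n i) (n j) = (if i = j then - 1 else 0))"

text \<open>If the lengths are bounded, a system of maximal length is taken; a negative vector
  \<open>Q\<close>-orthogonal to it could be normalised and appended.\<close>

lemma neg_system_dichotomy:
  assumes "\<not> (\<forall>m. \<exists>n. neg_system s m n)"
  obtains m n where "neg_system s m n"
    "\<And>u. u \<in> DA \<Longrightarrow> (\<And>j. j < m \<Longrightarrow> Q s u (n j) = 0) \<Longrightarrow> Q s u u \<ge> 0"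
proof -
  define k where "k = (LEAST m. \<not> (\<exists>n. neg_system s m n))"
  obtain m0 where "\<not> (\<exists>n. neg_system s m0 n)" using assms by blast
  then have k: "\<not> (\<exists>n. neg_system s k n)" unfolding k_def by (rule LeastI)
  have "neg_system s 0 (\<lambda>_. 0)" by (simp add: neg_system_def)
  then have "k \<noteq> 0" using k by metis
  then obtain m where m: "k = Suc m" using not0_implies_Suc by blast
  have "m < k" by (simp add: m)
  then have "\<not> \<not> (\<exists>n. neg_system s m n)" unfolding k_def by (rule not_less_Least)
  then obtain n where n: "neg_system s m n" by blast
  have "Q s u u \<ge> 0" if u: "u \<in> DA" "\<And>j. j < m \<Longrightarrow> Q s u (n j) = 0" for u
  proof (rule ccontr)
    assume "\<not> Q s u u \<ge> 0"
    then have neg: "Q s u u < 0" by simp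
    define t where "t = sqrt (- Q s u u)"
    define c where "c = inverse t"
    have t: "t > 0" "Q s u u = - (t * t)" using neg by (simp_all add: t_def)
    then have c: "c * (c * Q s u u) = - 1" unfolding c_def t(2) by (simp add: field_simps)
    define n' where "n' = n(m := c *\<^sub>R u)"
    have "neg_system s (Suc m) n'"
      unfolding neg_system_def
    proof (intro conjI allI impI)
      show "n' i \<in> DA" if "i < Suc m" for i
      proof (cases "i = m")
        case True
        then show ?thesis using u(1) dom by (simp add: n'_def subspace_scale)
      next
        case False
        then show ?thesis using that n by (simp add: n'_def neg_system_def)
      qed
      fix i j assume ij: "i < Suc m" "j < Suc m"
      have nd: "n i \<in> DA" if "i < m" for i using n that by (simp add: neg_system_def)
      have 0: "Q s (n i) u = 0" if "i < m" for i using Q_sym[OF nd[OF that] u(1)] u(2)[OF that] by (rule trans)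
      show "Q s (n' i) (n' j) = (if i = j then - 1 else 0)"
      proof (cases "i = m"; cases "j = m")
        assume "i = m" "j = m"
        then show ?thesis using c u(1) by (simp add: n'_def Q_scale_left Q_scale_right)
      next
        assume "i = m" "j \<noteq> m"
        then show ?thesis using ij u(2)[of j] by (simp add: n'_def Q_scale_left)
      next
        assume "i \<noteq> m" "j = m"
        then show ?thesis using ij u(1) 0[of i] by (simp add: n'_def Q_scale_right)
      next
        assume "i \<noteq> m" "j \<noteq> m"
        then show ?thesis using ij n by (simp add: n'_def neg_system_def)
      qed
    qed
    then show False using k m by blast
  qed
  then show ?thesis using that n by blast
qed

text \<open>The map \<open>p\<close> removes the finitely many negative directions, so
  Cauchy--Schwarz for the form holds for \<open>p (R (v k))\<close> and \<open>p (v k)\<close>. The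
  corrections \<open>a\<close>, \<open>b\<close>, \<open>d\<close> pair \<open>v k\<close> with
  fixed vectors and tend to 0 weakly. This forces \<open>inner (R (v k)) (v k)\<close> up to its
  maximal value 1/h, so \<open>v k\<close> approaches the eigenspace, whereas weak convergence keeps
  it away.\<close>

lemma nonneg_codim_no_null_sequence:
  assumes h: "0 < h" and gap: "\<And>m. 0 < \<bar>m - l\<bar> \<Longrightarrow> \<bar>m - l\<bar> \<le> h \<Longrightarrow> m \<notin> spec A DA"
    and ker: "finite B" "{x \<in> DA. A x = l *\<^sub>R x} = span B"
    and n: "neg_system (l - h) m n"
    and nonneg: "\<And>u. u \<in> DA \<Longrightarrow> (\<And>j. j < m \<Longrightarrow> Q (l - h) u (n j) = 0) \<Longrightarrow> Q (l - h) u u \<ge> 0"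
    and v: "\<And>k. v k \<in> DA" "\<And>k. norm (v k) = 1" "\<And>y. (\<lambda>k. inner y (v k)) \<longlonglongrightarrow> 0"
    and lim: "(\<lambda>k. inner (v k) (A (v k))) \<longlonglongrightarrow> l"
  shows False
proof -
  define s where "s = l - h"
  have nd: "n i \<in> DA" if "i < m" for i using n that by (simp add: neg_system_def)
  have nn: "Q s (n i) (n j) = (if i = j then - 1 else 0)" if "i < m" "j < m" for i j
    using n that by (simp add: neg_system_def s_def)
  have "s \<notin> spec A DA" using h by (intro gap) (auto simp: s_def)
  then obtain R where R: "bounded_linear R" "\<And>y. R y \<in> DA" "\<And>y. A (R y) = y + s *\<^sub>R R y"
    "\<And>x y. inner (R x) y = inner x (R y)" using resolvent_exists by blast
  note iso = isolated_point_kernel_approximation[OF h gap R(1,2) R(3)[unfolded s_def] R(4)]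
  obtain C where C: "\<And>v. \<exists>k\<in>DA. A k = l *\<^sub>R k \<and> (norm (v - k))\<^sup>2 \<le> C * ((norm v)\<^sup>2 - h * inner (R v) v)"
    using iso(2) by blast
  define S where "S = {u \<in> DA. \<forall>j<m. Q s u (n j) = 0}"
  have "subspace S"
    using dom unfolding subspace_def S_def
    by (auto simp: Q_add_left Q_scale_left) (simp add: Q_def)
  \<comment> \<open>The sign is plus because each \<open>n j\<close> has form value -1;
    \<open>p u\<close> is the \<open>Q\<close>-orthogonal projection off the system.\<close>
  define p where "p u = u + (\<Sum>j<m. Q s u (n j) *\<^sub>R n j)" for u
  have Q_sum_left: "Q s (\<Sum>j\<in>I. a j *\<^sub>R n j) w = (\<Sum>j\<in>I. a j * Q s (n j) w)" for a w and I :: "nat set"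
    by (simp add: Q_def inner_sum_left sum_subtractf sum_distrib_left algebra_simps)
  have p_mem: "p u \<in> DA" if "u \<in> DA" for u
    unfolding p_def using dom that nd by (intro subspace_add subspace_sum subspace_scale) auto
  have p_n: "Q s (p u) (n i) = 0" if "i < m" for u i
  proof -
    have "(\<Sum>j<m. Q s u (n j) * Q s (n j) (n i)) = (\<Sum>j<m. if j = i then - Q s u (n i) else 0)"
      using that by (intro sum.cong) (auto simp: nn)
    then show ?thesis using that by (simp add: p_def Q_add_left Q_sum_left)
  qed
  have p_S: "p u \<in> S" if "u \<in> DA" for u using that by (simp add: S_def p_mem p_n)
  have Qp: "Q s (p u) (p w) = Q s u w + (\<Sum>j<m. Q s u (n j) * Q s w (n j))"
    if "u \<in> DA" "w \<in> DA" for u w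
  proof -
    have "Q s (p u) (p w) = Q s (p w) (p u)" using that by (intro Q_sym p_mem)
    also have "\<dots> = Q s w (p u) + (\<Sum>j<m. Q s w (n j) * Q s (n j) (p u))"
      by (subst (1) p_def) (simp add: Q_add_left Q_sum_left)
    also have "(\<Sum>j<m. Q s w (n j) * Q s (n j) (p u)) = 0"
      using p_n that by (intro sum.neutral) (simp add: Q_sym[OF nd p_mem])
    also have "Q s w (p u) = Q s (p u) w" using that by (intro Q_sym p_mem)
    also have "\<dots> = Q s u w + (\<Sum>j<m. Q s u (n j) * Q s (n j) w)"
      by (simp add: p_def Q_add_left Q_sum_left)
    also have "\<dots> = Q s u w + (\<Sum>j<m. Q s u (n j) * Q s w (n j))"
      using that nd by (simp add: Q_sym)
    finally show ?thesis by simp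
  qed
  have QR: "Q s w (R y) = inner w y" for w y by (simp add: Q_def R(3) inner_add_right)
  define a where "a k = (\<Sum>j<m. (inner (n j) (v k))\<^sup>2)" for k
  define b where "b k = (\<Sum>j<m. (Q s (v k) (n j))\<^sup>2)" for k
  define d where "d k = (\<Sum>j<m. inner (n j) (v k) * Q s (v k) (n j))" for k
  define r where "r k = inner (R (v k)) (v k)" for k
  define q where "q k = Q s (v k) (v k) + b k" for k
  \<comment> \<open>Since \<open>A - s\<close> inverts \<open>R\<close>, the form of
    \<open>R (v k)\<close> with \<open>v k\<close> is 1 and that of \<open>R (v k)\<close> with
    itself is \<open>r k\<close>; the other terms come from the removed directions.\<close>
  have CS: "(1 + d k)\<^sup>2 \<le> (r k + a k) * q k" for k
  proof -
    have "(Q s (p (R (v k))) (p (v k)))\<^sup>2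
        \<le> Q s (p (R (v k))) (p (R (v k))) * Q s (p (v k)) (p (v k))"
      using \<open>subspace S\<close> nonneg v R(2) by (intro Q_Cauchy_Schwarz[of S] p_S) (auto simp: S_def s_def)
    moreover have "Q s (R (v k)) w = inner w (v k)" if "w \<in> DA" for w
      using Q_sym[OF R(2) that] by (simp add: QR)
    ultimately show ?thesis using v nd R(2)
      by (simp add: Qp a_def b_def d_def r_def q_def power2_eq_square dot_square_norm)
  qed
  \<comment> \<open>Moving \<open>A\<close> onto the fixed vector \<open>n j\<close> makes weak
    convergence applicable, although \<open>A (v k)\<close> need not be bounded.\<close>
  have Qn: "(\<lambda>k. Q s (v k) (n j)) \<longlonglongrightarrow> 0" if "j < m" for j
  proof -
    have "Q s (v k) (n j) = inner (A (n j) - s *\<^sub>R n j) (v k)" for k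
      by (simp add: Q_def inner_diff_left inner_commute[of "v k"])
    then show ?thesis using v(3) by simp
  qed
  have "a \<longlonglongrightarrow> (\<Sum>j<m. 0\<^sup>2)" unfolding a_def by (intro tendsto_intros v(3))
  then have a: "a \<longlonglongrightarrow> 0" by simp
  have "b \<longlonglongrightarrow> (\<Sum>j<m. 0\<^sup>2)" unfolding b_def by (intro tendsto_intros Qn) simp
  then have b: "b \<longlonglongrightarrow> 0" by simp
  have "d \<longlonglongrightarrow> (\<Sum>j<m. 0 * 0)" unfolding d_def by (intro tendsto_intros Qn v(3)) simp
  then have d: "d \<longlonglongrightarrow> 0" by simp
  have "q = (\<lambda>k. inner (v k) (A (v k)) - s + b k)"
    by (rule ext) (simp add: q_def Q_self v(2))
  then have "q \<longlonglongrightarrow> l - s + 0" by (simp only:) (intro tendsto_intros lim b)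
  then have q: "q \<longlonglongrightarrow> h" by (simp add: s_def)
  have "(\<lambda>k. (1 + d k)\<^sup>2 / q k - a k) \<longlonglongrightarrow> (1 + 0)\<^sup>2 / h - 0"
    using h by (intro tendsto_intros d q a) auto
  then have low: "(\<lambda>k. (1 + d k)\<^sup>2 / q k - a k) \<longlonglongrightarrow> 1 / h" by simp
  have "r \<longlonglongrightarrow> 1 / h"
  proof (rule tendsto_sandwich[OF _ _ low tendsto_const])
    have "eventually (\<lambda>k. q k > 0) sequentially" using order_tendstoD(1)[OF q h] .
    then show "\<forall>\<^sub>F k in sequentially. (1 + d k)\<^sup>2 / q k - a k \<le> r k"
    proof eventually_elim
      case (elim k)
      then show ?case using CS[of k] by (simp add: field_simps)
    qed
    show "\<forall>\<^sub>F k in sequentially. r k \<le> 1 / h"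
      using iso(1)[of "v _"] h v(2) by (simp add: r_def field_simps)
  qed
  then have "(\<lambda>k. C * ((norm (v k))\<^sup>2 - h * inner (R (v k)) (v k))) \<longlonglongrightarrow> C * (1 - h * (1 / h))"
    unfolding v(2) r_def[symmetric] by (intro tendsto_intros) simp_all
  then have "(\<lambda>k. C * ((norm (v k))\<^sup>2 - h * inner (R (v k)) (v k))) \<longlonglongrightarrow> 0" using h by simp
  then have ev1: "eventually (\<lambda>k. C * ((norm (v k))\<^sup>2 - h * inner (R (v k)) (v k)) < 3/4) sequentially"
    by (rule order_tendstoD) simp
  obtain F e where F: "finite F" "e > 0"
    "\<And>W u w. almost_orth F e W \<Longrightarrow> u \<in> span B \<Longrightarrow> w \<in> W \<Longrightarrow> \<bar>inner u w\<bar> \<le> 1/2 * norm u * norm w"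
    using almost_orth_imp_small_pairing[OF ker(1), of "\<lambda>x. x" "1/2"] by fastforce
  have "eventually (\<lambda>k. \<forall>f\<in>F. \<bar>inner f (v k)\<bar> < e) sequentially"
  proof (rule eventually_ball_finite[OF F(1)], rule ballI)
    fix f
    have "(\<lambda>k. \<bar>inner f (v k)\<bar>) \<longlonglongrightarrow> \<bar>0\<bar>" by (intro tendsto_intros v(3))
    then show "eventually (\<lambda>k. \<bar>inner f (v k)\<bar> < e) sequentially"
      using F(2) by (intro order_tendstoD(2)) auto
  qed
  with ev1 have "eventually (\<lambda>k. False) sequentially"
  proof eventually_elim
    case (elim k)
    then have "almost_orth F e {v k}" by (auto simp: almost_orth_def v(2) less_imp_le)
    obtain x where x: "x \<in> DA" "A x = l *\<^sub>R x"
      "(norm (v k - x))\<^sup>2 \<le> C * ((norm (v k))\<^sup>2 - h * inner (R (v k)) (v k))"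
      using C by blast
    then have "x \<in> span B" using ker(2) by blast
    then have "\<bar>inner x (v k)\<bar> \<le> 1/2 * norm x" using F(3)[OF \<open>almost_orth F e {v k}\<close>, of x "v k"] v(2) by simp
    moreover have "(norm (v k - x))\<^sup>2 = 1 - 2 * inner x (v k) + (norm x)\<^sup>2"
      using v(2)[of k] by (simp add: power2_norm_eq_inner inner_diff_left inner_diff_right inner_commute)
        (simp add: dot_square_norm)
    moreover have "0 \<le> (norm x - 1/2)\<^sup>2" by simp
    \<comment> \<open>At an angle with cosine at most 1/2, the squared distance is at least 1 - norm
      x + (norm x)^2, whose minimum is 3/4.\<close>
    ultimately have "3/4 \<le> (norm (v k - x))\<^sup>2" by (simp add: power2_eq_square algebra_simps)
    then show False using x elim by linarith
  qed
  then show False by simp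
qed

end


section \<open>Blocks\<close>

locale balanced_setup =
  fixes J :: "'a::{real_inner, complete_space} \<Rightarrow> 'a"
    and A :: "'a \<Rightarrow> 'a" and DA :: "'a set"
    and P :: "'a \<Rightarrow> 'a"
    and L :: "'a \<Rightarrow> 'a" and DL :: "'a set"
  assumes cs: "complex_structure J"
    and separable: "hilbert_separable TYPE('a)"
    and sa: "selfadjoint_in J UNIV A DA"
    and proj: "orth_projector J P"
    and L_lin: "clinear_on J DL L J"
    and DL_P: "DL \<subseteq> range P"
    and L_P: "\<forall>x\<in>DL. P (L x) = 0"
    and L_inj: "inj_on L DL"
    and core: "is_core A DA (dir_sum L DL)"
begin

sublocale symmetric_operator A DA
proof -
  have "clinear_on J DA A J" "\<forall>x\<in>DA. \<forall>y\<in>DA. inner (A x) y = inner x (A y)"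
    using sa unfolding selfadjoint_in_def by blast+
  then show "symmetric_operator A DA"
    by (simp add: symmetric_operator_def clinear_on_def csubspace_def)
qed

lemma J_linear: "linear J" and J_J: "J (J x) = - x" and J_inner: "inner (J x) (J y) = inner x y"
  using cs by (auto simp: complex_structure_def)

lemma J_skew: "inner (J x) y = - inner x (J y)"
  using J_inner[of x "J y"] J_J[of y] by simp

lemma J_orth: "inner x (J x) = 0"
  using J_skew[of x x] by (simp add: inner_commute)

lemma DL_subspace: "subspace DL" and DL_J: "x \<in> DL \<Longrightarrow> J x \<in> DL"
  and L_add: "x \<in> DL \<Longrightarrow> y \<in> DL \<Longrightarrow> L (x + y) = L x + L y"
  and L_scale: "x \<in> DL \<Longrightarrow> L (c *\<^sub>R x) = c *\<^sub>R L x"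
  and L_J: "x \<in> DL \<Longrightarrow> L (J x) = J (L x)"
  using L_lin by (auto simp: clinear_on_def csubspace_def)

lemma L_zero: "L 0 = 0"
  using L_scale[of 0 0] DL_subspace by (simp add: subspace_0)

lemma L_sum: "(\<And>i. i \<in> I \<Longrightarrow> x i \<in> DL) \<Longrightarrow> L (\<Sum>i\<in>I. c i *\<^sub>R x i) = (\<Sum>i\<in>I. c i *\<^sub>R L (x i))"
proof (induction I rule: infinite_finite_induct)
  case (insert i I)
  then have "(\<Sum>i\<in>I. c i *\<^sub>R x i) \<in> DL" "c i *\<^sub>R x i \<in> DL"
    using DL_subspace by (auto intro!: subspace_sum subspace_scale)
  then show ?case using insert by (simp add: L_add L_scale)
qed (simp_all add: L_zero)

lemma L_nonzero: "x \<in> DL \<Longrightarrow> x \<noteq> 0 \<Longrightarrow> L x \<noteq> 0"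
  using L_inj L_zero DL_subspace by (metis inj_onD subspace_0)

lemma DL_L_orth: "x \<in> DL \<Longrightarrow> y \<in> DL \<Longrightarrow> inner x (L y) = 0"
proof -
  assume x: "x \<in> DL" and y: "y \<in> DL"
  then have "P x = x" using DL_P proj by (auto simp: orth_projector_def)
  then have "inner x (L y) = inner x (P (L y))" using proj by (metis orth_projector_def)
  then show ?thesis using y L_P by simp
qed

lemma dir_sum_subset: "dir_sum L DL \<subseteq> DA"
  using core by (simp add: is_core_def)

text \<open>Adjoining the images under \<open>J\<close> makes real spans complex ones; on
  \<open>DL\<close> the maps \<open>L\<close> and \<open>J\<close> commute, so the order in which
  they are applied is immaterial.\<close>

definition block_gens :: "'a set \<Rightarrow> 'a set" where
  "block_gens S = (S \<union> J ` S) \<union> L ` (S \<union> J ` S)"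

definition block :: "'a set \<Rightarrow> 'a set" where
  "block S = span (block_gens S)"

lemma finite_block_gens: "finite S \<Longrightarrow> finite (block_gens S)"
  by (simp add: block_gens_def)

lemma block_Un: "block (S \<union> T) = {u + v | u v. u \<in> block S \<and> v \<in> block T}"
proof -
  have "block_gens (S \<union> T) = block_gens S \<union> block_gens T" by (auto simp: block_gens_def)
  then show ?thesis by (simp add: block_def span_Un)
qed

text \<open>\<open>L\<close> is linear on \<open>DL\<close> only, so both inclusions carry
  membership in \<open>DL\<close> along.\<close>

lemma span_L_image: "X \<subseteq> DL \<Longrightarrow> span (L ` X) = L ` span X"
proof
  assume X: "X \<subseteq> DL"
  then have sub: "span X \<subseteq> DL" using DL_subspace by (rule span_minimal)
  have "subspace (L ` span X)"
    unfolding subspace_def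
  proof (intro conjI ballI allI)
    show "0 \<in> L ` span X" using L_zero span_zero by (metis image_eqI)
    fix x y c assume "x \<in> L ` span X" "y \<in> L ` span X"
    then obtain a b where ab: "a \<in> span X" "b \<in> span X" "x = L a" "y = L b" by blast
    then have "x + y = L (a + b)" using sub L_add by (metis subsetD)
    then show "x + y \<in> L ` span X" using ab span_add by blast
  next
    fix x c assume "x \<in> L ` span X"
    then obtain a where ab: "a \<in> span X" "x = L a" by blast
    then have "c *\<^sub>R x = L (c *\<^sub>R a)" using sub L_scale by (metis subsetD)
    then show "c *\<^sub>R x \<in> L ` span X" using ab span_scale by blast
  qed
  then show "span (L ` X) \<subseteq> L ` span X" by (intro span_minimal) (auto intro: span_base)
  have "x \<in> DL \<and> L x \<in> span (L ` X)" if "x \<in> span X" for x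
    using that
  proof (induction rule: span_induct_alt)
    case (step c x y)
    then have "x \<in> DL" "y \<in> DL" using X by auto
    then have "L (c *\<^sub>R x + y) = c *\<^sub>R L x + L y" "c *\<^sub>R x + y \<in> DL"
      using DL_subspace by (simp_all add: L_add L_scale subspace_scale subspace_add)
    then show ?case using step by (simp add: span_add span_scale span_base)
  qed (use DL_subspace in \<open>simp add: L_zero span_zero subspace_0\<close>)
  then show "L ` span X \<subseteq> span (L ` X)" by blast
qed

lemma dir_sum_span: "S \<subseteq> DL \<Longrightarrow> dir_sum L (span (S \<union> J ` S)) = block S"
proof -
  assume "S \<subseteq> DL"
  then have "S \<union> J ` S \<subseteq> DL" using DL_J by blast
  then show ?thesis unfolding dir_sum_def block_def block_gens_def by (auto simp: span_Un[of "S \<union> J ` S"] span_L_image)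
qed

lemma block_subset: "S \<subseteq> DL \<Longrightarrow> block S \<subseteq> DA"
proof -
  assume "S \<subseteq> DL"
  then have "span (S \<union> J ` S) \<subseteq> DL" using DL_J DL_subspace by (intro span_minimal) auto
  then have "dir_sum L (span (S \<union> J ` S)) \<subseteq> dir_sum L DL" by (auto simp: dir_sum_def)
  then show ?thesis using dir_sum_span[OF \<open>S \<subseteq> DL\<close>] dir_sum_subset by blast
qed

lemma fin_csubspace_span: "finite S \<Longrightarrow> fin_csubspace J (span (S \<union> J ` S))"
proof -
  assume S: "finite S"
  have "J v \<in> span (S \<union> J ` S)" if "v \<in> span (S \<union> J ` S)" for v
  proof -
    have "J v \<in> span (J ` (S \<union> J ` S))"
      using that linear_span_image[OF J_linear] by blast
    moreover have "J ` (S \<union> J ` S) \<subseteq> span (S \<union> J ` S)"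
      by (auto simp: J_J intro!: span_neg intro: span_base)
    ultimately show ?thesis by (meson span_minimal subsetD subspace_span)
  qed
  then show ?thesis using S unfolding fin_csubspace_def csubspace_def
    by (auto intro!: exI[of _ "S \<union> J ` S"])
qed

text \<open>Coordinates on a block: two complex coefficients written as four real ones. Using the
  same coordinate space for all blocks allows forms on different blocks to be compared on one unit
  sphere.\<close>

definition pair_map :: "'a \<Rightarrow> real \<times> real \<times> real \<times> real \<Rightarrow> 'a" where
  "pair_map x = (\<lambda>(a, b, c, d). a *\<^sub>R x + b *\<^sub>R J x + c *\<^sub>R L x + d *\<^sub>R J (L x))"

lemma linear_pair_map: "linear (pair_map x)"
  by (rule linearI) (auto simp: pair_map_def algebra_simps)

lemma block_gens_singleton: "x \<in> DL \<Longrightarrow> block_gens {x} = {x, J x, L x, J (L x)}"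
  by (auto simp: block_gens_def L_J)

lemma pair_span_eq: "x \<in> DL \<Longrightarrow> pair_span J L x = block {x}"
  by (simp add: pair_span_def block_def block_gens_singleton)

lemma range_pair_map: "x \<in> DL \<Longrightarrow> range (pair_map x) = block {x}"
proof -
  assume x: "x \<in> DL"
  have "y \<in> block {x} \<longleftrightarrow> (\<exists>a b c d. y = pair_map x (a, b, c, d))" for y
  proof -
    have "y \<in> block {x} \<longleftrightarrow> (\<exists>a b c d. y - a *\<^sub>R x - b *\<^sub>R J x - c *\<^sub>R L x - d *\<^sub>R J (L x) = 0)"
      by (simp add: block_def block_gens_singleton[OF x] span_breakdown_eq)
    also have "\<dots> \<longleftrightarrow> (\<exists>a b c d. y = pair_map x (a, b, c, d))"
      by (simp add: pair_map_def algebra_simps)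
    finally show ?thesis .
  qed
  then show ?thesis by (auto simp: image_iff) blast
qed

lemma norm_pair_map:
  assumes "x \<in> DL"
  shows "(norm (pair_map x (a, b, c, d)))\<^sup>2 = (a\<^sup>2 + b\<^sup>2) * (norm x)\<^sup>2 + (c\<^sup>2 + d\<^sup>2) * (norm (L x))\<^sup>2"
proof -
  have o: "inner x (L x) = 0" "inner (J x) (L x) = 0" "inner x (J (L x)) = 0" "inner (J x) (J (L x)) = 0"
    "inner x (J x) = 0" "inner (L x) (J (L x)) = 0"
    using DL_L_orth[OF assms assms] DL_L_orth[OF DL_J[OF assms] assms] J_skew[of x "L x"] J_orth J_inner
    by auto
  show ?thesis
    unfolding power2_norm_eq_inner
    by (simp add: pair_map_def inner_add_left inner_add_right o o[THEN trans[OF inner_commute]] J_inner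
        power2_eq_square algebra_simps)
qed

lemma inj_pair_map: "x \<in> DL \<Longrightarrow> x \<noteq> 0 \<Longrightarrow> pair_map x c = 0 \<Longrightarrow> c = 0"
proof -
  assume x: "x \<in> DL" "x \<noteq> 0" "pair_map x c = 0"
  obtain p q r s where c: "c = (p, q, r, s)" by (metis prod.exhaust)
  have "(p\<^sup>2 + q\<^sup>2) * (norm x)\<^sup>2 + (r\<^sup>2 + s\<^sup>2) * (norm (L x))\<^sup>2 = 0"
    using norm_pair_map[OF x(1), of p q r s] x(3) c by simp
  then show ?thesis using x L_nonzero[of x] by (simp add: c zero_prod_def add_nonneg_eq_0_iff sum_power2_eq_zero_iff)
qed

lemma pair_map_combination: "x \<in> DL \<Longrightarrow> y \<in> DL \<Longrightarrow> pair_map (s *\<^sub>R x + t *\<^sub>R y) c = s *\<^sub>R pair_map x c + t *\<^sub>R pair_map y c"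
  using DL_subspace
  by (auto simp: pair_map_def L_add L_scale subspace_scale linear_add[OF J_linear] linear_scale[OF J_linear]
      algebra_simps split: prod.split)

lemma mu1_facts:
  assumes "x \<in> DL" "x \<noteq> 0"
  shows "\<exists>v\<in>block {x}. norm v = 1 \<and> (\<forall>w\<in>block {x}. inner w (A v) = mu1 J A L x * inner w v)"
    and "w \<in> block {x} \<Longrightarrow> mu1 J A L x * (norm w)\<^sup>2 \<le> inner w (A w)"
    and "mu1 J A L x \<in> comp_spec A (block {x})"
proof -
  have "finite (block_gens {x})" "span (block_gens {x}) \<subseteq> DA" "x \<in> span (block_gens {x})"
    using block_subset[of "{x}"] assms by (auto simp: block_def finite_block_gens block_gens_def intro: span_base)
  note * = Min_comp_spec[OF this assms(2)]
  show "\<exists>v\<in>block {x}. norm v = 1 \<and> (\<forall>w\<in>block {x}. inner w (A v) = mu1 J A L x * inner w v)"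
    using *(1) by (simp add: mu1_def pair_span_eq[OF assms(1)] block_def)
  show "w \<in> block {x} \<Longrightarrow> mu1 J A L x * (norm w)\<^sup>2 \<le> inner w (A w)"
    using *(2) by (simp add: mu1_def pair_span_eq[OF assms(1)] block_def)
  show "mu1 J A L x \<in> comp_spec A (block {x})"
    using *(3) by (simp add: mu1_def pair_span_eq[OF assms(1)] block_def)
qed

text \<open>The normalised generators and their images under \<open>J\<close> form an orthonormal
  basis of the block, so weak convergence of the generators alone is uniform on it.\<close>

lemma adm_seq_almost_orth:
  assumes "adm_seq L DL xs" "finite F" "e > 0"
  shows "eventually (\<lambda>n. almost_orth F e (block {xs n})) sequentially"
proof -
  have xs: "xs n \<in> DL" "xs n \<noteq> 0" for n using assms(1) unfolding adm_seq_def by blast+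
  define u where "u n = xs n /\<^sub>R norm (xs n)" for n
  define w where "w n = L (xs n) /\<^sub>R norm (L (xs n))" for n
  have weak: "weak_to_zero u" "weak_to_zero w"
    using assms(1) by (simp_all add: adm_seq_def u_def[abs_def] w_def[abs_def])
  have lim: "(\<lambda>n. inner f (u n)) \<longlonglongrightarrow> 0" "(\<lambda>n. inner f (w n)) \<longlonglongrightarrow> 0" for f
    using weak by (simp_all add: weak_to_zero_def)
  have "eventually (\<lambda>n. \<forall>f\<in>F. \<bar>inner f (u n)\<bar> + \<bar>inner (J f) (u n)\<bar> + \<bar>inner f (w n)\<bar> + \<bar>inner (J f) (w n)\<bar> < e)
      sequentially"
  proof (rule eventually_ball_finite[OF assms(2)], rule ballI)
    fix f
    have "(\<lambda>n. \<bar>inner f (u n)\<bar> + \<bar>inner (J f) (u n)\<bar> + \<bar>inner f (w n)\<bar> + \<bar>inner (J f) (w n)\<bar>)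
        \<longlonglongrightarrow> \<bar>0\<bar> + \<bar>0\<bar> + \<bar>0\<bar> + \<bar>0\<bar>" by (intro tendsto_intros lim)
    then show "eventually (\<lambda>n. \<bar>inner f (u n)\<bar> + \<bar>inner (J f) (u n)\<bar> + \<bar>inner f (w n)\<bar> + \<bar>inner (J f) (w n)\<bar> < e)
        sequentially"
      using assms(3) by (intro order_tendstoD(2)) auto
  qed
  then show ?thesis
  proof eventually_elim
    case (elim n)
    show ?case
      unfolding almost_orth_def
    proof (intro ballI)
      fix f y assume f: "f \<in> F" and "y \<in> block {xs n}"
      then obtain a b c d where y: "y = pair_map (xs n) (a, b, c, d)"
        using range_pair_map[OF xs(1)] by (metis (no_types, lifting) imageE prod.exhaust)
      define p where "p = norm (xs n)"
      define q where "q = norm (L (xs n))"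
      have pq: "p > 0" "q > 0" using xs L_nonzero by (auto simp: p_def q_def)
      have ny: "(norm y)\<^sup>2 = (a * p)\<^sup>2 + (b * p)\<^sup>2 + (c * q)\<^sup>2 + (d * q)\<^sup>2"
        unfolding y norm_pair_map[OF xs(1)] by (simp add: p_def q_def power_mult_distrib algebra_simps)
      have le: "\<bar>t\<bar> \<le> norm y" if "t\<^sup>2 \<le> (norm y)\<^sup>2" for t
        using that by (simp add: abs_le_square_iff[symmetric])
      have co: "\<bar>a * p\<bar> \<le> norm y" "\<bar>b * p\<bar> \<le> norm y" "\<bar>c * q\<bar> \<le> norm y" "\<bar>d * q\<bar> \<le> norm y"
        by (intro le; simp add: ny)+
      have y_eq: "y = (a * p) *\<^sub>R u n + (b * p) *\<^sub>R J (u n) + (c * q) *\<^sub>R w n + (d * q) *\<^sub>R J (w n)"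
      proof -
        have "p * inverse p = 1" "q * inverse q = 1" using pq by simp_all
        then show ?thesis
          by (simp add: y mult.assoc pair_map_def u_def w_def linear_scale[OF J_linear] flip: p_def q_def)
      qed
      \<comment> \<open>\<open>J\<close> is moved onto the test vector, so the images under
        \<open>J\<close> need no separate weak limit.\<close>
      have J': "inner f (J z) = - inner (J f) z" for z using J_skew[of f z] by simp
      have "\<bar>inner f y\<bar> \<le> \<bar>a * p\<bar> * \<bar>inner f (u n)\<bar> + \<bar>b * p\<bar> * \<bar>inner (J f) (u n)\<bar>
          + \<bar>c * q\<bar> * \<bar>inner f (w n)\<bar> + \<bar>d * q\<bar> * \<bar>inner (J f) (w n)\<bar>"
        unfolding y_eq inner_add_right inner_scaleR_right J' abs_mult[symmetric] by linarith
      also have "\<dots> \<le> norm y * \<bar>inner f (u n)\<bar> + norm y * \<bar>inner (J f) (u n)\<bar>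
          + norm y * \<bar>inner f (w n)\<bar> + norm y * \<bar>inner (J f) (w n)\<bar>"
        by (intro add_mono mult_right_mono co) auto
      also have "\<dots> = norm y * (\<bar>inner f (u n)\<bar> + \<bar>inner (J f) (u n)\<bar> + \<bar>inner f (w n)\<bar> + \<bar>inner (J f) (w n)\<bar>)"
        by (simp add: algebra_simps)
      also have "\<dots> \<le> norm y * e" using elim f by (intro mult_left_mono) (auto intro: less_imp_le)
      finally show "\<bar>inner f y\<bar> \<le> e * norm y" by (simp add: mult.commute)
    qed
  qed
qed

end

context symmetric_operator
begin

lemma Q_sum:
  assumes "\<And>i. i \<in> I \<Longrightarrow> w i \<in> DA"
  shows "Q s (\<Sum>i\<in>I. c i *\<^sub>R w i) (\<Sum>i\<in>I. c i *\<^sub>R w i) = (\<Sum>i\<in>I. \<Sum>j\<in>I. c i * c j * Q s (w i) (w j))"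
proof -
  have mem: "(\<Sum>j\<in>I'. c j *\<^sub>R w j) \<in> DA" if "I' \<subseteq> I" for I'
    using assms that dom by (intro subspace_sum subspace_scale) auto
  have left: "Q s (\<Sum>i\<in>I'. c i *\<^sub>R w i) x = (\<Sum>i\<in>I'. c i * Q s (w i) x)" for I' x
    by (simp add: Q_def inner_sum_left sum_subtractf sum_distrib_left algebra_simps)
  have "Q s (w i) (\<Sum>j\<in>I. c j *\<^sub>R w j) = (\<Sum>j\<in>I. c j * Q s (w i) (w j))" if i: "i \<in> I" for i
  proof -
    have "Q s (w i) (\<Sum>j\<in>I. c j *\<^sub>R w j) = (\<Sum>j\<in>I. c j * Q s (w j) (w i))"
      using Q_sym[OF assms[OF i] mem[of I]] by (simp add: left)
    also have "\<dots> = (\<Sum>j\<in>I. c j * Q s (w i) (w j))"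
    proof (rule sum.cong[OF refl])
      fix j assume "j \<in> I"
      then show "c j * Q s (w j) (w i) = c j * Q s (w i) (w j)"
        using Q_sym[OF assms assms[OF i]] by metis
    qed
    finally show ?thesis .
  qed
  then show ?thesis unfolding left by (simp add: sum_distrib_left mult.assoc)
qed

end

section \<open>Spurious points from remote blocks\<close>

context balanced_setup
begin

text \<open>An eigenvector \<open>u\<close> of a block \<open>S\<close> remote from
  \<open>T0\<close> has a small residual on the joint block: its pairing with
  \<open>block T0\<close> through \<open>A - l\<close> is small by the choice of \<open>F2\<close>,
  and on \<open>block S\<close> the residual is \<open>m - l\<close>. Then
  \<open>comp_spec_near\<close> supplies an eigenvalue.\<close>

lemma spu_step:
  assumes T0: "finite T0" "T0 \<subseteq> DL" and eta: "eta > 0"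
    and blocks: "\<And>F e. finite F \<Longrightarrow> e > 0 \<Longrightarrow>
      \<exists>S. finite S \<and> S \<subseteq> DL \<and> almost_orth F e (block S) \<and> (\<exists>m\<in>comp_spec A (block S). \<bar>l - m\<bar> < e)"
  shows "\<exists>T. finite T \<and> T \<subseteq> DL \<and> T0 \<subseteq> T \<and> (\<exists>m\<in>comp_spec A (block T). \<bar>l - m\<bar> < eta)"
proof -
  have DT0: "block T0 \<subseteq> DA" by (rule block_subset[OF T0(2)])
  obtain F1 e1 where F1: "finite F1" "e1 > 0"
    "\<And>W u w. almost_orth F1 e1 W \<Longrightarrow> u \<in> block T0 \<Longrightarrow> w \<in> W \<Longrightarrow> \<bar>inner u w\<bar> \<le> 1/2 * norm u * norm w"
    using almost_orth_imp_small_pairing[OF finite_block_gens[OF T0(1)], of "\<lambda>x. x" "1/2"] unfolding block_def by auto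
  have "\<exists>F e. finite F \<and> e > 0 \<and> (\<forall>W. almost_orth F e W \<longrightarrow>
      (\<forall>u\<in>span (block_gens T0). \<forall>w\<in>W. \<bar>inner (A u - l *\<^sub>R u) w\<bar> \<le> eta / 8 * norm u * norm w))"
    using DT0 eta unfolding block_def
    by (intro almost_orth_imp_small_pairing[OF finite_block_gens[OF T0(1)]])
      (auto simp: subset_iff A_add A_scale algebra_simps)
  then obtain F2 e2 where F2: "finite F2" "e2 > 0"
    "\<And>W u w. almost_orth F2 e2 W \<Longrightarrow> u \<in> block T0 \<Longrightarrow> w \<in> W \<Longrightarrow>
      \<bar>inner (A u - l *\<^sub>R u) w\<bar> \<le> eta / 8 * norm u * norm w"
    unfolding block_def by auto
  \<comment> \<open>Each of the two parts contributes eta/8 times its norm. The angle condition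
    bounds the sum of the norms by twice the norm of the sum, giving eta/4 in total.\<close>
  define e where "e = min e1 (min e2 (eta / 8))"
  have "e > 0" using F1 F2 eta by (simp add: e_def)
  then obtain S m where S: "finite S" "S \<subseteq> DL" "almost_orth (F1 \<union> F2) e (block S)"
    and m: "m \<in> comp_spec A (block S)" "\<bar>l - m\<bar> < e"
    using blocks[of "F1 \<union> F2" e] F1(1) F2(1) by auto
  have dec1: "almost_orth F1 e1 (block S)" and dec2: "almost_orth F2 e2 (block S)"
    by (rule almost_orth_mono[OF S(3)]; simp add: e_def)+
  have DS: "block S \<subseteq> DA" by (rule block_subset[OF S(2)])
  obtain v where v: "v \<in> block S" "v \<noteq> 0" "\<And>w. w \<in> block S \<Longrightarrow> inner w (A v) = m * inner w v"
    using m(1) unfolding comp_spec_def by blast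
  define u where "u = v /\<^sub>R norm v"
  have u: "u \<in> block S" "norm u = 1" using v by (auto simp: u_def block_def span_scale)
  have uA: "inner w (A u) = m * inner w u" if "w \<in> block S" for w
    using v DS that unfolding u_def by (subst A_scale) auto
  have uDA: "u \<in> DA" using u DS by blast
  have TS: "block (T0 \<union> S) \<subseteq> DA" "finite (block_gens (T0 \<union> S))" "block (T0 \<union> S) = span (block_gens (T0 \<union> S))"
    using T0 S block_subset[of "T0 \<union> S"] by (simp_all add: finite_block_gens block_def)
  have small: "\<bar>Q l w u\<bar> \<le> eta / 4 * norm w" if "w \<in> block (T0 \<union> S)" for w
  proof -
    obtain x y where xy: "x \<in> block T0" "y \<in> block S" "w = x + y" using \<open>w \<in> block (T0 \<union> S)\<close> unfolding block_Un by blast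
    have "Q l x u = inner (A x - l *\<^sub>R x) u"
      using xy DT0 uDA A_sym[of x u] by (auto simp: Q_def inner_diff_left)
    then have x: "\<bar>Q l x u\<bar> \<le> eta / 8 * norm x" using F2(3)[OF dec2 xy(1) u(1)] u(2) by simp
    have "\<bar>Q l y u\<bar> = \<bar>l - m\<bar> * \<bar>inner y u\<bar>"
      unfolding Q_def uA[OF xy(2)] abs_mult[symmetric] by (simp add: algebra_simps abs_minus_commute)
    also have "\<dots> \<le> eta / 8 * norm y"
      using Cauchy_Schwarz_ineq2[of y u] u(2) m(2) eta by (intro mult_mono) (auto simp: e_def)
    finally have "\<bar>Q l w u\<bar> \<le> eta / 8 * (norm x + norm y)"
      using x abs_triangle_ineq[of "Q l x u" "Q l y u"] unfolding xy(3) Q_add_left distrib_left by linarith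
    also have "\<dots> \<le> eta / 8 * (2 * norm w)"
      unfolding xy(3) using F1(3)[OF dec1 xy(1,2)] eta by (intro mult_left_mono norm_add_ge_half) auto
    finally show ?thesis by simp
  qed
  have "u \<in> block (T0 \<union> S)" unfolding block_Un using u by (auto simp: block_def span_zero intro: exI[of _ 0])
  then have "\<exists>m\<in>comp_spec A (span (block_gens (T0 \<union> S))). \<bar>l - m\<bar> \<le> eta / 4"
    using TS small u(2) by (intro comp_spec_near[of _ u]) auto
  then have "\<exists>m\<in>comp_spec A (block (T0 \<union> S)). \<bar>l - m\<bar> < eta" using eta unfolding TS(3) by force
  then show ?thesis using T0 S by (intro exI[of _ "T0 \<union> S"]) auto
qed

text \<open>Two demands are met at every stage: the next pair of a sequence dense in the graph over
  the core is adjoined, which yields density in graph norm, and a remote block is adjoined, which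
  restores an eigenvalue close to \<open>l\<close>.\<close>

lemma spu_intro:
  assumes "l \<notin> spec A DA"
    and blocks: "\<And>F e. finite F \<Longrightarrow> e > 0 \<Longrightarrow>
      \<exists>S. finite S \<and> S \<subseteq> DL \<and> almost_orth F e (block S) \<and> (\<exists>m\<in>comp_spec A (block S). \<bar>l - m\<bar> < e)"
  shows "l \<in> spu J A DA L DL"
proof -
  have "0 + L 0 \<in> dir_sum L DL" using DL_subspace subspace_0 unfolding dir_sum_def by blast
  then have "graph_of A (dir_sum L DL) \<noteq> {}" by (auto simp: graph_of_def)
  then obtain g :: "nat \<Rightarrow> 'a \<times> 'a" where g: "range g \<subseteq> graph_of A (dir_sum L DL)"
    "graph_of A (dir_sum L DL) \<subseteq> closure (range g)"
    using dense_sequence_in_product_subset[OF separable] by meson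
  have "\<exists>z z'. z \<in> DL \<and> z' \<in> DL \<and> g n = (z + L z', A (z + L z'))" for n
  proof -
    have "g n \<in> graph_of A (dir_sum L DL)" using g(1) by blast
    then show ?thesis unfolding graph_of_def dir_sum_def by blast
  qed
  then obtain z z' where z: "\<And>n. z n \<in> DL" "\<And>n. z' n \<in> DL"
    "\<And>n. g n = (z n + L (z' n), A (z n + L (z' n)))" by metis
  have "\<exists>T. \<forall>n. (finite (T n) \<and> T n \<subseteq> DL) \<and>
      (T n \<union> {z n, z' n} \<subseteq> T (Suc n) \<and> (\<exists>m\<in>comp_spec A (block (T (Suc n))). \<bar>l - m\<bar> < 1 / real (Suc n)))"
  proof (rule dependent_nat_choice)
    show "\<exists>T. finite T \<and> T \<subseteq> DL" by blast
    fix T :: "'a set" and n assume T: "finite T \<and> T \<subseteq> DL"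
    have "\<exists>T'. finite T' \<and> T' \<subseteq> DL \<and> T \<union> {z n, z' n} \<subseteq> T' \<and>
        (\<exists>m\<in>comp_spec A (block T'). \<bar>l - m\<bar> < 1 / real (Suc n))"
      by (rule spu_step) (use T z blocks in auto)
    then show "\<exists>T'. (finite T' \<and> T' \<subseteq> DL) \<and> T \<union> {z n, z' n} \<subseteq> T' \<and>
        (\<exists>m\<in>comp_spec A (block T'). \<bar>l - m\<bar> < 1 / real (Suc n))" by blast
  qed
  then obtain T where T: "\<And>n. finite (T n)" "\<And>n. T n \<subseteq> DL" "\<And>n. T n \<union> {z n, z' n} \<subseteq> T (Suc n)"
    "\<And>n. \<exists>m\<in>comp_spec A (block (T (Suc n))). \<bar>l - m\<bar> < 1 / real (Suc n)" by blast
  define V where "V n = span (T n \<union> J ` T n)" for n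
  have V: "dir_sum L (V n) = block (T n)" for n unfolding V_def by (rule dir_sum_span[OF T(2)])
  have "fin_csubspace J (V n)" for n unfolding V_def by (rule fin_csubspace_span[OF T(1)])
  moreover have "V n \<subseteq> DL" for n
    unfolding V_def using T(2)[of n] DL_J DL_subspace by (intro span_minimal) auto
  moreover have "V n \<subseteq> V (Suc n)" for n
    unfolding V_def using T(3)[of n] by (intro span_mono) auto
  moreover have "graph_of A DA \<subseteq> closure (graph_of A (\<Union>n. dir_sum L (V n)))"
  proof -
    have "z n + L (z' n) \<in> dir_sum L (V (Suc n))" for n
      unfolding dir_sum_def V_def using T(3)[of n] by (auto intro!: span_base)
    then have "range g \<subseteq> graph_of A (\<Union>n. dir_sum L (V n))"
      using z(3) by (auto simp: graph_of_def)
    then have "closure (range g) \<subseteq> closure (graph_of A (\<Union>n. dir_sum L (V n)))" by (rule closure_mono)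
    moreover have "closure (graph_of A (dir_sum L DL)) \<subseteq> closure (range g)"
      using closure_minimal[OF g(2)] by simp
    ultimately show ?thesis using core by (simp add: is_core_def)
  qed
  moreover have "eventually (\<lambda>n. \<exists>m\<in>comp_spec A (dir_sum L (V n)). \<bar>l - m\<bar> < e) sequentially"
    if "e > 0" for e :: real
  proof -
    obtain N where N: "1 / real (Suc N) < e"
      using reals_Archimedean[OF \<open>e > 0\<close>] by (auto simp: inverse_eq_divide)
    show ?thesis
      unfolding eventually_sequentially
    \<comment> \<open>The eigenvalue with error 1/(k+1) belongs to stage \<open>Suc k\<close>;
      nothing is known at stage 0.\<close>
    proof (intro exI[of _ "Suc N"] allI impI)
      fix n assume "Suc N \<le> n"
      then obtain k where k: "n = Suc k" "N \<le> k" by (cases n) auto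
      then have "1 / real (Suc k) \<le> 1 / real (Suc N)" by (intro divide_left_mono) auto
      then show "\<exists>m\<in>comp_spec A (dir_sum L (V n)). \<bar>l - m\<bar> < e"
        using T(4)[of k] N k(1) unfolding V by force
    qed
  qed
  ultimately show ?thesis using assms(1) unfolding spu_def by blast
qed

section \<open>Blocks with two generators and the segment argument\<close>

definition pair_map2 where
  "pair_map2 p q c = pair_map p (fst c) + pair_map q (snd c)"

lemma linear_pair_map2: "linear (pair_map2 p q)"
  by (rule linearI)
    (simp_all add: pair_map2_def linear_add[OF linear_pair_map] linear_scale[OF linear_pair_map] scaleR_add_right)

lemma range_pair_map2: "p \<in> DL \<Longrightarrow> q \<in> DL \<Longrightarrow> range (pair_map2 p q) = block {p, q}"
proof -
  assume pq: "p \<in> DL" "q \<in> DL"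
  have "block {p, q} = {u + v | u v. u \<in> block {p} \<and> v \<in> block {q}}" using block_Un[of "{p}" "{q}"] by (simp add: insert_commute)
  also have "\<dots> = range (pair_map2 p q)"
    unfolding range_pair_map[OF pq(1), symmetric] range_pair_map[OF pq(2), symmetric]
  proof (intro equalityI subsetI)
    fix x assume "x \<in> {u + v | u v. u \<in> range (pair_map p) \<and> v \<in> range (pair_map q)}"
    then obtain c c' where "x = pair_map p c + pair_map q c'" by blast
    then have "x = pair_map2 p q (c, c')" by (simp add: pair_map2_def)
    then show "x \<in> range (pair_map2 p q)" by blast
  next
    fix x assume "x \<in> range (pair_map2 p q)"
    then show "x \<in> {u + v | u v. u \<in> range (pair_map p) \<and> v \<in> range (pair_map q)}"
      unfolding pair_map2_def by blast
  qed
  finally show ?thesis by simp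
qed

lemma pair_map2_combination:
  assumes "p \<in> DL" "q \<in> DL" "p' \<in> DL" "q' \<in> DL"
  shows "pair_map2 (s *\<^sub>R p + t *\<^sub>R p') (s *\<^sub>R q + t *\<^sub>R q') c = s *\<^sub>R pair_map2 p q c + t *\<^sub>R pair_map2 p' q' c"
  using assms by (simp add: pair_map2_def pair_map_combination algebra_simps)

lemma continuous_pair_map2: "continuous_on S (pair_map2 p q)"
  by (intro linear_continuous_on linear_conv_bounded_linear[THEN iffD1] linear_pair_map2)

lemma continuous_A_pair_map2: "p \<in> DL \<Longrightarrow> q \<in> DL \<Longrightarrow> continuous_on S (\<lambda>c. A (pair_map2 p q c))"
proof -
  assume pq: "p \<in> DL" "q \<in> DL"
  then have mem: "pair_map2 p q c \<in> DA" for c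
    using range_pair_map2[OF pq] block_subset[of "{p, q}"] by blast
  have "linear (\<lambda>c. A (pair_map2 p q c))"
    by (rule linearI) (simp_all add: linear_add[OF linear_pair_map2] linear_scale[OF linear_pair_map2] A_add A_scale mem)
  then show ?thesis by (intro linear_continuous_on linear_conv_bounded_linear[THEN iffD1])
qed

text \<open>\<open>y'\<close> is chosen so remote from \<open>y\<close> that the cross term of the
  form is at most half of the margin \<open>c\<close>. Positivity is stated in coordinates and not
  for vectors, so it includes injectivity of the parametrisation.\<close>

lemma positive_pair_block:
  assumes c: "c > 0"
    and pos: "\<And>F e. finite F \<Longrightarrow> e > 0 \<Longrightarrow> \<exists>y\<in>DL. y \<noteq> 0 \<and> almost_orth F e (block {y}) \<and> l + c \<le> mu1 J A L y"
    and F: "finite F" "e > 0"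
  shows "\<exists>y\<in>DL. \<exists>y'\<in>DL. almost_orth F e (block {y, y'}) \<and> (\<forall>k. k \<noteq> 0 \<longrightarrow> Q l (pair_map2 y y' k) (pair_map2 y y' k) > 0)"
proof -
  obtain y where y: "y \<in> DL" "y \<noteq> 0" "almost_orth F (e/2) (block {y})" "l + c \<le> mu1 J A L y"
    using pos[of F "e/2"] F by auto
  have Dy: "block {y} \<subseteq> DA" using y by (intro block_subset) auto
  obtain F1 e1 where F1: "finite F1" "e1 > 0"
    "\<And>W u w. almost_orth F1 e1 W \<Longrightarrow> u \<in> block {y} \<Longrightarrow> w \<in> W \<Longrightarrow> \<bar>inner u w\<bar> \<le> 1/2 * norm u * norm w"
    using almost_orth_imp_small_pairing[OF finite_block_gens[of "{y}"], of "\<lambda>x. x" "1/2"] unfolding block_def by auto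
  have "\<exists>F e. finite F \<and> e > 0 \<and> (\<forall>W. almost_orth F e W \<longrightarrow>
      (\<forall>u\<in>span (block_gens {y}). \<forall>w\<in>W. \<bar>inner (A u - l *\<^sub>R u) w\<bar> \<le> c / 2 * norm u * norm w))"
    using Dy c unfolding block_def
    by (intro almost_orth_imp_small_pairing[OF finite_block_gens])
      (auto simp: subset_iff A_add A_scale algebra_simps)
  then obtain F2 e2 where F2: "finite F2" "e2 > 0"
    "\<And>W u w. almost_orth F2 e2 W \<Longrightarrow> u \<in> block {y} \<Longrightarrow> w \<in> W \<Longrightarrow>
      \<bar>inner (A u - l *\<^sub>R u) w\<bar> \<le> c / 2 * norm u * norm w"
    unfolding block_def by auto
  define d where "d = min (e/2) (min e1 e2)"
  have "d > 0" using F F1 F2 by (simp add: d_def)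
  then obtain y' where y': "y' \<in> DL" "y' \<noteq> 0" "almost_orth (F \<union> F1 \<union> F2) d (block {y'})" "l + c \<le> mu1 J A L y'"
    using pos[of "F \<union> F1 \<union> F2" d] F F1 F2 by auto
  have Dy': "block {y'} \<subseteq> DA" using y' by (intro block_subset) auto
  have almost_orth: "almost_orth F (e/2) (block {y'})" "almost_orth F1 e1 (block {y'})" "almost_orth F2 e2 (block {y'})"
    by (rule almost_orth_mono[OF y'(3)]; auto simp: d_def)+
  have sum: "block {y, y'} = {u + v | u v. u \<in> block {y} \<and> v \<in> block {y'}}" using block_Un[of "{y}" "{y'}"] by (simp add: insert_commute)
  have "almost_orth F (2 * (e/2)) (block {y, y'})"
    using F F1(3)[OF almost_orth(2)] by (intro almost_orth_sum[OF y(3) almost_orth(1)]) (auto simp: sum)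
  then have "almost_orth F e (block {y, y'})" by simp
  moreover have "Q l (pair_map2 y y' k) (pair_map2 y y' k) > 0" if "k \<noteq> 0" for k
  proof -
    obtain a b where k: "k = (a, b)" by (cases k)
    define u where "u = pair_map y a"
    define v where "v = pair_map y' b"
    have uv: "u \<in> block {y}" "v \<in> block {y'}" "pair_map2 y y' k = u + v"
      using range_pair_map[OF y(1)] range_pair_map[OF y'(1)] by (auto simp: u_def v_def pair_map2_def k)
    have uvA: "u \<in> DA" "v \<in> DA" using uv Dy Dy' by auto
    have "u \<noteq> 0 \<or> v \<noteq> 0"
      using that inj_pair_map[OF y(1,2), of a] inj_pair_map[OF y'(1,2), of b] by (auto simp: u_def v_def k zero_prod_def)
    then have "norm u > 0 \<or> norm v > 0" by simp
    have low: "c * (norm u)\<^sup>2 \<le> Q l u u" "c * (norm v)\<^sup>2 \<le> Q l v v"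
    proof -
      have "(l + c) * (norm u)\<^sup>2 \<le> mu1 J A L y * (norm u)\<^sup>2" using y(4) by (intro mult_right_mono) auto
      then show "c * (norm u)\<^sup>2 \<le> Q l u u"
        using mu1_facts(2)[OF y(1,2) uv(1)] by (simp add: Q_self algebra_simps)
      have "(l + c) * (norm v)\<^sup>2 \<le> mu1 J A L y' * (norm v)\<^sup>2" using y'(4) by (intro mult_right_mono) auto
      then show "c * (norm v)\<^sup>2 \<le> Q l v v"
        using mu1_facts(2)[OF y'(1,2) uv(2)] by (simp add: Q_self algebra_simps)
    qed
    have "Q l u v = inner (A u - l *\<^sub>R u) v" using A_sym[OF uvA] by (simp add: Q_def inner_diff_left)
    then have cross: "\<bar>Q l u v\<bar> \<le> c / 2 * norm u * norm v" using F2(3)[OF almost_orth(3) uv(1,2)] by simp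
    have "Q l (u + v) (u + v) = Q l u u + 2 * Q l u v + Q l v v"
      using Q_sym[OF uvA, of l] uvA by (simp add: Q_add_left Q_add_right)
    also have "\<dots> \<ge> c * (norm u)\<^sup>2 + c * (norm v)\<^sup>2 - c * norm u * norm v" using low cross by linarith
    also have "c * (norm u)\<^sup>2 + c * (norm v)\<^sup>2 - c * norm u * norm v
        = c / 2 * ((norm u - norm v)\<^sup>2 + (norm u)\<^sup>2 + (norm v)\<^sup>2)"
      by (simp add: power2_eq_square algebra_simps)
    finally have "c / 2 * ((norm u - norm v)\<^sup>2 + (norm u)\<^sup>2 + (norm v)\<^sup>2) \<le> Q l (u + v) (u + v)" .
    moreover have "(norm u - norm v)\<^sup>2 + (norm u)\<^sup>2 + (norm v)\<^sup>2 > 0"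
      using \<open>norm u > 0 \<or> norm v > 0\<close>
      by (metis add_nonneg_pos add_pos_nonneg zero_le_power2 zero_less_power add_nonneg_nonneg)
    ultimately show ?thesis using c uv(3) by (smt (verit) mult_pos_pos half_gt_zero)
  qed
  ultimately show ?thesis using y y' by blast
qed

text \<open>The negative block is fixed before the positive one, which is then made remote from it.
  The remoteness is used twice: it keeps all blocks on the segment almost orthogonal to
  \<open>F\<close>, and it prevents the null vector found at the crossing from being zero.\<close>

lemma block_interpolation:
  assumes c: "c > 0"
    and pos: "\<And>F e. finite F \<Longrightarrow> e > 0 \<Longrightarrow> \<exists>y\<in>DL. y \<noteq> 0 \<and> almost_orth F e (block {y}) \<and> l + c \<le> mu1 J A L y"
    and neg: "\<And>F e. finite F \<Longrightarrow> e > 0 \<Longrightarrow> \<exists>z\<in>DL. \<exists>z'\<in>DL. almost_orth F e (block {z, z'}) \<and> (\<exists>w\<in>block {z, z'}. Q l w w < 0)"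
    and F: "finite F" "e > 0"
  shows "\<exists>p\<in>DL. \<exists>q\<in>DL. almost_orth F e (block {p, q}) \<and> l \<in> comp_spec A (block {p, q})"
proof -
  obtain z z' w where z: "z \<in> DL" "z' \<in> DL" "almost_orth F (e/2) (block {z, z'})" and w: "w \<in> block {z, z'}" "Q l w w < 0"
    using neg[of F "e/2"] F by auto
  obtain F1 e1 where F1: "finite F1" "e1 > 0"
    "\<And>W u w. almost_orth F1 e1 W \<Longrightarrow> u \<in> block {z, z'} \<Longrightarrow> w \<in> W \<Longrightarrow> \<bar>inner u w\<bar> \<le> 1/2 * norm u * norm w"
    using almost_orth_imp_small_pairing[OF finite_block_gens[of "{z, z'}"], of "\<lambda>x. x" "1/2"] unfolding block_def by auto
  obtain y y' where y: "y \<in> DL" "y' \<in> DL" "almost_orth (F \<union> F1) (min (e/2) e1) (block {y, y'})"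
    and ypos: "\<And>k. k \<noteq> 0 \<Longrightarrow> Q l (pair_map2 y y' k) (pair_map2 y y' k) > 0"
    using positive_pair_block[OF c pos, of "F \<union> F1" "min (e/2) e1"] F F1 by auto
  have almost_orth: "almost_orth F (e/2) (block {y, y'})" "almost_orth F1 e1 (block {y, y'})" by (rule almost_orth_mono[OF y(3)]; auto)+
  have cross: "\<bar>inner u v\<bar> \<le> 1/2 * norm u * norm v" if "u \<in> block {z, z'}" "v \<in> block {y, y'}" for u v
    using F1(3)[OF almost_orth(2) that] .
  define p where "p t = (1 - t) *\<^sub>R z + t *\<^sub>R y" for t :: real
  define q where "q t = (1 - t) *\<^sub>R z' + t *\<^sub>R y'" for t :: real
  have pq: "p t \<in> DL" "q t \<in> DL" for t
    using z y DL_subspace by (auto simp: p_def q_def intro!: subspace_add subspace_scale)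
  define Phi where "Phi t = pair_map2 (p t) (q t)" for t
  have Phi: "Phi t k = (1 - t) *\<^sub>R pair_map2 z z' k + t *\<^sub>R pair_map2 y y' k" for t k
    unfolding Phi_def p_def q_def by (rule pair_map2_combination[OF z(1,2) y(1,2)])
  have mem: "pair_map2 z z' k \<in> block {z, z'}" "pair_map2 y y' k \<in> block {y, y'}" for k
    using range_pair_map2[OF z(1,2)] range_pair_map2[OF y(1,2)] by auto
  have sub: "block {z, z'} \<subseteq> DA" "block {y, y'} \<subseteq> DA" "block {p t, q t} \<subseteq> DA" for t
    using z y pq by (simp_all add: block_subset)
  have A_Phi: "A (Phi t k) = (1 - t) *\<^sub>R A (pair_map2 z z' k) + t *\<^sub>R A (pair_map2 y y' k)" for t k
  proof -
    have "pair_map2 z z' k \<in> DA" "pair_map2 y y' k \<in> DA" using mem sub by blast+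
    then show ?thesis unfolding Phi using dom by (simp add: A_add A_scale subspace_scale)
  qed
  have range_Phi: "range (Phi t) = block {p t, q t}" for t unfolding Phi_def by (rule range_pair_map2[OF pq])
  define g where "g t k = Q l (Phi t k) (Phi t k)" for t k
  have g_scale: "g t (r *\<^sub>R k) = r\<^sup>2 * g t k" for t r k
  proof -
    have "Phi t k \<in> DA" using range_Phi[of t] sub(3)[of t] by blast
    then show ?thesis
      by (simp add: g_def Phi_def linear_scale[OF linear_pair_map2] Q_scale_left Q_scale_right power2_eq_square)
  qed
  obtain k0 where k0: "w = pair_map2 z z' k0" using w(1) range_pair_map2[OF z(1,2)] by blast
  have g0: "g 0 k0 < 0" using w(2) k0 by (simp add: g_def Phi)
  have "k0 \<noteq> 0" using w(2) k0 by (auto simp: linear_0[OF linear_pair_map2] Q_def)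
  have "\<exists>t\<in>{0<..<1}. (\<forall>k. norm k = 1 \<longrightarrow> g t k \<ge> 0) \<and> (\<exists>k. norm k = 1 \<and> g t k = 0)"
  proof (rule form_path_crossing)
    show "continuous_on ({0..1} \<times> sphere 0 1) (\<lambda>(t, k). g t k)"
      unfolding g_def Q_def A_Phi unfolding Phi case_prod_unfold
      by (intro continuous_intros continuous_on_compose2[OF continuous_pair_map2[of UNIV]]
          continuous_on_compose2[OF continuous_A_pair_map2[of _ _ UNIV]] z y) auto
    show "g 1 k > 0" if "norm k = 1" for k
    proof -
      have "k \<noteq> 0" using that by (metis norm_zero zero_neq_one)
      then show ?thesis using ypos[of k] by (simp add: g_def Phi)
    qed
    show "norm (k0 /\<^sub>R norm k0) = 1" using \<open>k0 \<noteq> 0\<close> by simp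
    show "g 0 (k0 /\<^sub>R norm k0) < 0" using g0 \<open>k0 \<noteq> 0\<close> by (simp add: g_scale mult_pos_neg)
  qed
  then obtain t k where t: "0 < t" "t < 1" "\<And>k. norm k = 1 \<Longrightarrow> g t k \<ge> 0" and k: "norm k = 1" "g t k = 0"
    by auto
  define v where "v = Phi t k"
  \<comment> \<open>The parametrisation at an interior \<open>t\<close> is not known to be
    injective. A vanishing \<open>v\<close> would, by the angle condition and \<open>t > 0\<close>,
    annihilate the positive component, which is impossible for \<open>k \<noteq> 0\<close>.\<close>
  have "v \<noteq> 0"
  proof
    assume "v = 0"
    have "norm ((1 - t) *\<^sub>R pair_map2 z z' k) + norm (t *\<^sub>R pair_map2 y y' k) \<le> 2 * norm v"
      unfolding v_def Phi using mem by (intro norm_add_ge_half cross) (auto simp: block_def span_scale)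
    then have "norm (t *\<^sub>R pair_map2 y y' k) \<le> 0" 
      using norm_ge_zero[of "(1 - t) *\<^sub>R pair_map2 z z' k"] unfolding \<open>v = 0\<close> norm_zero by linarith
    then have "t *\<^sub>R pair_map2 y y' k = 0" using norm_le_zero_iff by blast
    then have "pair_map2 y y' k = 0" using t by simp
    moreover have "k \<noteq> 0" using k(1) by (metis norm_zero zero_neq_one)
    ultimately show False using ypos[of k] by (simp add: Q_def)
  qed
  have vD: "v \<in> block {p t, q t}" using range_Phi v_def by blast
  have nn: "Q l x x \<ge> 0" if x: "x \<in> block {p t, q t}" for x
  proof -
    obtain k' where k': "x = Phi t k'" using x range_Phi[of t] by blast
    show ?thesis
    proof (cases "k' = 0")
      case False
      have "g t k' = g t (norm k' *\<^sub>R (k' /\<^sub>R norm k'))" using False by simp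
      also have "\<dots> = (norm k')\<^sup>2 * g t (k' /\<^sub>R norm k')" by (rule g_scale)
      also have "\<dots> \<ge> 0" using False by (intro mult_nonneg_nonneg t(3)) auto
      finally show ?thesis by (simp add: g_def k')
    qed (simp add: k' Phi_def linear_0[OF linear_pair_map2] Q_def)
  qed
  have "inner x (A v) = l * inner x v" if "x \<in> block {p t, q t}" for x
    using k(2) that vD nn sub(3)
    by (intro Q_null_vector[of "block {p t, q t}"]) (auto simp: g_def v_def block_def)
  then have "l \<in> comp_spec A (block {p t, q t})"
    using vD \<open>v \<noteq> 0\<close> unfolding comp_spec_def by blast
  moreover have "almost_orth F (2 * (e/2)) (block {p t, q t})"
  proof (rule almost_orth_sum[OF z(3) almost_orth(1) cross])
    show "block {p t, q t} \<subseteq> {u + v | u v. u \<in> block {z, z'} \<and> v \<in> block {y, y'}}"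
    proof
      fix x assume "x \<in> block {p t, q t}"
      then obtain k' where "x = Phi t k'" using range_Phi[of t] by blast
      then have "x = (1 - t) *\<^sub>R pair_map2 z z' k' + t *\<^sub>R pair_map2 y y' k'" by (simp only: Phi)
      moreover have "(1 - t) *\<^sub>R pair_map2 z z' k' \<in> block {z, z'}" "t *\<^sub>R pair_map2 y y' k' \<in> block {y, y'}"
        using mem by (auto simp: block_def span_scale)
      ultimately show "x \<in> {u + v | u v. u \<in> block {z, z'} \<and> v \<in> block {y, y'}}" by blast
    qed
  qed (use F in auto)
  ultimately show ?thesis using pq by auto
qed

text \<open>A combination of \<open>m\<close> negative vectors has \<open>m\<close> free
  coefficients; orthogonality of all block generators to \<open>F\<close> is only
  \<open>8 * card F\<close> real conditions. The vectors are first moved into the core, where they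
  split as \<open>z i + L (z' i)\<close>, close enough in graph norm for the form to stay negative
  on all combinations.\<close>

lemma neg_system_orthogonal_block:
  assumes neg: "\<And>m. \<exists>n. neg_system s m n" and F: "finite F"
  shows "\<exists>z\<in>DL. \<exists>z'\<in>DL. almost_orth F 0 (block {z, z'}) \<and> (\<exists>w\<in>block {z, z'}. Q s w w < 0)"
proof -
  \<comment> \<open>The three booleans enumerate the eight generators: which component, whether
    \<open>L\<close> is applied, whether \<open>J\<close> is applied.\<close>
  define val where "val = (\<lambda>(f, b1, b2, b3) x y.
    inner f ((if b3 then J else id) ((if b2 then L else id) (if b1 then x else y))))"
  define K where "K = F \<times> (UNIV :: (bool \<times> bool \<times> bool) set)"
  define m where "m = Suc (card K)"
  have "finite K" using F by (simp add: K_def)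
  have m: "m > 0" "card K < card {..<m}" by (simp_all add: m_def)
  obtain n where n: "neg_system s m n" using neg by blast
  have "\<exists>W. (\<forall>k. W k \<in> dir_sum L DL) \<and> W \<longlonglongrightarrow> n i \<and> (\<lambda>k. A (W k)) \<longlonglongrightarrow> A (n i)" if "i < m" for i
  proof -
    have "n i \<in> DA" using n that by (simp add: neg_system_def)
    then have "(n i, A (n i)) \<in> closure (graph_of A (dir_sum L DL))"
      using core by (auto simp: is_core_def graph_of_def)
    then obtain g where g: "\<And>k. g k \<in> graph_of A (dir_sum L DL)" "g \<longlonglongrightarrow> (n i, A (n i))"
      unfolding closure_sequential by blast
    have "snd (g k) = A (fst (g k))" "fst (g k) \<in> dir_sum L DL" for k
      using g(1)[of k] by (auto simp: graph_of_def)
    then show ?thesis using tendsto_fst[OF g(2)] tendsto_snd[OF g(2)]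
      by (intro exI[of _ "\<lambda>k. fst (g k)"]) simp
  qed
  then obtain W where W: "\<And>i k. i < m \<Longrightarrow> W i k \<in> dir_sum L DL" "\<And>i. i < m \<Longrightarrow> W i \<longlonglongrightarrow> n i"
    "\<And>i. i < m \<Longrightarrow> (\<lambda>k. A (W i k)) \<longlonglongrightarrow> A (n i)" by metis
  \<comment> \<open>With entries of the Gram matrix off by less than 1/(2m), the error in the form
    is at most half the sum of the squared coefficients, because the square of the sum of their
    moduli is at most \<open>m\<close> times that sum.\<close>
  have "eventually (\<lambda>k. \<forall>i\<in>{..<m}. \<forall>j\<in>{..<m}. \<bar>Q s (W i k) (W j k) - (if i = j then - 1 else 0)\<bar> < 1 / (2 * real m))
      sequentially"
  proof (intro eventually_ball_finite ballI)
    fix i j assume "i \<in> {..<m}" "j \<in> {..<m}"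
    then have "(\<lambda>k. Q s (W i k) (W j k) - (if i = j then - 1 else 0)) \<longlonglongrightarrow> Q s (n i) (n j) - (if i = j then - 1 else 0)"
      unfolding Q_def by (intro tendsto_intros W) auto
    moreover have "Q s (n i) (n j) = (if i = j then - 1 else 0)"
      using n \<open>i \<in> _\<close> \<open>j \<in> _\<close> by (simp add: neg_system_def)
    ultimately have "(\<lambda>k. \<bar>Q s (W i k) (W j k) - (if i = j then - 1 else 0)\<bar>) \<longlonglongrightarrow> 0"
      by (simp add: tendsto_rabs_zero)
    then show "eventually (\<lambda>k. \<bar>Q s (W i k) (W j k) - (if i = j then - 1 else 0)\<bar> < 1 / (2 * real m)) sequentially"
      using m(1) by (intro order_tendstoD(2)) auto
  qed auto
  then obtain k where k: "\<And>i j. i < m \<Longrightarrow> j < m \<Longrightarrow>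
      \<bar>Q s (W i k) (W j k) - (if i = j then - 1 else 0)\<bar> < 1 / (2 * real m)"
    unfolding eventually_sequentially by (metis lessThan_iff order_refl)
  have "\<exists>z z'. z \<in> DL \<and> z' \<in> DL \<and> W i k = z + L z'" if "i < m" for i
    using W(1)[OF that, of k] unfolding dir_sum_def by blast
  then obtain z z' where z: "\<And>i. i < m \<Longrightarrow> z i \<in> DL" "\<And>i. i < m \<Longrightarrow> z' i \<in> DL"
    "\<And>i. i < m \<Longrightarrow> W i k = z i + L (z' i)" by metis
  obtain c where c: "\<exists>i\<in>{..<m}. c i \<noteq> 0" "\<And>\<kappa>. \<kappa> \<in> K \<Longrightarrow> (\<Sum>i<m. val \<kappa> (z i) (z' i) * c i) = 0"
    using homogeneous_system_nontrivial[OF \<open>finite K\<close> _ m(2), of "\<lambda>\<kappa> i. val \<kappa> (z i) (z' i)"] by auto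
  define Z where "Z = (\<Sum>i<m. c i *\<^sub>R z i)"
  define Z' where "Z' = (\<Sum>i<m. c i *\<^sub>R z' i)"
  have ZDL: "Z \<in> DL" "Z' \<in> DL"
    using z DL_subspace by (auto simp: Z_def Z'_def intro!: subspace_sum subspace_scale)
  have LZ: "L Z = (\<Sum>i<m. c i *\<^sub>R L (z i))" "L Z' = (\<Sum>i<m. c i *\<^sub>R L (z' i))"
    using L_sum[of "{..<m}" z c] L_sum[of "{..<m}" z' c] z by (simp_all add: Z_def Z'_def)
  have J_sum: "J (\<Sum>i<m. c i *\<^sub>R x i) = (\<Sum>i<m. c i *\<^sub>R J (x i))" for x
    by (simp add: linear_sum[OF J_linear] linear_scale[OF J_linear])
  have val0: "val (f, b1, b2, b3) Z Z' = 0" if "f \<in> F" for f b1 b2 b3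
  proof -
    have "val (f, b1, b2, b3) Z Z' = (\<Sum>i<m. val (f, b1, b2, b3) (z i) (z' i) * c i)"
      by (cases b1; cases b2; cases b3)
        (simp_all add: val_def LZ, simp_all add: Z_def Z'_def J_sum inner_sum_right mult.commute)
    then show ?thesis using c(2)[of "(f, b1, b2, b3)"] that by (simp add: K_def)
  qed
  have gen0: "inner f g = 0" if f: "f \<in> F" and g: "g \<in> block_gens {Z, Z'}" for f g
  proof -
    have "g \<in> {Z, Z', J Z, J Z', L Z, L Z', J (L Z), J (L Z')}"
      using g ZDL by (auto simp: block_gens_def L_J)
    then show ?thesis
      using val0[OF f, of True False False] val0[OF f, of False False False]
        val0[OF f, of True False True] val0[OF f, of False False True]
        val0[OF f, of True True False] val0[OF f, of False True False]
        val0[OF f, of True True True] val0[OF f, of False True True]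
      by (auto simp: val_def)
  qed
  have "almost_orth F 0 (block {Z, Z'})"
    unfolding almost_orth_def
  proof (intro ballI)
    fix f w assume f: "f \<in> F" and "w \<in> block {Z, Z'}"
    then have "orthogonal f w"
      unfolding block_def by (intro orthogonal_to_span[of w "block_gens {Z, Z'}"]) (auto simp: orthogonal_def gen0)
    then show "\<bar>inner f w\<bar> \<le> 0 * norm w" by (simp add: orthogonal_def)
  qed
  moreover have "Z + L Z' \<in> block {Z, Z'}"
    unfolding block_def by (intro span_add) (auto simp: block_gens_def intro: span_base)
  moreover have "Q s (Z + L Z') (Z + L Z') < 0"
  proof -
    have eq: "Z + L Z' = (\<Sum>i<m. c i *\<^sub>R W i k)"
      unfolding LZ by (simp add: Z_def z(3) scaleR_add_right sum.distrib)
    have "W i k \<in> DA" if "i < m" for i using W(1)[OF that] dir_sum_subset by blast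
    then have "Q s (Z + L Z') (Z + L Z') = (\<Sum>i<m. \<Sum>j<m. c i * c j * Q s (W i k) (W j k))"
      unfolding eq by (intro Q_sum) auto
    also have "\<dots> \<le> (\<Sum>i<m. \<Sum>j<m. c i * c j * (if i = j then - 1 else 0) + \<bar>c i\<bar> * \<bar>c j\<bar> * (1 / (2 * real m)))"
    proof (intro sum_mono)
      fix i j assume "i \<in> {..<m}" "j \<in> {..<m}"
      define r where "r = Q s (W i k) (W j k) - (if i = j then - 1 else 0)"
      have "\<bar>c i * c j * r\<bar> \<le> \<bar>c i\<bar> * \<bar>c j\<bar> * (1 / (2 * real m))"
        unfolding abs_mult r_def using k[of i j] \<open>i \<in> _\<close> \<open>j \<in> _\<close> by (intro mult_left_mono) auto
      moreover have "c i * c j * Q s (W i k) (W j k) = c i * c j * (if i = j then - 1 else 0) + c i * c j * r"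
        by (simp add: r_def algebra_simps)
      ultimately show "c i * c j * Q s (W i k) (W j k)
          \<le> c i * c j * (if i = j then - 1 else 0) + \<bar>c i\<bar> * \<bar>c j\<bar> * (1 / (2 * real m))"
        by linarith
    qed
    also have "\<dots> = (\<Sum>i<m. \<Sum>j<m. c i * c j * (if i = j then - 1 else 0))
        + (\<Sum>i<m. \<bar>c i\<bar>) * (\<Sum>j<m. \<bar>c j\<bar>) * (1 / (2 * real m))"
      unfolding sum_product by (simp add: sum.distrib sum_divide_distrib)
    also have "(\<Sum>i<m. \<Sum>j<m. c i * c j * (if i = j then - 1 else 0)) = - (\<Sum>i<m. (c i)\<^sup>2)"
    proof -
      have "(\<Sum>j<m. c i * c j * (if i = j then - 1 else 0)) = - (c i)\<^sup>2" if "i < m" for i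
      proof -
        have "(\<Sum>j<m. c i * c j * (if i = j then - 1 else 0)) = (\<Sum>j<m. if j = i then - (c i)\<^sup>2 else 0)"
          by (intro sum.cong) (auto simp: power2_eq_square)
        then show ?thesis using that by simp
      qed
      then show ?thesis by (simp add: sum_negf)
    qed
    also have "(\<Sum>i<m. \<bar>c i\<bar>) * (\<Sum>j<m. \<bar>c j\<bar>) * (1 / (2 * real m)) \<le> (\<Sum>i<m. (c i)\<^sup>2) / 2"
    proof -
      have "(\<Sum>i<m. \<bar>c i\<bar>)\<^sup>2 \<le> (\<Sum>i<m. \<bar>c i\<bar>\<^sup>2) * real (card {..<m})"
        by (rule sum_squared_le_sum_of_squares)
      then have "(\<Sum>i<m. \<bar>c i\<bar>) * (\<Sum>j<m. \<bar>c j\<bar>) \<le> (\<Sum>i<m. (c i)\<^sup>2) * real m"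
        by (simp add: power2_eq_square)
      then have "(\<Sum>i<m. \<bar>c i\<bar>) * (\<Sum>j<m. \<bar>c j\<bar>) * (1 / (2 * real m))
          \<le> (\<Sum>i<m. (c i)\<^sup>2) * real m * (1 / (2 * real m))"
        by (intro mult_right_mono) auto
      then show ?thesis using m(1) by simp
    qed
    finally have "Q s (Z + L Z') (Z + L Z') \<le> - (\<Sum>i<m. (c i)\<^sup>2) / 2" by simp
    moreover have "(\<Sum>i<m. (c i)\<^sup>2) > 0"
    proof -
      obtain i where "i \<in> {..<m}" "c i \<noteq> 0" using c(1) by blast
      then show ?thesis by (intro sum_pos2[of _ i]) auto
    qed
    ultimately show ?thesis by simp
  qed
  ultimately show ?thesis using ZDL by blast
qed

section \<open>The interval of the lower eigenvalue\<close>

lemma adm_seq_liminf_bounds: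
  assumes "adm_seq L DL xs"
  shows "inf_liminf L DL f \<le> liminf (\<lambda>n. ereal (f (xs n)))"
    and "limsup (\<lambda>n. ereal (f (xs n))) \<le> sup_limsup L DL f"
  unfolding inf_liminf_def sup_limsup_def
  by (rule Inf_lower, use assms in blast, rule Sup_upper, use assms in blast)

text \<open>Extracts one term meeting a condition that holds infinitely often together with eventual
  ones; \<open>R\<close> stands for whatever else holds eventually.\<close>

lemma exists_below:
  assumes adm: "adm_seq L DL xs" and "liminf (\<lambda>n. ereal (f (xs n))) < ereal r"
    and ev: "eventually (\<lambda>n. R (xs n)) sequentially" and F: "finite F" "e > 0"
  shows "\<exists>x\<in>DL. x \<noteq> 0 \<and> almost_orth F e (block {x}) \<and> R x \<and> f x < r"
proof (rule ccontr)
  assume no: "\<not> ?thesis"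
  from adm_seq_almost_orth[OF adm F] ev have "eventually (\<lambda>n. ereal r \<le> ereal (f (xs n))) sequentially"
  proof eventually_elim
    case (elim n)
    then show ?case using no adm unfolding adm_seq_def by (metis ereal_less_eq(3) linorder_not_le)
  qed
  then have "ereal r \<le> liminf (\<lambda>n. ereal (f (xs n)))" by (rule Liminf_bounded)
  then show False using assms(2) by simp
qed

lemma exists_above:
  assumes adm: "adm_seq L DL xs" and "ereal r < limsup (\<lambda>n. ereal (f (xs n)))"
    and ev: "eventually (\<lambda>n. R (xs n)) sequentially" and F: "finite F" "e > 0"
  shows "\<exists>x\<in>DL. x \<noteq> 0 \<and> almost_orth F e (block {x}) \<and> R x \<and> r < f x"
proof (rule ccontr)
  assume no: "\<not> ?thesis"
  from adm_seq_almost_orth[OF adm F] ev have "eventually (\<lambda>n. ereal (f (xs n)) \<le> ereal r) sequentially"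
  proof eventually_elim
    case (elim n)
    then show ?case using no adm unfolding adm_seq_def by (metis ereal_less_eq(3) linorder_not_le)
  qed
  then have "limsup (\<lambda>n. ereal (f (xs n))) \<le> ereal r" by (rule Limsup_bounded)
  then show False using assms(2) by simp
qed

text \<open>At an end of the interval, remote single-generator blocks already have
  \<open>mu1\<close> close to \<open>l\<close>. Strictly inside, \<open>l\<close> is reached by
  interpolation, with \<open>z' = z\<close> as the negative block.\<close>

lemma mu1_interval_not_spec:
  assumes l: "l \<notin> spec A DA"
    and low: "inf_liminf L DL (mu1 J A L) \<le> ereal l" and high: "ereal l \<le> sup_limsup L DL (mu1 J A L)"
  shows "l \<in> spu J A DA L DL"
proof (rule spu_intro[OF l])
  fix F :: "'a set" and e :: real assume F: "finite F" "e > 0"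
  let ?f = "mu1 J A L"
  have single: "\<exists>S. finite S \<and> S \<subseteq> DL \<and> almost_orth F e (block S) \<and> (\<exists>m\<in>comp_spec A (block S). \<bar>l - m\<bar> < e)"
    if "x \<in> DL" "x \<noteq> 0" "almost_orth F e (block {x})" "l - e < ?f x" "?f x < l + e" for x
    using that mu1_facts(3)[of x] by (intro exI[of _ "{x}"]) (auto intro!: bexI[of _ "?f x"])
  consider "inf_liminf L DL ?f = ereal l" | "ereal l = sup_limsup L DL ?f"
    | "inf_liminf L DL ?f < ereal l" "ereal l < sup_limsup L DL ?f"
    using low high unfolding order_le_less by blast
  then show "\<exists>S. finite S \<and> S \<subseteq> DL \<and> almost_orth F e (block S) \<and> (\<exists>m\<in>comp_spec A (block S). \<bar>l - m\<bar> < e)"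
  proof cases
    case 1
    then have "inf_liminf L DL ?f < ereal (l + e)" using F by simp
    then obtain xs where xs: "adm_seq L DL xs" "liminf (\<lambda>n. ereal (?f (xs n))) < ereal (l + e)"
      unfolding inf_liminf_def by (auto simp: Inf_less_iff)
    have "ereal (l - e) < liminf (\<lambda>n. ereal (?f (xs n)))"
      by (rule less_le_trans[OF _ adm_seq_liminf_bounds(1)[OF xs(1), of ?f]]) (use 1 F in simp)
    then have "eventually (\<lambda>n. l - e < ?f (xs n)) sequentially" by (auto dest: less_LiminfD)
    then show ?thesis using exists_below[OF xs _ F, of "\<lambda>x. l - e < ?f x"] single by blast
  next
    case 2
    then have 2: "sup_limsup L DL ?f = ereal l" by (rule sym)
    then have "ereal (l - e) < sup_limsup L DL ?f" using F by simp
    then obtain xs where xs: "adm_seq L DL xs" "ereal (l - e) < limsup (\<lambda>n. ereal (?f (xs n)))"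
      unfolding sup_limsup_def by (auto simp: less_Sup_iff)
    have "limsup (\<lambda>n. ereal (?f (xs n))) < ereal (l + e)"
      by (rule le_less_trans[OF adm_seq_liminf_bounds(2)[OF xs(1), of ?f]]) (use 2 F in simp)
    then have "eventually (\<lambda>n. ?f (xs n) < l + e) sequentially" by (auto dest: Limsup_lessD)
    then show ?thesis using exists_above[OF xs _ F, of "\<lambda>x. ?f x < l + e"] single by blast
  next
    case 3
    obtain xs where xs: "adm_seq L DL xs" "liminf (\<lambda>n. ereal (?f (xs n))) < ereal l"
      using 3(1) unfolding inf_liminf_def by (auto simp: Inf_less_iff)
    obtain ys where ys: "adm_seq L DL ys" "ereal l < limsup (\<lambda>n. ereal (?f (ys n)))"
      using 3(2) unfolding sup_limsup_def by (auto simp: less_Sup_iff)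
    \<comment> \<open>The interpolation needs a margin independent of \<open>F'\<close> and
      \<open>e'\<close>; \<open>r - l\<close> provides it.\<close>
    obtain r where r: "l < r" "ereal r < limsup (\<lambda>n. ereal (?f (ys n)))"
      using ereal_dense2[OF ys(2)] by auto
    have "\<exists>p\<in>DL. \<exists>q\<in>DL. almost_orth F e (block {p, q}) \<and> l \<in> comp_spec A (block {p, q})"
    proof (rule block_interpolation[OF _ _ _ F])
      show "r - l > 0" using r by simp
      fix F' :: "'a set" and e' :: real assume F': "finite F'" "e' > 0"
      show "\<exists>y\<in>DL. y \<noteq> 0 \<and> almost_orth F' e' (block {y}) \<and> l + (r - l) \<le> ?f y"
        using exists_above[OF ys(1) r(2), of "\<lambda>_. True", OF _ F'] by force
      obtain x where x: "x \<in> DL" "x \<noteq> 0" "almost_orth F' e' (block {x})" "?f x < l"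
        using exists_below[OF xs, of "\<lambda>_. True", OF _ F'] by auto
      obtain v where v: "v \<in> block {x}" "norm v = 1" "inner v (A v) = ?f x * inner v v"
        using mu1_facts(1)[OF x(1,2)] by blast
      then have "Q l v v < 0" using x(4) by (simp add: Q_self dot_square_norm)
      then show "\<exists>z\<in>DL. \<exists>z'\<in>DL. almost_orth F' e' (block {z, z'}) \<and> (\<exists>w\<in>block {z, z'}. Q l w w < 0)"
        using x v by (intro bexI[of _ x]) auto
    qed
    then obtain p q where "p \<in> DL" "q \<in> DL" "almost_orth F e (block {p, q})" "l \<in> comp_spec A (block {p, q})" by blast
    then show ?thesis using F by (intro exI[of _ "{p, q}"]) (auto intro!: bexI[of _ l])
  qed
qed

text \<open>At level \<open>l - h\<close> the given sequence supplies the positive blocks, with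
  margin \<open>h / 2\<close>. Negative blocks come from negative systems of every length, since a
  bounded length would contradict the weak nullity of the lowest eigenvectors.\<close>

lemma constant_mu1_left_pollution:
  assumes ker: "finite B" "{x \<in> DA. A x = l *\<^sub>R x} = span B"
    and h: "0 < h" and gap: "\<And>m. 0 < \<bar>m - l\<bar> \<Longrightarrow> \<bar>m - l\<bar> \<le> h \<Longrightarrow> m \<notin> spec A DA"
    and adm: "adm_seq L DL xs" and lim: "(\<lambda>n. mu1 J A L (xs n)) \<longlonglongrightarrow> l"
  shows "l - h \<in> spu J A DA L DL"
proof -
  have xs: "xs k \<in> DL" "xs k \<noteq> 0" for k using adm unfolding adm_seq_def by blast+
  have "\<exists>v. v \<in> block {xs k} \<and> norm v = 1 \<and> inner v (A v) = mu1 J A L (xs k)" for k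
    using mu1_facts(1)[OF xs, of k] by (force simp: dot_square_norm)
  then obtain v where v: "\<And>k. v k \<in> block {xs k}" "\<And>k. norm (v k) = 1"
    "\<And>k. inner (v k) (A (v k)) = mu1 J A L (xs k)" by metis
  have vDA: "v k \<in> DA" for k using v(1)[of k] block_subset[of "{xs k}"] xs by auto
  have weak: "(\<lambda>k. inner y (v k)) \<longlonglongrightarrow> 0" for y
  proof (rule tendstoI)
    fix e :: real assume "e > 0"
    then have "eventually (\<lambda>k. almost_orth {y} (e/2) (block {xs k})) sequentially" by (intro adm_seq_almost_orth[OF adm]) auto
    then show "eventually (\<lambda>k. dist (inner y (v k)) 0 < e) sequentially"
    proof eventually_elim
      case (elim k)
      then have "\<bar>inner y (v k)\<bar> \<le> e / 2" using almost_orthD[OF elim _ v(1)[of k], of y] v(2) by simp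
      then show ?case using \<open>e > 0\<close> by simp
    qed
  qed
  have neg: "\<forall>m. \<exists>n. neg_system (l - h) m n"
  proof (rule ccontr)
    assume "\<not> (\<forall>m. \<exists>n. neg_system (l - h) m n)"
    then obtain m n where n: "neg_system (l - h) m n"
      "\<And>u. u \<in> DA \<Longrightarrow> (\<And>j. j < m \<Longrightarrow> Q (l - h) u (n j) = 0) \<Longrightarrow> Q (l - h) u u \<ge> 0"
      using neg_system_dichotomy by blast
    show False
      by (rule nonneg_codim_no_null_sequence[OF h gap ker n vDA v(2) weak]) (simp_all add: v(3) lim)
  qed
  have l: "l - h \<notin> spec A DA" using h by (intro gap) auto
  show ?thesis
  proof (rule spu_intro[OF l])
    fix F :: "'a set" and e :: real assume F: "finite F" "e > 0"
    have "\<exists>p\<in>DL. \<exists>q\<in>DL. almost_orth F e (block {p, q}) \<and> l - h \<in> comp_spec A (block {p, q})"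
    proof (rule block_interpolation[OF _ _ _ F])
      show "h / 2 > 0" using h by simp
      fix F' :: "'a set" and e' :: real assume F': "finite F'" "e' > 0"
      have "eventually (\<lambda>n. l - h / 2 < mu1 J A L (xs n)) sequentially"
        using h by (intro order_tendstoD(1)[OF lim]) auto
      with adm_seq_almost_orth[OF adm F']
      have "eventually (\<lambda>n. almost_orth F' e' (block {xs n}) \<and> l - h / 2 < mu1 J A L (xs n)) sequentially"
        by eventually_elim simp
      then obtain k where "almost_orth F' e' (block {xs k})" "l - h / 2 < mu1 J A L (xs k)"
        unfolding eventually_sequentially by blast
      then show "\<exists>y\<in>DL. y \<noteq> 0 \<and> almost_orth F' e' (block {y}) \<and> l - h + h / 2 \<le> mu1 J A L y"
        using xs[of k] by (intro bexI[of _ "xs k"]) auto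
      obtain z z' where z: "z \<in> DL" "z' \<in> DL" "almost_orth F' 0 (block {z, z'})" "\<exists>w\<in>block {z, z'}. Q (l - h) w w < 0"
        using neg_system_orthogonal_block[OF neg[rule_format] F'(1)] by blast
      moreover have "almost_orth F' e' (block {z, z'})" using F'(2) by (intro almost_orth_mono[OF z(3)]) auto
      ultimately show "\<exists>z\<in>DL. \<exists>z'\<in>DL. almost_orth F' e' (block {z, z'}) \<and> (\<exists>w\<in>block {z, z'}. Q (l - h) w w < 0)"
        by blast
    qed
    then obtain p q where "p \<in> DL" "q \<in> DL" "almost_orth F e (block {p, q})" "l - h \<in> comp_spec A (block {p, q})" by blast
    then show "\<exists>S. finite S \<and> S \<subseteq> DL \<and> almost_orth F e (block S) \<and> (\<exists>m\<in>comp_spec A (block S). \<bar>l - h - m\<bar> < e)"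
      using F by (intro exI[of _ "{p, q}"]) (auto intro!: bexI[of _ "l - h"])
  qed
qed

lemma mu1_interval_disc_spec:
  assumes l: "l \<in> disc_spec A DA"
    and low: "inf_liminf L DL (mu1 J A L) \<le> ereal l" and high: "ereal l \<le> sup_limsup L DL (mu1 J A L)"
  shows "l \<in> closure (spu J A DA L DL)"
  unfolding closure_approachable
proof (intro allI impI)
  fix e :: real assume "e > 0"
  let ?f = "mu1 J A L"
  obtain d B where d: "d > 0" "spec A DA \<inter> ball l d = {l}"
    and B: "finite B" "{x \<in> DA. A x = l *\<^sub>R x} = span B"
    using l unfolding disc_spec_def by blast
  define h where "h = min d e / 2"
  have h: "0 < h" "h < d" "h < e" using d \<open>e > 0\<close> by (auto simp: h_def)
  have gap: "m \<notin> spec A DA" if "0 < \<bar>m - l\<bar>" "\<bar>m - l\<bar> \<le> h" for m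
  proof
    assume "m \<in> spec A DA"
    then have "m \<in> spec A DA \<inter> ball l d" using that h by (simp add: dist_real_def)
    then show False using d(2) that(1) by simp
  qed
  have near: "\<exists>y\<in>spu J A DA L DL. dist y l < e"
    if "inf_liminf L DL ?f \<le> ereal m" "ereal m \<le> sup_limsup L DL ?f" "0 < \<bar>m - l\<bar>" "\<bar>m - l\<bar> \<le> h" for m
    using mu1_interval_not_spec[OF gap[OF that(3,4)] that(1,2)] that(4) h
    by (intro bexI[of _ m]) (auto simp: dist_real_def)
  consider "inf_liminf L DL ?f < ereal l" | "ereal l < sup_limsup L DL ?f"
    | "inf_liminf L DL ?f = ereal l" "ereal l = sup_limsup L DL ?f"
    using low high unfolding order_le_less by blast
  then show "\<exists>y\<in>spu J A DA L DL. dist y l < e"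
  proof cases
    case 1
    then obtain r where r: "inf_liminf L DL ?f < ereal r" "r < l" using ereal_dense2 by fastforce
    \<comment> \<open>Clipping at \<open>l - h\<close> keeps \<open>m\<close> in the hole around
      \<open>l\<close>, and \<open>m >= r\<close> keeps it in the interval.\<close>
    define m where "m = max r (l - h)"
    have "ereal m \<le> ereal l" using r h unfolding ereal_less_eq by (simp add: m_def)
    then have "ereal m \<le> sup_limsup L DL ?f" using high by (rule order_trans)
    moreover have "ereal r \<le> ereal m" unfolding ereal_less_eq by (simp add: m_def)
    then have "inf_liminf L DL ?f \<le> ereal m" using r(1) by (meson less_imp_le order_trans)
    moreover have "0 < \<bar>m - l\<bar>" "\<bar>m - l\<bar> \<le> h" using r(2) h by (auto simp: m_def)
    ultimately show ?thesis by (intro near[of m])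
  next
    case 2
    then obtain r where r: "ereal r < sup_limsup L DL ?f" "l < r" using ereal_dense2 by fastforce
    define m where "m = min r (l + h)"
    have "ereal l \<le> ereal m" using r h unfolding ereal_less_eq by (simp add: m_def)
    with low have "inf_liminf L DL ?f \<le> ereal m" by (rule order_trans)
    moreover have "ereal m \<le> ereal r" unfolding ereal_less_eq by (simp add: m_def)
    then have "ereal m \<le> sup_limsup L DL ?f" using r(1) by (meson less_imp_le order_trans)
    moreover have "0 < \<bar>m - l\<bar>" "\<bar>m - l\<bar> \<le> h" using r(2) h by (auto simp: m_def)
    ultimately show ?thesis by (intro near[of m])
  next
    case 3
    \<comment> \<open>An infimum over no sequences would be infinite, so a finite value provides an
      admissible sequence.\<close>
    have "inf_liminf L DL ?f < \<infinity>" unfolding 3(1) by simp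
    then obtain xs where xs: "adm_seq L DL xs" unfolding inf_liminf_def Inf_less_iff by blast
    have "ereal l \<le> liminf (\<lambda>n. ereal (?f (xs n)))" "limsup (\<lambda>n. ereal (?f (xs n))) \<le> ereal l"
      using adm_seq_liminf_bounds[OF xs, of ?f] unfolding 3(1) 3(2)[symmetric] by blast+
    then have "(\<lambda>n. ereal (?f (xs n))) \<longlonglongrightarrow> ereal l"
      using Liminf_le_Limsup[of sequentially "\<lambda>n. ereal (?f (xs n))"]
      by (intro Liminf_eq_Limsup) auto
    then have "(\<lambda>n. ?f (xs n)) \<longlonglongrightarrow> l" by simp
    with gap xs have "l - h \<in> spu J A DA L DL"
      by (intro constant_mu1_left_pollution[OF B h(1)])
    then show ?thesis using h by (intro bexI[of _ "l - h"]) (auto simp: dist_real_def)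
  qed
qed

lemma mu1_le_if_form_le:
  assumes "\<And>u. u \<in> DA \<Longrightarrow> inner u (A u) \<le> C * (norm u)\<^sup>2" "x \<in> DL" "x \<noteq> 0"
  shows "mu1 J A L x \<le> C"
proof -
  obtain v where v: "v \<in> block {x}" "norm v = 1" "inner v (A v) = mu1 J A L x * inner v v"
    using mu1_facts(1)[OF assms(2,3)] by blast
  then have "v \<in> DA" using block_subset[of "{x}"] assms(2) by auto
  then show ?thesis using assms(1)[of v] v by (simp add: dot_square_norm)
qed

lemma mu1_ge_if_form_ge:
  assumes "\<And>u. u \<in> DA \<Longrightarrow> C * (norm u)\<^sup>2 \<le> inner u (A u)" "x \<in> DL" "x \<noteq> 0"
  shows "C \<le> mu1 J A L x"
proof -
  obtain v where v: "v \<in> block {x}" "norm v = 1" "inner v (A v) = mu1 J A L x * inner v v"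
    using mu1_facts(1)[OF assms(2,3)] by blast
  then have "v \<in> DA" using block_subset[of "{x}"] assms(2) by auto
  then show ?thesis using assms(1)[of v] v by (simp add: dot_square_norm)
qed

end

section \<open>Reflection of the operator and the upper eigenvalue\<close>

lemma spec_uminus:
  fixes T :: "'a::real_normed_vector \<Rightarrow> 'a"
  assumes "l \<in> spec (\<lambda>x. - T x) DT"
  shows "- l \<in> spec T DT"
proof -
  have "bij_betw (\<lambda>x. - T x - l *\<^sub>R x) DT UNIV \<and> (\<exists>C. \<forall>x\<in>DT. norm x \<le> C * norm (- T x - l *\<^sub>R x))"
    if "bij_betw (\<lambda>x. T x - - l *\<^sub>R x) DT UNIV" "\<forall>x\<in>DT. norm x \<le> C * norm (T x - - l *\<^sub>R x)" for C
  proof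
    have eq: "(\<lambda>x. - T x - l *\<^sub>R x) = uminus \<circ> (\<lambda>x. T x - - l *\<^sub>R x)" by (auto simp: fun_eq_iff)
    have "bij_betw uminus UNIV (UNIV :: 'a set)" by (rule bij_uminus)
    then show "bij_betw (\<lambda>x. - T x - l *\<^sub>R x) DT UNIV" unfolding eq by (rule bij_betw_trans[OF that(1)])
    have "norm (- T x - l *\<^sub>R x) = norm (T x - - l *\<^sub>R x)" for x
      using norm_minus_cancel[of "T x - - l *\<^sub>R x"] by simp
    then show "\<exists>C. \<forall>x\<in>DT. norm x \<le> C * norm (- T x - l *\<^sub>R x)" using that(2) by auto
  qed
  then show ?thesis using assms unfolding spec_def by blast
qed

lemma spec_uminus_iff: "l \<in> spec (\<lambda>x. - T x) DT \<longleftrightarrow> - l \<in> spec T DT"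
  using spec_uminus[of l T DT] spec_uminus[of "- l" "\<lambda>x. - T x" DT] by auto

lemma comp_spec_uminus_iff: "l \<in> comp_spec (\<lambda>x. - T x) W \<longleftrightarrow> - l \<in> comp_spec T W"
  by (auto simp: comp_spec_def) (metis minus_equation_iff)+

lemma ess_spec_uminus:
  assumes "l \<in> ess_spec (\<lambda>x. - T x) DT"
  shows "- l \<in> ess_spec T DT"
proof -
  have "l \<in> disc_spec (\<lambda>x. - T x) DT" if disc: "- l \<in> disc_spec T DT"
  proof -
    obtain e B where e: "e > 0" "spec T DT \<inter> ball (- l) e = {- l}"
      and B: "finite B" "{x \<in> DT. T x = - l *\<^sub>R x} = span B" and l: "- l \<in> spec T DT"
      using disc unfolding disc_spec_def by blast
    have "m = l" if "m \<in> spec (\<lambda>x. - T x) DT" "m \<in> ball l e" for m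
    proof -
      have "- m \<in> spec T DT \<inter> ball (- l) e"
        using that by (auto simp: spec_uminus_iff dist_real_def)
      then show ?thesis using e(2) by auto
    qed
    then have "spec (\<lambda>x. - T x) DT \<inter> ball l e = {l}" using e(1) l by (auto simp: spec_uminus_iff)
    moreover have "{x \<in> DT. - T x = l *\<^sub>R x} = span B"
    proof -
      have "- T x = l *\<^sub>R x \<longleftrightarrow> T x = - l *\<^sub>R x" for x by (metis minus_minus scaleR_minus_left)
      then show ?thesis using B(2) by simp
    qed
    ultimately show ?thesis using e(1) B(1) l unfolding disc_spec_def by (auto simp: spec_uminus_iff)
  qed
  then show ?thesis using assms unfolding ess_spec_def by (auto simp: spec_uminus_iff)
qed

lemma closure_graph_uminus:
  fixes T :: "'a::real_normed_vector \<Rightarrow> 'a"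
  assumes "(x, y) \<in> closure (graph_of T W)"
  shows "(x, - y) \<in> closure (graph_of (\<lambda>x. - T x) W)"
proof -
  have "bounded_linear (\<lambda>p::'a \<times> 'a. (fst p, - snd p))"
    by (intro bounded_linear_Pair bounded_linear_fst bounded_linear_minus bounded_linear_snd)
  then have "(\<lambda>p. (fst p, - snd p)) ` closure (graph_of T W) \<subseteq> closure ((\<lambda>p. (fst p, - snd p)) ` graph_of T W)"
    by (rule closure_bounded_linear_image_subset)
  moreover have "(\<lambda>p. (fst p, - snd p)) ` graph_of T W = graph_of (\<lambda>x. - T x) W"
    by (force simp: graph_of_def)
  ultimately show ?thesis using assms by force
qed

lemma spu_uminus:
  assumes "l \<in> spu J (\<lambda>x. - A x) DA L DL"
  shows "- l \<in> spu J A DA L DL"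
proof -
  obtain V where l: "l \<notin> spec (\<lambda>x. - A x) DA"
    and V: "\<forall>n. fin_csubspace J (V n) \<and> V n \<subseteq> DL \<and> V n \<subseteq> V (Suc n)"
    "graph_of (\<lambda>x. - A x) DA \<subseteq> closure (graph_of (\<lambda>x. - A x) (\<Union>n. dir_sum L (V n)))"
    "\<forall>e>0. eventually (\<lambda>n. \<exists>m\<in>comp_spec (\<lambda>x. - A x) (dir_sum L (V n)). \<bar>l - m\<bar> < e) sequentially"
    using assms unfolding spu_def by blast
  have "- l \<notin> spec A DA" using l by (simp add: spec_uminus_iff)
  moreover have "graph_of A DA \<subseteq> closure (graph_of A (\<Union>n. dir_sum L (V n)))"
  proof
    fix p assume "p \<in> graph_of A DA"
    then obtain x where x: "x \<in> DA" "p = (x, A x)" by (auto simp: graph_of_def)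
    then have "(x, - A x) \<in> closure (graph_of (\<lambda>x. - A x) (\<Union>n. dir_sum L (V n)))"
      using V(2) by (auto simp: graph_of_def)
    from closure_graph_uminus[OF this] x(2)
    show "p \<in> closure (graph_of A (\<Union>n. dir_sum L (V n)))" by simp
  qed
  moreover have "eventually (\<lambda>n. \<exists>m\<in>comp_spec A (dir_sum L (V n)). \<bar>- l - m\<bar> < e) sequentially"
    if "e > 0" for e
  proof -
    have "eventually (\<lambda>n. \<exists>m\<in>comp_spec (\<lambda>x. - A x) (dir_sum L (V n)). \<bar>l - m\<bar> < e) sequentially"
      using V(3) \<open>e > 0\<close> by blast
    then show ?thesis
    proof eventually_elim
      case (elim n)
      then obtain m where "m \<in> comp_spec (\<lambda>x. - A x) (dir_sum L (V n))" "\<bar>l - m\<bar> < e" by blast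
      then show ?case by (intro bexI[of _ "- m"]) (auto simp: comp_spec_uminus_iff)
    qed
  qed
  ultimately show ?thesis using V(1) unfolding spu_def by blast
qed

lemma closure_spu_uminus:
  assumes "l \<in> closure (spu J (\<lambda>x. - A x) DA L DL)"
  shows "- l \<in> closure (spu J A DA L DL)"
  unfolding closure_approachable
proof (intro allI impI)
  fix e :: real assume "e > 0"
  then obtain y where y: "y \<in> spu J (\<lambda>x. - A x) DA L DL" "dist y l < e"
    using assms unfolding closure_approachable by blast
  then show "\<exists>y\<in>spu J A DA L DL. dist y (- l) < e"
    using spu_uminus[OF y(1)] by (intro bexI[of _ "- y"]) (auto simp: dist_real_def)
qed

lemma hat_ess_spec_uminus:
  assumes "x \<in> hat_ess_spec (\<lambda>x. - A x) DA"
  shows "- x \<in> hat_ess_spec A DA"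
proof -
  have spec: "spec (\<lambda>x. - A x) DA = uminus ` spec A DA"
    by (force simp: spec_uminus_iff image_iff)
  have "bdd_below (spec (\<lambda>x. - A x) DA) = bdd_above (spec A DA)"
    "bdd_above (spec (\<lambda>x. - A x) DA) = bdd_below (spec A DA)"
    unfolding spec by simp_all
  moreover have "ereal (- r) \<in> ereal ` ess_spec A DA" if "r \<in> ess_spec (\<lambda>x. - A x) DA" for r
    using ess_spec_uminus[OF that] by (rule imageI)
  ultimately show ?thesis using assms unfolding hat_ess_spec_def by (auto split: if_splits)
qed

text \<open>Reflecting the second component of the graph preserves closures, so the core property
  carries over, and maximality follows by applying it to \<open>- z\<close>.\<close>

lemma (in balanced_setup) balanced_setup_uminus: "balanced_setup J (\<lambda>x. - A x) DA P L DL"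
proof -
  have lin: "clinear_on J DA A J" and dense: "UNIV \<subseteq> closure DA"
    and maximal: "\<And>y z. (\<forall>x\<in>DA. inner (A x) y = inner x z) \<Longrightarrow> y \<in> DA \<and> A y = z"
    using sa unfolding selfadjoint_in_def by blast+
  have "clinear_on J DA (\<lambda>x. - A x) J"
    using lin linear_neg[OF J_linear] unfolding clinear_on_def by (simp add: scaleR_minus_right)
  moreover have "\<forall>y\<in>UNIV. \<forall>z\<in>UNIV. (\<forall>x\<in>DA. inner (- A x) y = inner x z) \<longrightarrow> y \<in> DA \<and> - A y = z"
  proof (intro ballI impI)
    fix y z assume *: "\<forall>x\<in>DA. inner (- A x) y = inner x z"
    have "\<forall>x\<in>DA. inner (A x) y = inner x (- z)"
    proof
      fix x assume "x \<in> DA"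
      with * have "inner (- A x) y = inner x z" by blast
      then show "inner (A x) y = inner x (- z)" by simp
    qed
    then have "y \<in> DA \<and> A y = - z" by (rule maximal)
    then show "y \<in> DA \<and> - A y = z" by simp
  qed
  moreover have "\<forall>x\<in>DA. \<forall>y\<in>DA. inner (- A x) y = inner x (- A y)" by (simp add: A_sym)
  ultimately have "selfadjoint_in J UNIV (\<lambda>x. - A x) DA"
    using dense unfolding selfadjoint_in_def by blast
  moreover have "is_core (\<lambda>x. - A x) DA (dir_sum L DL)"
  proof -
    have cl: "closure (graph_of A (dir_sum L DL)) = graph_of A DA" using core by (simp add: is_core_def)
    have "(x, y) \<in> closure (graph_of (\<lambda>x. - A x) (dir_sum L DL)) \<longleftrightarrow> (x, y) \<in> graph_of (\<lambda>x. - A x) DA" for x y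
    proof -
      have "(x, y) \<in> closure (graph_of (\<lambda>x. - A x) (dir_sum L DL))
          \<longleftrightarrow> (x, - y) \<in> closure (graph_of A (dir_sum L DL))"
        using closure_graph_uminus[of x y "\<lambda>x. - A x"] closure_graph_uminus[of x "- y" A] by auto
      also have "\<dots> \<longleftrightarrow> (x, y) \<in> graph_of (\<lambda>x. - A x) DA"
        unfolding cl by (auto simp: graph_of_def minus_equation_iff[of y])
      finally show ?thesis .
    qed
    then show ?thesis using dir_sum_subset unfolding is_core_def by auto
  qed
  ultimately show ?thesis
    using cs separable proj L_lin DL_P L_P L_inj by (simp add: balanced_setup_def)
qed

lemma (in balanced_setup) mu2_uminus:
  assumes "x \<in> DL" "x \<noteq> 0"
  shows "mu2 J A L x = - mu1 J (\<lambda>x. - A x) L x"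
proof -
  have fin: "finite (block_gens {x})" "span (block_gens {x}) \<subseteq> DA"
    using block_subset[of "{x}"] assms by (auto simp: block_def finite_block_gens)
  have C: "finite (comp_spec A (block {x}))" using comp_spec_finite[OF fin] by (simp add: block_def)
  have ne: "comp_spec A (block {x}) \<noteq> {}" using mu1_facts(3)[OF assms] by blast
  have "comp_spec (\<lambda>x. - A x) (block {x}) = uminus ` comp_spec A (block {x})"
    by (force simp: comp_spec_uminus_iff image_iff)
  then show ?thesis
    using minus_Max_eq_Min[OF C ne] by (simp add: mu1_def mu2_def pair_span_eq[OF assms(1)])
qed

lemma (in balanced_setup) mu1_interval:
  assumes low: "inf_liminf L DL (mu1 J A L) \<le> x" and high: "x \<le> sup_limsup L DL (mu1 J A L)"
  shows "x \<in> ereal ` closure (spu J A DA L DL) \<union> hat_ess_spec A DA"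
proof (cases x)
  case (real l)
  consider "l \<notin> spec A DA" | "l \<in> disc_spec A DA" | "l \<in> ess_spec A DA" by (auto simp: ess_spec_def)
  then show ?thesis
  proof cases
    case 1
    then show ?thesis using mu1_interval_not_spec[of l] low high real closure_subset by blast
  next
    case 2
    then show ?thesis using mu1_interval_disc_spec[of l] low high real by blast
  next
    case 3
    then show ?thesis using real by (simp add: hat_ess_spec_def)
  qed
next
  case PInf
  \<comment> \<open>Spectrum bounded above would bound the form, hence \<open>mu1\<close>, by a
    constant, and an infinite upper end would be impossible.\<close>
  have "\<not> bdd_above (spec A DA)"
  proof
    assume "bdd_above (spec A DA)"
    then obtain C where C: "\<And>u. u \<in> DA \<Longrightarrow> inner u (A u) \<le> C * (norm u)\<^sup>2"
      using form_le_if_spec_bdd_above by blast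
    have "sup_limsup L DL (mu1 J A L) \<le> ereal C"
      unfolding sup_limsup_def
    proof (rule Sup_least)
      fix r assume "r \<in> {limsup (\<lambda>n. ereal (mu1 J A L (xs n))) | xs. adm_seq L DL xs}"
      then obtain xs where xs: "adm_seq L DL xs" "r = limsup (\<lambda>n. ereal (mu1 J A L (xs n)))" by blast
      have "mu1 J A L (xs n) \<le> C" for n
        using xs(1) unfolding adm_seq_def by (intro mu1_le_if_form_le C) auto
      then show "r \<le> ereal C" unfolding xs(2) by (intro Limsup_bounded) simp
    qed
    then show False using high PInf by simp
  qed
  then show ?thesis using PInf by (simp add: hat_ess_spec_def)
next
  case MInf
  have "\<not> bdd_below (spec A DA)"
  proof
    assume "bdd_below (spec A DA)"
    moreover have "spec (\<lambda>x. - A x) DA = uminus ` spec A DA" by (force simp: spec_uminus_iff image_iff)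
    ultimately have "bdd_above (spec (\<lambda>x. - A x) DA)" by simp
    \<comment> \<open>The lower form bound for \<open>A\<close> is the upper one for the reflected
      operator.\<close>
    interpret neg: balanced_setup J "\<lambda>x. - A x" DA P L DL by (rule balanced_setup_uminus)
    obtain C where C: "\<And>u. u \<in> DA \<Longrightarrow> inner u (- A u) \<le> C * (norm u)\<^sup>2"
      using neg.form_le_if_spec_bdd_above[OF \<open>bdd_above (spec (\<lambda>x. - A x) DA)\<close>] by blast
    have "ereal (- C) \<le> inf_liminf L DL (mu1 J A L)"
      unfolding inf_liminf_def
    proof (rule Inf_greatest)
      fix r assume "r \<in> {liminf (\<lambda>n. ereal (mu1 J A L (xs n))) | xs. adm_seq L DL xs}"
      then obtain xs where xs: "adm_seq L DL xs" "r = liminf (\<lambda>n. ereal (mu1 J A L (xs n)))" by blast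
      have "- C * (norm u)\<^sup>2 \<le> inner u (A u)" if "u \<in> DA" for u using C[OF that] by simp
      then have "- C \<le> mu1 J A L (xs n)" for n
        using xs(1) unfolding adm_seq_def by (intro mu1_ge_if_form_ge) auto
      then show "ereal (- C) \<le> r" unfolding xs(2) by (intro Liminf_bounded) simp
    qed
    then show False using low MInf by simp
  qed
  then show ?thesis using MInf by (simp add: hat_ess_spec_def)
qed

text \<open>Since \<open>mu2\<close> of \<open>A\<close> is minus \<open>mu1\<close> of the
  reflected operator, liminf and limsup change places and the interval is reflected; spurious points
  and the extended essential spectrum are reflected back.\<close>

lemma (in balanced_setup) mu2_interval:
  assumes low: "inf_liminf L DL (mu2 J A L) \<le> x" and high: "x \<le> sup_limsup L DL (mu2 J A L)"
  shows "x \<in> ereal ` closure (spu J A DA L DL) \<union> hat_ess_spec A DA"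
proof -
  interpret neg: balanced_setup J "\<lambda>x. - A x" DA P L DL by (rule balanced_setup_uminus)
  let ?f = "mu1 J (\<lambda>x. - A x) L"
  have mu2: "mu2 J A L (xs n) = - ?f (xs n)" if "adm_seq L DL xs" for xs n
    using that mu2_uminus unfolding adm_seq_def by blast
  have "inf_liminf L DL ?f \<le> - x"
  proof -
    have "sup_limsup L DL (mu2 J A L) \<le> - inf_liminf L DL ?f"
      unfolding sup_limsup_def
    proof (rule Sup_least)
      fix r assume "r \<in> {limsup (\<lambda>n. ereal (mu2 J A L (xs n))) | xs. adm_seq L DL xs}"
      then obtain xs where xs: "adm_seq L DL xs" "r = limsup (\<lambda>n. ereal (mu2 J A L (xs n)))" by blast
      then have "r = - liminf (\<lambda>n. ereal (?f (xs n)))"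
        by (simp add: mu2 ereal_Limsup_uminus flip: uminus_ereal.simps(1))
      then show "r \<le> - inf_liminf L DL ?f" using neg.adm_seq_liminf_bounds(1)[OF xs(1), of ?f] by simp
    qed
    then show ?thesis using high by (metis ereal_minus_le_minus ereal_uminus_uminus order_trans)
  qed
  moreover have "- x \<le> sup_limsup L DL ?f"
  proof -
    have "- sup_limsup L DL ?f \<le> inf_liminf L DL (mu2 J A L)"
      unfolding inf_liminf_def
    proof (rule Inf_greatest)
      fix r assume "r \<in> {liminf (\<lambda>n. ereal (mu2 J A L (xs n))) | xs. adm_seq L DL xs}"
      then obtain xs where xs: "adm_seq L DL xs" "r = liminf (\<lambda>n. ereal (mu2 J A L (xs n)))" by blast
      then have "r = - limsup (\<lambda>n. ereal (?f (xs n)))"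
        by (simp add: mu2 ereal_Liminf_uminus flip: uminus_ereal.simps(1))
      then show "- sup_limsup L DL ?f \<le> r" using neg.adm_seq_liminf_bounds(2)[OF xs(1), of ?f] by simp
    qed
    then show ?thesis using low by (metis ereal_minus_le_minus ereal_uminus_uminus order_trans)
  qed
  ultimately have "- x \<in> ereal ` closure (spu J (\<lambda>x. - A x) DA L DL) \<union> hat_ess_spec (\<lambda>x. - A x) DA"
    by (rule neg.mu1_interval)
  then show ?thesis
  proof
    assume "- x \<in> ereal ` closure (spu J (\<lambda>x. - A x) DA L DL)"
    then obtain l where l: "l \<in> closure (spu J (\<lambda>x. - A x) DA L DL)" "- x = ereal l" by blast
    then have "x = ereal (- l)" by (metis ereal_uminus_uminus uminus_ereal.simps(1))
    then show ?thesis using closure_spu_uminus[OF l(1)] by blast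
  next
    assume "- x \<in> hat_ess_spec (\<lambda>x. - A x) DA"
    from hat_ess_spec_uminus[OF this] show ?thesis by simp
  qed
qed

theorem mainTheorem12:
  fixes J :: "'a::{real_inner, complete_space} \<Rightarrow> 'a"
    and A :: "'a \<Rightarrow> 'a" and DA :: "'a set"
    and P :: "'a \<Rightarrow> 'a"
    and L :: "'a \<Rightarrow> 'a" and DL :: "'a set"
  assumes "complex_structure J"
    and "hilbert_separable TYPE('a)"
    and "selfadjoint_in J UNIV A DA"
    and "orth_projector J P"
    and "clinear_on J DL L J"
    and "DL \<subseteq> range P"
    and "\<forall>x\<in>DL. P (L x) = 0"
    and "inj_on L DL"
    and "is_core A DA (dir_sum L DL)"
    and "ess_selfadjoint_in J (range P) (\<lambda>x. P (A x)) DL"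
    and "ess_selfadjoint_in J {x. P x = 0} (\<lambda>x. A x - P (A x)) (L ` DL)"
  shows "{inf_liminf L DL (mu1 J A L) .. sup_limsup L DL (mu1 J A L)}
         \<union> {inf_liminf L DL (mu2 J A L) .. sup_limsup L DL (mu2 J A L)}
         \<subseteq> ereal ` closure (spu J A DA L DL) \<union> hat_ess_spec A DA"
proof -
  interpret balanced_setup J A DA P L DL by (rule balanced_setup.intro) fact+
  show ?thesis
  proof (intro Un_least subsetI)
    fix x assume "x \<in> {inf_liminf L DL (mu1 J A L) .. sup_limsup L DL (mu1 J A L)}"
    then show "x \<in> ereal ` closure (spu J A DA L DL) \<union> hat_ess_spec A DA"
      by (intro mu1_interval) simp_all
  next
    fix x assume "x \<in> {inf_liminf L DL (mu2 J A L) .. sup_limsup L DL (mu2 J A L)}"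
    then show "x \<in> ereal ` closure (spu J A DA L DL) \<union> hat_ess_spec A DA"
      by (intro mu2_interval) simp_all
  qed
qed

end
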